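(* The index transform $$(Ff)(\tau)=\frac{\sqrt\pi}{\cosh(\pi\tau)}\int_0^\infty e^{-x/2}\,\mathrm{Re}\left[I_{i\tau}\left(\frac x2\right)\right]f(x)\,dx,\qquad \tau\in\mathbb R,$$ is well-defined as a bounded operator $F:L_1(\mathbb R_+)\to C(\mathbb R)$, and $$\|Ff\|_{C(\mathbb R)}\equiv\sup_{\tau\in\mathbb R}|(Ff)(\tau)|\le\sqrt\pi\,\|f\|_1 .$$ Moreover, if the Mellin transform $f^*$ of $f$ satisfies $$\frac{f^*(s)}{\Gamma(1-s)}\in L_p(1-\nu-i\infty,\,1-\nu+i\infty),\qquad 0<\nu<\tfrac12,\quad 1<p\le2,$$ then $$(Ff)(\tau)=\frac{2\sqrt\pi}{\cosh(\pi\tau)}\int_0^\infty \mathrm{Re}\left[I_{i\tau}(\sqrt x)\right]K_{i\tau}(\sqrt x)\,\varphi(x)\,dx,\qquad \tau\in\mathbb R,$$ where $$\varphi(x)=\frac1{2\pi i}\int_{1-\nu-i\infty}^{1-\nu+i\infty}\frac{f^*(s)}{\Gamma(1-s)}\,x^{-s}\,ds,$$ and the latter integral converges with respect to the norm in $L_{1-\nu,q}(\mathbb R_+)$, $q=p/(p-1)$.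
   Context: $f$ is a complex-valued function on $\mathbb R_+=(0,\infty)$. $C(\mathbb R)$ is the space of bounded continuous functions on $\mathbb R$ with the sup norm. $I_\nu$ is the modified Bessel function of the first kind, $I_\nu(z)=\sum_{k\ge0}\frac{(z/2)^{2k+\nu}}{k!\,\Gamma(k+\nu+1)}$, and $K_\nu(z)=\frac{\pi}{2\sin(\pi\nu)}[I_{-\nu}(z)-I_\nu(z)]$ is the Macdonald function (for $\nu=0$ by continuity). $\|f\|_1=\int_0^\infty|f(x)|\,dx$. For real $\mu$ and $r\ge1$, $L_{\mu,r}(\mathbb R_+)$ is the space of functions with finite norm $\|f\|_{\mu,r}=\left(\int_0^\infty|f(x)|^r x^{\mu r-1}dx\right)^{1/r}$. $L_p(c-i\infty,c+i\infty)$ is the $L_p$ space on the vertical line $\mathrm{Re}\,s=c$ with respect to $|ds|$. The Mellin transform is $f^*(s)=\int_0^\infty f(x)x^{s-1}dx$ (on a line $\mathrm{Re}\,s=\mu$ the integral being understood in the mean when necessary), with the inverse transform given by $f(x)=\frac1{2\pi i}\int_{\mu-i\infty}^{\mu+i\infty}f^*(s)x^{-s}ds$, likewise understood in the mean when necessary. (The transform of $\varphi$ with kernel $\mathrm{Re}[I_{i\tau}(\sqrt x)]K_{i\tau}(\sqrt x)$ is called the Lebedev transform.) *)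

theory Defs
  imports "HOL-Analysis.Analysis"
begin

text \<open>
  The reciprocal Gamma function supplies the value 0 of 1/Gamma at the poles. The definition is meant
  for \<open>z \<noteq> 0\<close> (principal branch of the power).
\<close>

definition bessel_I :: "complex \<Rightarrow> complex \<Rightarrow> complex" where
  "bessel_I \<nu> z =
     (\<Sum>k. (z / 2) powr (2 * of_nat k + \<nu>) * rGamma (of_nat k + \<nu> + 1) / fact k)"

definition bessel_K_quot :: "complex \<Rightarrow> complex \<Rightarrow> complex" where
  "bessel_K_quot \<nu> z =
     of_real pi / (2 * sin (of_real pi * \<nu>)) * (bessel_I (- \<nu>) z - bessel_I \<nu> z)"

text \<open>For integer order (in particular order 0) the value is the limit in the order.\<close>

definition bessel_K :: "complex \<Rightarrow> complex \<Rightarrow> complex" where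
  "bessel_K \<nu> z =
     (if \<nu> \<in> \<int> then Lim (at \<nu>) (\<lambda>\<mu>. bessel_K_quot \<mu> z) else bessel_K_quot \<nu> z)"

text \<open>
  Functions on the positive half-line are functions on the reals whose values outside
  \<open>{0<..}\<close> are never used; elements of Lebesgue spaces are represented by Lebesgue measurable functions.
\<close>

definition L1_pos :: "(real \<Rightarrow> complex) set" where
  "L1_pos = {f. set_integrable lebesgue {0<..} f}"

definition L1_norm :: "(real \<Rightarrow> complex) \<Rightarrow> real" where
  "L1_norm f = (LINT x:{0<..}|lebesgue. norm (f x))"

definition weighted_Lp :: "real \<Rightarrow> real \<Rightarrow> (real \<Rightarrow> complex) set" where
  "weighted_Lp \<mu> r =
     {f. set_borel_measurable lebesgue {0<..} f \<and>
         set_integrable lebesgue {0<..} (\<lambda>x. norm (f x) powr r * x powr (\<mu> * r - 1))}"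

definition weighted_Lp_norm :: "real \<Rightarrow> real \<Rightarrow> (real \<Rightarrow> complex) \<Rightarrow> real" where
  "weighted_Lp_norm \<mu> r f =
     (LINT x:{0<..}|lebesgue. norm (f x) powr r * x powr (\<mu> * r - 1)) powr (1 / r)"

text \<open>The space \<open>L\<^sub>p(c - i\<infinity>, c + i\<infinity>)\<close>; on the line \<open>s = c + i t\<close> one has \<open>|ds| = dt\<close>.\<close>

definition line_Lp :: "real \<Rightarrow> real \<Rightarrow> (complex \<Rightarrow> complex) set" where
  "line_Lp c p =
     {h. (\<lambda>t. h (Complex c t)) \<in> borel_measurable lebesgue \<and>
         integrable lebesgue (\<lambda>t. norm (h (Complex c t)) powr p)}"

definition line_Lp_norm :: "real \<Rightarrow> real \<Rightarrow> (complex \<Rightarrow> complex) \<Rightarrow> real" where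
  "line_Lp_norm c p h = (LINT t|lebesgue. norm (h (Complex c t)) powr p) powr (1 / p)"

definition mellin_trunc :: "(real \<Rightarrow> complex) \<Rightarrow> real \<Rightarrow> complex \<Rightarrow> complex" where
  "mellin_trunc f a s = (LINT x:{1/a..a}|lebesgue. f x * of_real x powr (s - 1))"

text \<open>
  \<open>g\<close> is the Mellin transform of \<open>f\<close> on the line \<open>Re s = \<mu>\<close>: either the defining integral converges
  absolutely there, or it converges in the mean of some order \<open>r \<ge> 1\<close> on that line.
\<close>

definition is_mellin_transform ::
  "(real \<Rightarrow> complex) \<Rightarrow> real \<Rightarrow> (complex \<Rightarrow> complex) \<Rightarrow> bool" where
  "is_mellin_transform f \<mu> g \<longleftrightarrow>
     (\<forall>s. Re s = \<mu> \<longrightarrow>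
        set_integrable lebesgue {0<..} (\<lambda>x. f x * of_real x powr (s - 1)) \<and>
        g s = (LINT x:{0<..}|lebesgue. f x * of_real x powr (s - 1))) \<or>
     ((\<forall>a\<ge>1. set_integrable lebesgue {1/a..a} f) \<and>
      (\<exists>r\<ge>1. g \<in> line_Lp \<mu> r \<and>
         (\<forall>\<^sub>F a in at_top. mellin_trunc f a \<in> line_Lp \<mu> r) \<and>
         ((\<lambda>a. line_Lp_norm \<mu> r (\<lambda>s. mellin_trunc f a s - g s)) \<longlongrightarrow> 0) at_top))"

text \<open>
  The integral over the segment from \<open>c - iT\<close> to \<open>c + iT\<close> divided by \<open>2 \<pi> i\<close>; with \<open>s = c + i t\<close>,
  \<open>ds = i dt\<close>, the factor \<open>i\<close> cancels.
\<close>

definition inv_mellin_trunc :: "real \<Rightarrow> (complex \<Rightarrow> complex) \<Rightarrow> real \<Rightarrow> real \<Rightarrow> complex" where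
  "inv_mellin_trunc c h T x =
     (LINT t:{-T..T}|lebesgue. h (Complex c t) * of_real x powr (- Complex c t)) / of_real (2 * pi)"

text \<open>
  \<open>\<phi>\<close> is the inverse Mellin transform of \<open>h\<close> along \<open>Re s = c\<close>, the integral converging in the norm
  of \<open>weighted_Lp c q\<close>; this determines \<open>\<phi>\<close> up to null sets.
\<close>

definition is_inv_mellin_in_mean ::
  "real \<Rightarrow> real \<Rightarrow> (complex \<Rightarrow> complex) \<Rightarrow> (real \<Rightarrow> complex) \<Rightarrow> bool" where
  "is_inv_mellin_in_mean c q h \<phi> \<longleftrightarrow>
     \<phi> \<in> weighted_Lp c q \<and>
     (\<forall>\<^sub>F T in at_top. inv_mellin_trunc c h T \<in> weighted_Lp c q) \<and>
     ((\<lambda>T. weighted_Lp_norm c q (\<lambda>x. inv_mellin_trunc c h T x - \<phi> x)) \<longlongrightarrow> 0) at_top"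

definition F_kernel :: "real \<Rightarrow> real \<Rightarrow> real" where
  "F_kernel \<tau> x = exp (- x / 2) * Re (bessel_I (\<i> * of_real \<tau>) (of_real (x / 2)))"

definition F_transform :: "(real \<Rightarrow> complex) \<Rightarrow> real \<Rightarrow> complex" where
  "F_transform f \<tau> =
     of_real (sqrt pi / cosh (pi * \<tau>)) * (LINT x:{0<..}|lebesgue. of_real (F_kernel \<tau> x) * f x)"

definition lebedev_kernel :: "real \<Rightarrow> real \<Rightarrow> complex" where
  "lebedev_kernel \<tau> x =
     of_real (Re (bessel_I (\<i> * of_real \<tau>) (of_real (sqrt x)))) *
     bessel_K (\<i> * of_real \<tau>) (of_real (sqrt x))"

end

theory Submission
  imports Defs "HOL-Probability.Probability" "HOL-Complex_Analysis.Complex_Analysis" "HOL-Real_Asymp.Real_Asymp"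
begin

text \<open>
  Write \<open>k(y) = exp (- y/2) Re [I\<^bsub>i\<tau>\<^esub>(y/2)]\<close> for the kernel of the index transform. The representation by the
  Lebedev transform is the composition of two identities,

    \<open>2 Re [I\<^bsub>i\<tau>\<^esub>(\<surd>x)] K\<^bsub>i\<tau>\<^esub>(\<surd>x) = \<integral> k(y) exp (- x/y) dy/y\<close>  and
    \<open>f(y) = (1/y) \<integral> exp (- x/y) \<phi>(x) dx\<close>,

  with integrals over the positive half-line: inserting the second one into \<open>\<integral> k(y) f(y) dy\<close> and
  exchanging the integrations gives \<open>\<integral> 2 Re [I\<^bsub>i\<tau>\<^esub>(\<surd>x)] K\<^bsub>i\<tau>\<^esub>(\<surd>x) \<phi>(x) dx\<close>. The second identity holds because the
  Laplace-type integral multiplies the Mellin transform by \<open>\<Gamma>(1 - s)\<close>, which undoes the division in the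
  definition of \<open>\<phi>\<close>.

  What makes the exchange legitimate is the bound
  \<open>\<bar>k(y)\<bar> \<le> cosh (\<pi>\<tau>) min (1, \<surd>2 y\<^bsup>-1/2\<^esup>)\<close> of lemma \<open>abs_F_kernel_le\<close>: it makes \<open>y\<^bsup>\<nu>-1\<^esup> k(y)\<close> integrable on the
  half-line for every \<open>\<nu>\<close> between 0 and \<open>1/2\<close>. Its first half alone gives the
  boundedness of the transform on \<open>L\<^sub>1\<close> with constant \<open>\<surd>\<pi>\<close>. The bound comes from comparing the power series
  of \<open>I\<^sub>0\<close> with that of the exponential function, where the quotients of the coefficients are the central
  binomial probabilities.

  The first identity is \<open>lebedev_kernel_eq_integral\<close>. It reduces to \<open>bessel_product_formula\<close>, an integral
  for \<open>I\<^sub>\<nu>(z) K\<^sub>\<nu>(z)\<close> built from the exponential integral that represents \<open>K\<^sub>\<nu>\<close>. For a product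
  \<open>I\<^sub>\<nu>(2 \<surd>(ly)) K\<^sub>\<nu>(2 \<surd>y)\<close> with small \<open>l\<close> the formula can be checked by comparing powers of \<open>l\<close>, since the
  coefficients and the exponential integrals obey matching recurrences; analytic continuation and a limit
  carry it to equal arguments.

  The second identity must be read with care, because \<open>\<phi>\<close> is only a limit in a weighted \<open>L\<^sub>q\<close> space and the
  Mellin transform of \<open>f\<close> may itself exist in the mean only. The limit defining \<open>\<phi>\<close> exists by the
  Hausdorff-Young inequality (\<open>hausdorff_young\<close>, \<open>fourier_truncations_converge\<close>), proved by real interpolation
  between Plancherel's inequality and the trivial bound of a Fourier transform by the \<open>L\<^sub>1\<close> norm. The Laplace-type integral of \<open>\<phi>\<close> is
  computed in \<open>laplace_of_inv_mellin\<close>; it equals an inverse Fourier integral of an integrable function, the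
  decay of \<open>\<Gamma>\<close> on vertical lines having made the Mellin transform integrable. That this integral is \<open>f\<close> is
  not shown pointwise but only after integration against \<open>k\<close> (\<open>inversion_against_kernel\<close>), by smoothing with
  Gaussian kernels, for which Parseval's relation is a mere exchange of integrals.

  Throughout, \<open>x = exp v\<close> and \<open>y = exp u\<close> turn Mellin transforms into Fourier transforms on the real line.
\<close>

section \<open>Logarithmic coordinates on the half-line\<close>

text \<open>
  The substitution rule applies to \<open>exp\<close> on each interval \<open>[- n, n]\<close>; monotone convergence removes the
  restriction.
\<close>

lemma lborel_half_line_eq_distr_exp:
  "density lborel (indicator {0<..}) = distr (density lborel (\<lambda>u. ennreal (exp u))) borel (exp :: real \<Rightarrow> real)"
  (is "?M1 = ?M2")
proof (intro measure_eqI)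
  show "sets ?M1 = sets ?M2" by simp
  fix A assume "A \<in> sets ?M1"
  then have [measurable]: "A \<in> sets borel" by simp
  have fin: "(\<integral>\<^sup>+x. ennreal (indicator A x * indicator {exp (- real n)..exp (real n)} x) \<partial>lborel)
     = (\<integral>\<^sup>+u. ennreal (indicator A (exp u) * exp u * indicator {- real n..real n} u) \<partial>lborel)" for n
    by (rule nn_integral_substitution[of exp "- real n" "real n" "\<lambda>x. indicator A x" exp])
       (auto intro!: derivative_eq_intros continuous_intros simp: set_borel_measurable_def)
  have I1: "(SUP n. \<integral>\<^sup>+x. ennreal (indicator A x * indicator {exp (- real n)..exp (real n)} x) \<partial>lborel)
     = (\<integral>\<^sup>+x. (SUP n. ennreal (indicator A x * indicator {exp (- real n)..exp (real n)} x)) \<partial>lborel)"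
  proof (rule nn_integral_monotone_convergence_SUP[symmetric])
    show "incseq (\<lambda>n x. ennreal (indicator A x * indicator {exp (- real n)..exp (real n)} x))"
      unfolding incseq_def le_fun_def
      by (auto split: split_indicator intro: order_trans[of _ "exp (- real m)" for m] order_trans[of _ "exp (real m)" for m])
  qed measurable
  have I2: "(SUP n. \<integral>\<^sup>+u. ennreal (indicator A (exp u) * exp u * indicator {- real n..real n} u) \<partial>lborel)
     = (\<integral>\<^sup>+u. (SUP n. ennreal (indicator A (exp u) * exp u * indicator {- real n..real n} u)) \<partial>lborel)"
  proof (rule nn_integral_monotone_convergence_SUP[symmetric])
    show "incseq (\<lambda>n u. ennreal (indicator A (exp u) * exp u * indicator {- real n..real n} u))"
      unfolding incseq_def le_fun_def by (auto split: split_indicator)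
  qed measurable
  have S1: "(SUP n. ennreal (indicator A x * indicator {exp (- real n)..exp (real n)} x)) = indicator A x * indicator {0<..} x" for x
  proof (cases "x \<in> A \<and> x > 0")
    case True
    obtain n where n: "real n \<ge> \<bar>ln x\<bar>" using real_arch_simple by blast
    have "exp (- real n) \<le> exp (ln x)" "exp (ln x) \<le> exp (real n)"
      using n by auto
    then have "exp (- real n) \<le> x" "x \<le> exp (real n)"
      using True by auto
    then have "ennreal (indicator A x * indicator {exp (- real n)..exp (real n)} x) = 1" using True by auto
    then have "(SUP n. ennreal (indicator A x * indicator {exp (- real n)..exp (real n)} x)) \<ge> 1"
      by (intro SUP_upper2[of n]) auto
    moreover have "(SUP n. ennreal (indicator A x * indicator {exp (- real n)..exp (real n)} x)) \<le> 1"
      by (rule SUP_least) (auto split: split_indicator)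
    ultimately show ?thesis using True by auto
  next
    case False
    have "\<not> (exp (- real n) \<le> x)" if "x \<le> 0" for n using that exp_gt_zero[of "- real n"] by linarith
    then have "ennreal (indicator A x * indicator {exp (- real n)..exp (real n)} x) = 0" for n
      using False by (auto split: split_indicator)
    then show ?thesis using False by (auto split: split_indicator)
  qed
  have S2: "(SUP n. ennreal (indicator A (exp u) * exp u * indicator {- real n..real n} u)) = indicator A (exp u) * ennreal (exp u)" for u
  proof -
    obtain n where n: "real n \<ge> \<bar>u\<bar>" using real_arch_simple by blast
    have "ennreal (indicator A (exp u) * exp u * indicator {- real n..real n} u) = indicator A (exp u) * ennreal (exp u)"
      using n by (auto split: split_indicator)
    then have "(SUP n. ennreal (indicator A (exp u) * exp u * indicator {- real n..real n} u)) \<ge> indicator A (exp u) * ennreal (exp u)"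
      by (intro SUP_upper2[of n]) auto
    moreover have "(SUP n. ennreal (indicator A (exp u) * exp u * indicator {- real n..real n} u)) \<le> indicator A (exp u) * ennreal (exp u)"
      by (rule SUP_least) (auto split: split_indicator)
    ultimately show ?thesis by auto
  qed
  have "(\<integral>\<^sup>+x. indicator A x * indicator {0<..} x \<partial>lborel) = (\<integral>\<^sup>+u. indicator A (exp u) * ennreal (exp u) \<partial>lborel)"
    using I1 I2 S1 S2 fin by simp
  moreover have "emeasure ?M1 A = (\<integral>\<^sup>+x. indicator A x * indicator {0<..} x \<partial>lborel)"
    by (subst emeasure_density) (auto simp: mult.commute)
  moreover have "emeasure ?M2 A = (\<integral>\<^sup>+u. indicator A (exp u) * ennreal (exp u) \<partial>lborel)"
  proof -
    have "emeasure ?M2 A = emeasure (density lborel (\<lambda>u. ennreal (exp u))) (exp -` A)"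
      by (subst emeasure_distr) auto
    also have "\<dots> = (\<integral>\<^sup>+u. ennreal (exp u) * indicator (exp -` A) u \<partial>lborel)"
      by (subst emeasure_density) (auto intro!: measurable_sets_borel[of exp borel])
    also have "\<dots> = (\<integral>\<^sup>+u. indicator A (exp u) * ennreal (exp u) \<partial>lborel)"
      by (intro nn_integral_cong) (auto split: split_indicator)
    finally show ?thesis .
  qed
  ultimately show "emeasure ?M1 A = emeasure ?M2 A" by simp
qed

lemma nn_integral_exp_substitution:
  fixes g :: "real \<Rightarrow> ennreal"
  assumes [measurable]: "g \<in> borel_measurable borel"
  shows "(\<integral>\<^sup>+x. g x * indicator {0<..} x \<partial>lborel) = (\<integral>\<^sup>+u. g (exp u) * ennreal (exp u) \<partial>lborel)"
proof -
  have "integral\<^sup>N (density lborel (indicator {0<..})) g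
      = integral\<^sup>N (distr (density lborel (\<lambda>u. ennreal (exp u))) borel exp) g"
    by (simp add: lborel_half_line_eq_distr_exp)
  then show ?thesis
    by (simp add: nn_integral_density nn_integral_distr mult.commute)
qed

lemma AE_exp_iff:
  assumes [measurable]: "{x. P x} \<in> sets borel"
  shows "(AE x in lborel. x > (0::real) \<longrightarrow> P x) \<longleftrightarrow> (AE u in lborel. P (exp u))"
proof -
  have m: "Measurable.pred borel P" by (simp add: pred_def)
  note m[measurable]
  have P1: "(x > 0 \<longrightarrow> P x) \<longleftrightarrow> indicator {x. \<not> P x} x * indicator {0<..} x = (0::ennreal)" for x :: real
    by (auto split: split_indicator)
  have P2: "P (exp u) \<longleftrightarrow> indicator {x. \<not> P x} (exp u) * ennreal (exp u) = 0" for u :: real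
    by (auto split: split_indicator)
  have "(AE x in lborel. x > (0::real) \<longrightarrow> P x) \<longleftrightarrow> (\<integral>\<^sup>+x. indicator {x. \<not> P x} x * indicator {0<..} x \<partial>lborel) = 0"
    unfolding P1 by (subst nn_integral_0_iff_AE) simp_all
  also have "\<dots> \<longleftrightarrow> (\<integral>\<^sup>+u. indicator {x. \<not> P x} (exp u) * ennreal (exp u) \<partial>lborel) = 0"
    by (subst nn_integral_exp_substitution) simp_all
  also have "\<dots> \<longleftrightarrow> (AE u in lborel. P (exp u))"
    unfolding P2 by (subst nn_integral_0_iff_AE) simp_all
  finally show ?thesis .
qed

text \<open>
  The set where \<open>P\<close> holds need not be Borel, so the equivalence above is applied to the complement of a
  Borel null set instead.
\<close>

lemma AE_exp_imp:
  assumes "AE x in lborel. x > (0::real) \<longrightarrow> P x"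
  shows "AE u in lborel. P (exp u)"
proof -
  from assms obtain N where N: "N \<in> null_sets lborel" "{x. \<not> (x > 0 \<longrightarrow> P x)} \<subseteq> N"
    by (auto simp: eventually_ae_filter)
  have "AE x in lborel. x > 0 \<longrightarrow> x \<notin> N" using AE_not_in[OF N(1)] by auto
  moreover have "{x. x \<notin> N} \<in> sets borel" 
    using N(1) by (auto simp: null_sets_def Collect_neg_eq)
  ultimately have "AE u in lborel. exp u \<notin> N" using AE_exp_iff[of "\<lambda>x. x \<notin> N"] by auto
  then show ?thesis
  proof eventually_elim
    case (elim u)
    then show ?case using N(2) exp_gt_zero[of u] by blast
  qed
qed

lemma AE_exp_imp_rev:
  assumes "AE u in lborel. P (exp u)"
  shows "AE x in lborel. x > (0::real) \<longrightarrow> P x"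
proof -
  from assms obtain N where N: "N \<in> null_sets lborel" "{u. \<not> P (exp u)} \<subseteq> N"
    by (auto simp: eventually_ae_filter)
  have Nb[measurable]: "N \<in> sets borel" using N(1) by auto
  have m: "{x. ln x \<notin> N} \<in> sets borel" by measurable
  have "AE u in lborel. ln (exp u) \<notin> N" using AE_not_in[OF N(1)] by auto
  then have "AE x in lborel. x > 0 \<longrightarrow> ln x \<notin> N" using AE_exp_iff[OF m] by auto
  then show ?thesis
  proof eventually_elim
    case (elim x)
    then show ?case using N(2) by (auto dest!: subsetD[of _ _ "ln x"])
  qed
qed

text \<open>
  Borel functions, unlike Lebesgue measurable ones, stay measurable under composition with maps such as
  \<open>(u, v) \<mapsto> v - u\<close>, so the data are replaced by Borel functions before any computation.
\<close>

lemma lebesgue_borel_representative: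
  fixes f :: "real \<Rightarrow> complex"
  assumes "f \<in> borel_measurable lebesgue"
  shows "\<exists>g\<in>borel_measurable borel. AE x in lborel. f x = g x"
proof -
  have mRe: "(\<lambda>x. Re (f x)) \<in> borel_measurable lebesgue"
    by (rule measurable_compose[OF assms]) (simp add: borel_measurable_continuous_onI continuous_on_Re)
  have mIm: "(\<lambda>x. Im (f x)) \<in> borel_measurable lebesgue"
    by (rule measurable_compose[OF assms]) (simp add: borel_measurable_continuous_onI continuous_on_Im)
  obtain a where a: "a \<in> borel_measurable lborel" "AE x in lborel. Re (f x) = a x"
    using completion_ex_borel_measurable_real[OF mRe] by (elim bexE)
  obtain b where b: "b \<in> borel_measurable lborel" "AE x in lborel. Im (f x) = b x"
    using completion_ex_borel_measurable_real[OF mIm] by (elim bexE)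
  have "(\<lambda>x. complex_of_real (a x) + \<i> * complex_of_real (b x)) \<in> borel_measurable borel"
    using a(1) b(1) by (intro borel_measurable_add borel_measurable_times borel_measurable_const measurable_compose[OF _ borel_measurable_of_real]) auto
  moreover have "AE x in lborel. f x = complex_of_real (a x) + \<i> * complex_of_real (b x)"
    using a(2) b(2) by eventually_elim (simp add: complex_eq_iff)
  ultimately show ?thesis by (intro bexI)
qed

lemma integral_exp_substitution:
  fixes g :: "real \<Rightarrow> 'b::{banach, second_countable_topology}"
  assumes [measurable]: "g \<in> borel_measurable borel"
  shows "integrable lborel (\<lambda>x. indicat_real {0<..} x *\<^sub>R g x) \<longleftrightarrow> integrable lborel (\<lambda>u. exp u *\<^sub>R g (exp u))"
    and "(\<integral>x. indicat_real {0<..} x *\<^sub>R g x \<partial>lborel) = (\<integral>u. exp u *\<^sub>R g (exp u) \<partial>lborel)"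
proof -
  define M1 where "M1 = density lborel (\<lambda>x::real. ennreal (indicat_real {0<..} x))"
  define M2 where "M2 = distr (density lborel (\<lambda>u. ennreal (exp u))) borel exp"
  have eq: "M1 = M2"
    unfolding M1_def M2_def lborel_half_line_eq_distr_exp[symmetric] by (simp add: ennreal_indicator)
  have "integrable M1 g \<longleftrightarrow> integrable M2 g" "integral\<^sup>L M1 g = integral\<^sup>L M2 g" using eq by auto
  moreover have "integrable M1 g \<longleftrightarrow> integrable lborel (\<lambda>x. indicat_real {0<..} x *\<^sub>R g x)"
    unfolding M1_def by (rule integrable_density) simp_all
  moreover have "integral\<^sup>L M1 g = (\<integral>x. indicat_real {0<..} x *\<^sub>R g x \<partial>lborel)"
    unfolding M1_def by (rule integral_density) simp_all
  moreover have "integrable M2 g \<longleftrightarrow> integrable (density lborel (\<lambda>u. ennreal (exp u))) (\<lambda>u. g (exp u))"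
    unfolding M2_def by (rule integrable_distr_eq) simp_all
  moreover have "integral\<^sup>L M2 g = integral\<^sup>L (density lborel (\<lambda>u. ennreal (exp u))) (\<lambda>u. g (exp u))"
    unfolding M2_def by (rule integral_distr) simp_all
  moreover have "integrable (density lborel (\<lambda>u. ennreal (exp u))) (\<lambda>u. g (exp u)) \<longleftrightarrow> integrable lborel (\<lambda>u. exp u *\<^sub>R g (exp u))"
    by (rule integrable_density) simp_all
  moreover have "integral\<^sup>L (density lborel (\<lambda>u. ennreal (exp u))) (\<lambda>u. g (exp u)) = (\<integral>u. exp u *\<^sub>R g (exp u) \<partial>lborel)"
    by (rule integral_density) simp_all
  ultimately show "integrable lborel (\<lambda>x. indicat_real {0<..} x *\<^sub>R g x) \<longleftrightarrow> integrable lborel (\<lambda>u. exp u *\<^sub>R g (exp u))"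
    and "(\<integral>x. indicat_real {0<..} x *\<^sub>R g x \<partial>lborel) = (\<integral>u. exp u *\<^sub>R g (exp u) \<partial>lborel)"
    by simp_all
qed

text \<open>
  The form in which every integral over the half-line is moved to the real line: \<open>G\<close> is a Borel
  representative of \<open>f \<circ> exp\<close>.
\<close>

lemma half_line_integral_log:
  fixes f G :: "real \<Rightarrow> 'b::euclidean_space"
  assumes [measurable]: "G \<in> borel_measurable borel" and ae: "AE u in lborel. f (exp u) = G u"
  shows "set_integrable lebesgue {0<..} f \<longleftrightarrow> integrable lborel (\<lambda>u. exp u *\<^sub>R G u)"
    and "(LINT x:{0<..}|lebesgue. f x) = (\<integral>u. exp u *\<^sub>R G u \<partial>lborel)"
    and "set_borel_measurable lebesgue {0<..} f"
proof -
  have [measurable]: "(\<lambda>x. G (ln x)) \<in> borel_measurable borel" by measurable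
  have "AE u in lborel. f (exp u) = G (ln (exp u))" using ae by simp
  from AE_exp_imp_rev[of "\<lambda>x. f x = G (ln x)", OF this] have "AE x in lborel. x > 0 \<longrightarrow> f x = G (ln x)" by simp
  then have ae': "AE x in lebesgue. indicat_real {0<..} x *\<^sub>R f x = indicat_real {0<..} x *\<^sub>R G (ln x)"
    by (subst AE_completion_iff) (auto split: split_indicator)
  have mG: "(\<lambda>x. indicat_real {0<..} x *\<^sub>R G (ln x)) \<in> borel_measurable lborel" by measurable
  then have mG': "(\<lambda>x. indicat_real {0<..} x *\<^sub>R G (ln x)) \<in> borel_measurable lebesgue"
    by (rule measurable_completion)
  have mf: "(\<lambda>x. indicat_real {0<..} x *\<^sub>R f x) \<in> borel_measurable lebesgue"
    using ae' by (intro borel_measurable_AE[OF mG']) (auto elim: eventually_mono)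
  show "set_borel_measurable lebesgue {0<..} f" using mf by (simp add: set_borel_measurable_def)
  have "set_integrable lebesgue {0<..} f \<longleftrightarrow> integrable lebesgue (\<lambda>x. indicat_real {0<..} x *\<^sub>R G (ln x))"
    unfolding set_integrable_def by (rule integrable_cong_AE[OF mf mG' ae'])
  also have "\<dots> \<longleftrightarrow> integrable lborel (\<lambda>u. exp u *\<^sub>R G u)"
    using integral_exp_substitution(1)[of "\<lambda>x. G (ln x)"] by (simp add: integrable_completion[OF mG])
  finally show "set_integrable lebesgue {0<..} f \<longleftrightarrow> integrable lborel (\<lambda>u. exp u *\<^sub>R G u)" .
  have "(LINT x:{0<..}|lebesgue. f x) = integral\<^sup>L lebesgue (\<lambda>x. indicat_real {0<..} x *\<^sub>R G (ln x))"
    unfolding set_lebesgue_integral_def by (rule integral_cong_AE[OF mf mG' ae'])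
  then show "(LINT x:{0<..}|lebesgue. f x) = (\<integral>u. exp u *\<^sub>R G u \<partial>lborel)"
    using integral_exp_substitution(2)[of "\<lambda>x. G (ln x)"] by (simp add: integral_completion[OF mG])
qed

lemma half_line_log_representative:
  fixes f :: "real \<Rightarrow> complex"
  assumes "set_borel_measurable lebesgue {0<..} f"
  obtains G where "G \<in> borel_measurable borel" "AE u in lborel. f (exp u) = G u"
proof -
  from lebesgue_borel_representative[OF assms[unfolded set_borel_measurable_def]]
  obtain g where [measurable]: "g \<in> borel_measurable borel" and g: "AE x in lborel. indicat_real {0<..} x *\<^sub>R f x = g x" by blast
  have "AE x in lborel. x > 0 \<longrightarrow> f x = g x" using g by eventually_elim auto
  from AE_exp_imp[OF this] have "AE u in lborel. f (exp u) = g (exp u)" by simp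
  moreover have "(\<lambda>u. g (exp u)) \<in> borel_measurable borel" by measurable
  ultimately show ?thesis using that by blast
qed

section \<open>The Fourier transform and the Plancherel inequality\<close>

lemma measurable_cis [measurable (raw)]:
  "f \<in> borel_measurable M \<Longrightarrow> (\<lambda>x. cis (f x)) \<in> borel_measurable M"
  by (rule measurable_compose[where g = cis and N = borel]) (auto intro!: borel_measurable_continuous_onI continuous_intros)

lemma measurable_cnj [measurable (raw)]:
  "f \<in> borel_measurable M \<Longrightarrow> (\<lambda>x. cnj (f x)) \<in> borel_measurable M"
  by (rule measurable_compose[where g = cnj and N = borel]) (auto intro!: borel_measurable_continuous_onI continuous_intros)

text \<open>
  Without a normalising factor, so that \<open>2 \<pi>\<close> appears in the Plancherel inequality and in inversion formulas.
\<close>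

definition fourier :: "(real \<Rightarrow> complex) \<Rightarrow> real \<Rightarrow> complex" where
  "fourier h u = (\<integral>t. h t * cis (- (t * u)) \<partial>lborel)"

lemma measurable_fourier [measurable]:
  assumes [measurable]: "h \<in> borel_measurable borel"
  shows "fourier h \<in> borel_measurable borel"
  unfolding fourier_def by measurable

lemma integrable_mult_cis:
  assumes [measurable]: "h \<in> borel_measurable borel" "g \<in> borel_measurable borel" and h: "integrable lborel h"
  shows "integrable lborel (\<lambda>t. h t * cis (g t))"
  by (rule Bochner_Integration.integrable_bound[OF h]) (auto simp: norm_mult)

lemma norm_fourier_le:
  assumes [measurable]: "h \<in> borel_measurable borel"
  shows "norm (fourier h u) \<le> (\<integral>t. norm (h t) \<partial>lborel)"
proof -
  have "norm (fourier h u) \<le> (\<integral>t. norm (h t * cis (- (t * u))) \<partial>lborel)"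
    unfolding fourier_def by (rule integral_norm_bound)
  then show ?thesis by (simp add: norm_mult)
qed

text \<open>
  A rescaling of the characteristic function of the standard normal distribution.
\<close>

lemma integral_gaussian_cis:
  fixes s \<theta> :: real
  assumes s: "s > 0"
  shows "integrable lborel (\<lambda>u. complex_of_real (exp (- (u / s)\<^sup>2 / 2)) * cis (\<theta> * u))"
    and "(\<integral>u. complex_of_real (exp (- (u / s)\<^sup>2 / 2)) * cis (\<theta> * u) \<partial>lborel) = of_real (s * sqrt (2 * pi) * exp (- (\<theta> * s)\<^sup>2 / 2))"
proof -
  have "char std_normal_distribution (\<theta> * s) = (\<integral>x. std_normal_density x *\<^sub>R iexp (\<theta> * s * x) \<partial>lborel)"
    unfolding char_def by (subst integral_density) auto
  then have 1: "(\<integral>x. std_normal_density x *\<^sub>R cis (\<theta> * s * x) \<partial>lborel) = of_real (exp (- (\<theta> * s)\<^sup>2 / 2))"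
    by (simp add: char_std_normal_distribution cis_conv_exp)
  have i1: "integrable lborel (\<lambda>x. std_normal_density x *\<^sub>R cis (\<theta> * s * x))"
    by (rule Bochner_Integration.integrable_bound[of _ std_normal_density]) auto
  have eq: "complex_of_real (exp (- ((0 + s * x) / s)\<^sup>2 / 2)) * cis (\<theta> * (0 + s * x)) = sqrt (2 * pi) *\<^sub>R (std_normal_density x *\<^sub>R cis (\<theta> * s * x))" for x
    using s by (simp add: std_normal_density_def scaleR_conv_of_real mult.assoc)
  have "integrable lborel (\<lambda>x. complex_of_real (exp (- ((0 + s * x) / s)\<^sup>2 / 2)) * cis (\<theta> * (0 + s * x)))"
    unfolding eq by (intro integrable_scaleR_right i1)
  then show "integrable lborel (\<lambda>u. complex_of_real (exp (- (u / s)\<^sup>2 / 2)) * cis (\<theta> * u))"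
    by (subst (asm) lborel_integrable_real_affine_iff) (use s in auto)
  have "(\<integral>u. complex_of_real (exp (- (u / s)\<^sup>2 / 2)) * cis (\<theta> * u) \<partial>lborel) = \<bar>s\<bar> *\<^sub>R (\<integral>x. complex_of_real (exp (- ((0 + s * x) / s)\<^sup>2 / 2)) * cis (\<theta> * (0 + s * x)) \<partial>lborel)"
    by (rule lborel_integral_real_affine) (use s in auto)
  also have "\<dots> = s *\<^sub>R (sqrt (2 * pi) *\<^sub>R of_real (exp (- (\<theta> * s)\<^sup>2 / 2)))"
    unfolding eq integral_scaleR_right 1 using s by simp
  finally show "(\<integral>u. complex_of_real (exp (- (u / s)\<^sup>2 / 2)) * cis (\<theta> * u) \<partial>lborel) = of_real (s * sqrt (2 * pi) * exp (- (\<theta> * s)\<^sup>2 / 2))"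
    by (simp add: scaleR_conv_of_real)
qed

lemma integral_gaussian:
  fixes s :: real
  assumes s: "s > 0"
  shows "integrable lborel (\<lambda>u. exp (- (u / s)\<^sup>2 / 2))"
    and "(\<integral>u. exp (- (u / s)\<^sup>2 / 2) \<partial>lborel) = s * sqrt (2 * pi)"
proof -
  have 1: "integrable lborel (\<lambda>u. complex_of_real (exp (- (u / s)\<^sup>2 / 2)))" "(\<integral>u. complex_of_real (exp (- (u / s)\<^sup>2 / 2)) \<partial>lborel) = of_real (s * sqrt (2 * pi))"
    using integral_gaussian_cis[OF s, of 0] by auto
  show i: "integrable lborel (\<lambda>u. exp (- (u / s)\<^sup>2 / 2))" using integrable_Re[OF 1(1)] by simp
  show "(\<integral>u. exp (- (u / s)\<^sup>2 / 2) \<partial>lborel) = s * sqrt (2 * pi)"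
    using 1(2) unfolding integral_complex_of_real of_real_eq_iff .
qed

lemma nn_integral_gaussian_translate:
  fixes n t :: real
  assumes n: "n > 0"
  shows "(\<integral>\<^sup>+s. ennreal (n * sqrt (2 * pi) * exp (- ((s - t) * n)\<^sup>2 / 2)) \<partial>lborel) = ennreal (2 * pi)"
proof -
  have "(\<integral>\<^sup>+s. ennreal (n * sqrt (2 * pi) * exp (- ((s - t) * n)\<^sup>2 / 2)) \<partial>lborel) =
     (\<integral>\<^sup>+s. ennreal (n * sqrt (2 * pi) * exp (- ((t + 1 * s - t) * n)\<^sup>2 / 2)) \<partial>lborel)"
    by (subst nn_integral_real_affine[where c = 1 and t = t]) simp_all
  also have "\<dots> = (\<integral>\<^sup>+s. ennreal (n * sqrt (2 * pi)) * ennreal (exp (- (s / (1 / n))\<^sup>2 / 2)) \<partial>lborel)"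
    using n by (intro nn_integral_cong) (simp add: ennreal_mult)
  also have "\<dots> = ennreal (n * sqrt (2 * pi)) * (\<integral>\<^sup>+s. ennreal (exp (- (s / (1 / n))\<^sup>2 / 2)) \<partial>lborel)"
    by (rule nn_integral_cmult) simp
  also have "(\<integral>\<^sup>+s. ennreal (exp (- (s / (1 / n))\<^sup>2 / 2)) \<partial>lborel) = ennreal (1 / n * sqrt (2 * pi))"
    by (subst nn_integral_eq_integral) (use n integral_gaussian[of "1 / n"] in auto)
  also have "ennreal (n * sqrt (2 * pi)) * ennreal (1 / n * sqrt (2 * pi)) = ennreal (2 * pi)"
    using n by (simp flip: ennreal_mult)
  finally show ?thesis .
qed

lemma norm_integral_le_nn_integral:
  fixes f :: "'a \<Rightarrow> 'b::{banach, second_countable_topology}"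
  shows "ennreal (norm (integral\<^sup>L M f)) \<le> (\<integral>\<^sup>+x. ennreal (norm (f x)) \<partial>M)"
proof (cases "integrable M f")
  case True
  then show ?thesis by (rule integral_norm_bound_ennreal)
next
  case False
  then show ?thesis by (simp add: not_integrable_integral_eq)
qed

lemma integrable_tensor_product:
  fixes f g :: "real \<Rightarrow> real"
  assumes f: "integrable lborel f" and g: "integrable lborel g"
  shows "integrable (lborel \<Otimes>\<^sub>M lborel) (\<lambda>(s, u). f s * g u)"
proof (rule lborel_pair.Fubini_integrable)
  have [measurable]: "f \<in> borel_measurable borel" "g \<in> borel_measurable borel" using f g by auto
  show "(\<lambda>(s, u). f s * g u) \<in> borel_measurable (lborel \<Otimes>\<^sub>M lborel)" by measurable
  show "integrable lborel (\<lambda>x. LBINT y. norm (case (x, y) of (s, u) \<Rightarrow> f s * g u))"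
    using f by (simp add: abs_mult)
  show "AE x in lborel. integrable lborel (\<lambda>y. case (x, y) of (s, u) \<Rightarrow> f s * g u)"
    using g by simp
qed

text \<open>
  With the Gaussian factor the integral of the squared transform is an absolutely convergent triple
  integral, equal to the quadratic form of \<open>h\<close> with a Gaussian kernel \<open>K\<close> whose integral in either variable is
  \<open>2 \<pi>\<close>. Estimating \<open>\<bar>h(t) h(s)\<bar>\<close> by the mean of the squares and integrating out one variable (Schur's
  test) bounds the form.
\<close>

lemma plancherel_gaussian:
  fixes n :: real
  assumes [measurable]: "h \<in> borel_measurable borel" and h: "integrable lborel h" and n: "n > 0"
  shows "(\<integral>\<^sup>+u. ennreal ((norm (fourier h u))\<^sup>2 * exp (- (u / n)\<^sup>2 / 2)) \<partial>lborel) \<le> ennreal (2 * pi) * (\<integral>\<^sup>+t. ennreal ((norm (h t))\<^sup>2) \<partial>lborel)"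
proof -
  define w where "w = (\<lambda>u. exp (- (u / n)\<^sup>2 / 2))"
  define K where "K = (\<lambda>s t. n * sqrt (2 * pi) * exp (- ((s - t) * n)\<^sup>2 / 2))"
  have [measurable]: "w \<in> borel_measurable borel" unfolding w_def by measurable
  have [measurable]: "(\<lambda>(s,t). K s t) \<in> borel_measurable (borel \<Otimes>\<^sub>M borel)" unfolding K_def by measurable
  have Kc: "(\<lambda>s. K s t) \<in> borel_measurable borel" for t unfolding K_def by measurable
  note [measurable] = Kc
  have wpos: "w u > 0" for u by (simp add: w_def)
  have wint: "integrable lborel w" unfolding w_def by (rule integral_gaussian[OF n])
  have Kpos: "K s t \<ge> 0" for s t using n by (simp add: K_def)
  have Ksym: "K s t = K t s" for s t by (simp add: K_def power2_eq_square algebra_simps)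
  define B where "B = (\<integral>t. norm (h t) \<partial>lborel)"
  have B: "norm (fourier h u) \<le> B" for u unfolding B_def by (rule norm_fourier_le) simp
  have B0: "B \<ge> 0" unfolding B_def by simp
  have hn: "integrable lborel (\<lambda>t. norm (h t))" using h by simp
  have inner: "(\<integral>u. cis (- (t * u)) * (cnj (fourier h u) * of_real (w u)) \<partial>lborel) = (\<integral>s. cnj (h s) * of_real (K s t) \<partial>lborel)" for t
  proof -
    have "(\<integral>u. cis (- (t * u)) * (cnj (fourier h u) * of_real (w u)) \<partial>lborel) = 
       (\<integral>u. (\<integral>s. cnj (h s) * (of_real (w u) * cis ((s - t) * u)) \<partial>lborel) \<partial>lborel)"
    proof (rule Bochner_Integration.integral_cong[OF refl])
      fix u
      have "cnj (fourier h u) = (\<integral>s. cnj (h s) * cis (s * u) \<partial>lborel)"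
        using Bochner_Integration.integral_cnj[of lborel "\<lambda>s. h s * cis (- (s * u))"] by (simp add: cis_cnj fourier_def)
      then have "cis (- (t * u)) * (cnj (fourier h u) * of_real (w u)) = (\<integral>s. (cis (- (t * u)) * of_real (w u)) * (cnj (h s) * cis (s * u)) \<partial>lborel)"
        by (simp only: integral_mult_right_zero)
           (simp only: mult.assoc mult.commute mult.left_commute)
      also have "\<dots> = (\<integral>s. cnj (h s) * (of_real (w u) * cis ((s - t) * u)) \<partial>lborel)"
      proof (rule Bochner_Integration.integral_cong[OF refl])
        fix s
        have "cis (- (t * u)) * cis (s * u) = cis ((s - t) * u)" by (simp add: cis_mult algebra_simps)
        then show "(cis (- (t * u)) * of_real (w u)) * (cnj (h s) * cis (s * u)) = cnj (h s) * (of_real (w u) * cis ((s - t) * u))"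
          by (metis (no_types, opaque_lifting) mult.assoc mult.commute)
      qed
      finally show "cis (- (t * u)) * (cnj (fourier h u) * of_real (w u)) = (\<integral>s. cnj (h s) * (of_real (w u) * cis ((s - t) * u)) \<partial>lborel)" .
    qed
    also have "\<dots> = (\<integral>s. (\<integral>u. cnj (h s) * (of_real (w u) * cis ((s - t) * u)) \<partial>lborel) \<partial>lborel)"
    proof (rule lborel_pair.Fubini_integral)
      have "integrable (lborel \<Otimes>\<^sub>M lborel) (\<lambda>(s,u). norm (h s) * w u)"
        by (rule integrable_tensor_product[OF hn wint])
      then show "integrable (lborel \<Otimes>\<^sub>M lborel) (\<lambda>(s, u). cnj (h s) * (of_real (w u) * cis ((s - t) * u)))"
      proof (rule Bochner_Integration.integrable_bound)
        show "(\<lambda>(s, u). cnj (h s) * (of_real (w u) * cis ((s - t) * u))) \<in> borel_measurable (lborel \<Otimes>\<^sub>M lborel)"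
          by measurable
      qed (auto simp: norm_mult less_imp_le[OF wpos])
    qed
    also have "\<dots> = (\<integral>s. cnj (h s) * of_real (K s t) \<partial>lborel)"
    proof (rule Bochner_Integration.integral_cong[OF refl])
      fix s
      show "(\<integral>u. cnj (h s) * (of_real (w u) * cis ((s - t) * u)) \<partial>lborel) = cnj (h s) * of_real (K s t)"
        unfolding w_def K_def using integral_gaussian_cis(2)[OF n, of "s - t"] by simp
    qed
    finally show ?thesis .
  qed
  have "(\<integral>u. of_real ((norm (fourier h u))\<^sup>2 * w u) \<partial>lborel) = (\<integral>u. (\<integral>t. h t * (cis (- (t * u)) * (cnj (fourier h u) * of_real (w u))) \<partial>lborel) \<partial>lborel)"
  proof (rule Bochner_Integration.integral_cong[OF refl])
    fix u
    have "of_real ((norm (fourier h u))\<^sup>2 * w u) = fourier h u * (cnj (fourier h u) * of_real (w u))"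
      using complex_norm_square[of "fourier h u"] by (simp add: mult.assoc)
    also have "\<dots> = (\<integral>t. h t * cis (- (t * u)) * (cnj (fourier h u) * of_real (w u)) \<partial>lborel)"
      unfolding fourier_def by simp
    finally show "of_real ((norm (fourier h u))\<^sup>2 * w u) = (\<integral>t. h t * (cis (- (t * u)) * (cnj (fourier h u) * of_real (w u))) \<partial>lborel)"
      by (simp add: mult.assoc)
  qed
  also have "\<dots> = (\<integral>t. (\<integral>u. h t * (cis (- (t * u)) * (cnj (fourier h u) * of_real (w u))) \<partial>lborel) \<partial>lborel)"
  proof (rule lborel_pair.Fubini_integral)
    have "integrable (lborel \<Otimes>\<^sub>M lborel) (\<lambda>(s,u). norm (h s) * (B * w u))"
      by (rule integrable_tensor_product) (use hn wint in auto)
    then show "integrable (lborel \<Otimes>\<^sub>M lborel) (\<lambda>(t, u). h t * (cis (- (t * u)) * (cnj (fourier h u) * of_real (w u))))"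
    proof (rule Bochner_Integration.integrable_bound)
      show "(\<lambda>(t, u). h t * (cis (- (t * u)) * (cnj (fourier h u) * of_real (w u)))) \<in> borel_measurable (lborel \<Otimes>\<^sub>M lborel)"
        by measurable
      show "AE x in lborel \<Otimes>\<^sub>M lborel. norm (case x of (t, u) \<Rightarrow> h t * (cis (- (t * u)) * (cnj (fourier h u) * of_real (w u))))
            \<le> norm (case x of (s, u) \<Rightarrow> norm (h s) * (B * w u))"
        using B B0 wpos by (auto simp: norm_mult abs_mult less_imp_le intro!: AE_I2 mult_left_mono mult_right_mono)
    qed
  qed
  also have "\<dots> = (\<integral>t. h t * (\<integral>s. cnj (h s) * of_real (K s t) \<partial>lborel) \<partial>lborel)"
    by (simp add: inner)
  finally have main: "(\<integral>u. complex_of_real ((norm (fourier h u))\<^sup>2 * w u) \<partial>lborel) = (\<integral>t. h t * (\<integral>s. cnj (h s) * of_real (K s t) \<partial>lborel) \<partial>lborel)" .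
  have int: "integrable lborel (\<lambda>u. (norm (fourier h u))\<^sup>2 * w u)"
  proof (rule Bochner_Integration.integrable_bound)
    show "integrable lborel (\<lambda>u. B\<^sup>2 * w u)" using wint by simp
  qed (auto simp: less_imp_le[OF wpos] B0 intro!: mult_right_mono power_mono B)
  have "(\<integral>\<^sup>+u. ennreal ((norm (fourier h u))\<^sup>2 * w u) \<partial>lborel) = ennreal (\<integral>u. (norm (fourier h u))\<^sup>2 * w u \<partial>lborel)"
    by (rule nn_integral_eq_integral[OF int]) (simp add: less_imp_le[OF wpos])
  also have "(\<integral>u. (norm (fourier h u))\<^sup>2 * w u \<partial>lborel) = norm (\<integral>u. complex_of_real ((norm (fourier h u))\<^sup>2 * w u) \<partial>lborel)"
    by (simp only: integral_complex_of_real norm_of_real) (simp add: less_imp_le[OF wpos])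
  also have "ennreal \<dots> \<le> (\<integral>\<^sup>+t. norm (h t * (\<integral>s. cnj (h s) * of_real (K s t) \<partial>lborel)) \<partial>lborel)"
    unfolding main by (rule norm_integral_le_nn_integral)
  also have "\<dots> \<le> (\<integral>\<^sup>+t. \<integral>\<^sup>+s. ennreal (norm (h t) * norm (h s) * K s t) \<partial>lborel \<partial>lborel)"
  proof (rule nn_integral_mono)
    fix t
    have "ennreal (norm (\<integral>s. cnj (h s) * of_real (K s t) \<partial>lborel)) \<le> (\<integral>\<^sup>+s. norm (cnj (h s) * of_real (K s t)) \<partial>lborel)"
      by (rule norm_integral_le_nn_integral)
    then have "ennreal (norm (h t)) * ennreal (norm (\<integral>s. cnj (h s) * of_real (K s t) \<partial>lborel)) \<le> ennreal (norm (h t)) * (\<integral>\<^sup>+s. norm (cnj (h s) * of_real (K s t)) \<partial>lborel)"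
      by (rule mult_left_mono) simp
    also have "\<dots> = (\<integral>\<^sup>+s. ennreal (norm (h t) * norm (h s) * K s t) \<partial>lborel)"
      by (subst nn_integral_cmult[symmetric]) (auto simp: norm_mult Kpos ennreal_mult mult.assoc)
    finally show "ennreal (norm (h t * (\<integral>s. cnj (h s) * of_real (K s t) \<partial>lborel))) \<le> (\<integral>\<^sup>+s. ennreal (norm (h t) * norm (h s) * K s t) \<partial>lborel)"
      by (simp add: norm_mult ennreal_mult)
  qed
  also have "\<dots> \<le> (\<integral>\<^sup>+t. \<integral>\<^sup>+s. ennreal ((norm (h t))\<^sup>2 / 2 * K s t) + ennreal ((norm (h s))\<^sup>2 / 2 * K s t) \<partial>lborel \<partial>lborel)"
  proof (intro nn_integral_mono)
    fix s t
    have "norm (h t) * norm (h s) \<le> (norm (h t))\<^sup>2 / 2 + (norm (h s))\<^sup>2 / 2"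
      using sum_squares_bound[of "norm (h t)" "norm (h s)"] by (simp add: field_simps)
    from mult_right_mono[OF this Kpos[of s t]]
    show "ennreal (norm (h t) * norm (h s) * K s t) \<le> ennreal ((norm (h t))\<^sup>2 / 2 * K s t) + ennreal ((norm (h s))\<^sup>2 / 2 * K s t)"
      by (subst ennreal_plus[symmetric]) (simp_all only: Kpos distrib_right ennreal_leI mult_nonneg_nonneg zero_le_power2 divide_nonneg_pos zero_less_numeral)
  qed
  also have "\<dots> = (\<integral>\<^sup>+t. \<integral>\<^sup>+s. ennreal ((norm (h t))\<^sup>2 / 2 * K s t) \<partial>lborel \<partial>lborel) + (\<integral>\<^sup>+t. \<integral>\<^sup>+s. ennreal ((norm (h s))\<^sup>2 / 2 * K s t) \<partial>lborel \<partial>lborel)"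
    by (subst nn_integral_add[symmetric]) (auto intro!: nn_integral_cong nn_integral_add)
  also have "(\<integral>\<^sup>+t. \<integral>\<^sup>+s. ennreal ((norm (h s))\<^sup>2 / 2 * K s t) \<partial>lborel \<partial>lborel) = (\<integral>\<^sup>+s. \<integral>\<^sup>+t. ennreal ((norm (h s))\<^sup>2 / 2 * K s t) \<partial>lborel \<partial>lborel)"
    by (rule lborel_pair.Fubini') measurable
  also have "\<dots> = (\<integral>\<^sup>+t. \<integral>\<^sup>+s. ennreal ((norm (h t))\<^sup>2 / 2 * K s t) \<partial>lborel \<partial>lborel)"
    by (subst Ksym) simp
  also have "(\<integral>\<^sup>+t. \<integral>\<^sup>+s. ennreal ((norm (h t))\<^sup>2 / 2 * K s t) \<partial>lborel \<partial>lborel) = (\<integral>\<^sup>+t. ennreal (2 * pi) * ennreal ((norm (h t))\<^sup>2 / 2) \<partial>lborel)"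
  proof (rule nn_integral_cong)
    fix t
    have "(\<integral>\<^sup>+s. ennreal ((norm (h t))\<^sup>2 / 2 * K s t) \<partial>lborel) = ennreal ((norm (h t))\<^sup>2 / 2) * (\<integral>\<^sup>+s. ennreal (K s t) \<partial>lborel)"
      by (subst nn_integral_cmult[symmetric]) (auto simp: Kpos simp flip: ennreal_mult)
    then show "(\<integral>\<^sup>+s. ennreal ((norm (h t))\<^sup>2 / 2 * K s t) \<partial>lborel) = ennreal (2 * pi) * ennreal ((norm (h t))\<^sup>2 / 2)"
      unfolding K_def nn_integral_gaussian_translate[OF n] by (simp add: mult.commute)
  qed
  also have "\<dots> = ennreal (2 * pi) * (\<integral>\<^sup>+t. ennreal ((norm (h t))\<^sup>2 / 2) \<partial>lborel)"
    by (rule nn_integral_cmult) simp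
  also have "\<dots> + \<dots> = ennreal (2 * pi) * ((\<integral>\<^sup>+t. ennreal ((norm (h t))\<^sup>2 / 2) \<partial>lborel) + (\<integral>\<^sup>+t. ennreal ((norm (h t))\<^sup>2 / 2) \<partial>lborel))"
    by (simp add: distrib_left)
  also have "(\<integral>\<^sup>+t. ennreal ((norm (h t))\<^sup>2 / 2) \<partial>lborel) + (\<integral>\<^sup>+t. ennreal ((norm (h t))\<^sup>2 / 2) \<partial>lborel) = (\<integral>\<^sup>+t. ennreal ((norm (h t))\<^sup>2) \<partial>lborel)"
    by (subst nn_integral_add[symmetric]) (auto intro!: nn_integral_cong simp flip: ennreal_plus)
  finally show ?thesis unfolding w_def .
qed

text \<open>
  Fatou's lemma removes the Gaussian factor, as its width tends to infinity.
\<close>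

lemma plancherel_le:
  assumes [measurable]: "h \<in> borel_measurable borel" and h: "integrable lborel h"
  shows "(\<integral>\<^sup>+u. ennreal ((norm (fourier h u))\<^sup>2) \<partial>lborel) \<le> ennreal (2 * pi) * (\<integral>\<^sup>+t. ennreal ((norm (h t))\<^sup>2) \<partial>lborel)"
proof -
  define f where "f = (\<lambda>n u. ennreal ((norm (fourier h u))\<^sup>2 * exp (- (u / real (Suc n))\<^sup>2 / 2)))"
  have [measurable]: "f n \<in> borel_measurable lborel" for n unfolding f_def by measurable
  have "(\<integral>\<^sup>+u. ennreal ((norm (fourier h u))\<^sup>2) \<partial>lborel) = (\<integral>\<^sup>+u. liminf (\<lambda>n. f n u) \<partial>lborel)"
  proof (rule nn_integral_cong)
    fix u
    have "(\<lambda>n. u / real (Suc n)) \<longlonglongrightarrow> 0"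
      using LIMSEQ_Suc[OF lim_const_over_n[of u]] by simp
    then have "(\<lambda>n. (norm (fourier h u))\<^sup>2 * exp (- (u / real (Suc n))\<^sup>2 / 2)) \<longlonglongrightarrow> (norm (fourier h u))\<^sup>2 * exp (- 0\<^sup>2 / 2)"
      by (intro tendsto_intros) auto
    then have "(\<lambda>n. f n u) \<longlonglongrightarrow> ennreal ((norm (fourier h u))\<^sup>2)" unfolding f_def
      by (intro tendsto_ennrealI) simp
    from lim_imp_Liminf[OF _ this] show "ennreal ((norm (fourier h u))\<^sup>2) = liminf (\<lambda>n. f n u)" by simp
  qed
  also have "\<dots> \<le> liminf (\<lambda>n. \<integral>\<^sup>+u. f n u \<partial>lborel)" by (rule nn_integral_liminf) simp
  also have "\<dots> \<le> liminf (\<lambda>n. ennreal (2 * pi) * (\<integral>\<^sup>+t. ennreal ((norm (h t))\<^sup>2) \<partial>lborel))"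
    by (intro Liminf_mono always_eventually allI) (auto simp only: f_def intro!: plancherel_gaussian assms)
  finally show ?thesis by (simp add: Liminf_const)
qed

section \<open>The Hausdorff-Young inequality\<close>

lemma nn_integral_powr_upto:
  fixes e L :: real
  assumes e: "e > 0" and L: "L \<ge> 0"
  shows "(\<integral>\<^sup>+x. ennreal (x powr (e - 1)) * indicator {0..L} x \<partial>lborel) = ennreal (L powr e / e)"
proof -
  have "((\<lambda>x. x powr (e - 1)) has_integral (L powr (e - 1 + 1) / (e - 1 + 1))) {0..L}"
    by (rule has_integral_powr_from_0) (use e L in auto)
  then have "(\<integral>\<^sup>+x\<in>{0..L}. ennreal (x powr (e - 1)) \<partial>lborel) = ennreal (L powr e / e)"
    by (intro nn_integral_has_integral_lebesgue') auto
  then show ?thesis by simp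
qed

text \<open>
  The levels run up to \<open>r / 2\<close> because the distribution function of a Fourier transform will be estimated
  at twice the level at which the function is cut.
\<close>

lemma powr_layer_cake:
  fixes q r :: real
  assumes q: "q > 0" and r: "r \<ge> 0"
  shows "ennreal (r powr q) = (\<integral>\<^sup>+l. ennreal (q * 2 powr q * l powr (q - 1)) * indicator {0..r / 2} l \<partial>lborel)"
proof -
  have "(\<integral>\<^sup>+l. ennreal (q * 2 powr q * l powr (q - 1)) * indicator {0..r / 2} l \<partial>lborel)
      = (\<integral>\<^sup>+l. ennreal (q * 2 powr q) * (ennreal (l powr (q - 1)) * indicator {0..r / 2} l) \<partial>lborel)"
    using q by (intro nn_integral_cong) (simp add: ennreal_mult mult.assoc)
  also have "\<dots> = ennreal (q * 2 powr q) * ennreal ((r / 2) powr q / q)"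
    using q r by (subst nn_integral_cmult) (simp_all add: nn_integral_powr_upto)
  also have "\<dots> = ennreal (r powr q)"
    using q r by (simp add: powr_divide flip: ennreal_mult)
  finally show ?thesis ..
qed

text \<open>
  Real interpolation between the supremum bound and the Plancherel inequality. At level \<open>l\<close> the function
  is cut where \<open>l \<bar>h\<bar>\<^bsup>p-1\<^esup> = N\<close>. The part above the cut has \<open>L\<^sub>1\<close> norm at most \<open>l\<close>, hence a transform of
  modulus at most \<open>l\<close>; so wherever the full transform exceeds \<open>2 l\<close>, the transform of the lower part
  exceeds \<open>l\<close>, and Chebyshev's and Plancherel's inequalities bound the measure of that set. Integration over
  the levels converges at \<open>l = 0\<close> because \<open>q > 2\<close>. The constant is not the sharp one.
\<close>

lemma hausdorff_young_below_2:
  fixes p q :: real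
  assumes [measurable]: "h \<in> borel_measurable borel" and h: "integrable lborel h"
    and p: "1 < p" "p < 2" and q: "q = p / (p - 1)"
    and hp: "integrable lborel (\<lambda>t. norm (h t) powr p)"
    and N: "N = (\<integral>t. norm (h t) powr p \<partial>lborel)" "N > 0"
  shows "(\<integral>\<^sup>+u. ennreal (norm (fourier h u) powr q) \<partial>lborel) \<le> ennreal (2 * pi * q * 2 powr q / (q - 2) * N powr (q - 1))"
proof -
  have q2: "q > 2" using p unfolding q by (simp add: field_simps)
  \<comment> \<open>The exponents of the final integration over the levels match because \<open>q\<close> is conjugate to \<open>p\<close>.\<close>
  have pq: "(p - 1) * (q - 2) = 2 - p" using p unfolding q by (simp add: field_simps)
  define A where "A = (\<lambda>l t. l * norm (h t) powr (p - 1) \<le> N)"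
  have Am[measurable]: "Measurable.pred (borel \<Otimes>\<^sub>M borel) (\<lambda>x. A (fst x) (snd x))" unfolding A_def by measurable
  have Am''[measurable]: "Measurable.pred borel (\<lambda>l. A l t)" for t unfolding A_def by measurable
  have Am'[measurable]: "Measurable.pred borel (A l)" for l unfolding A_def by measurable
  have level: "emeasure lborel {u. 2 * l < norm (fourier h u)} \<le> ennreal (2 * pi * l powr (- 2)) * (\<integral>\<^sup>+t. ennreal ((norm (h t))\<^sup>2) * indicator {t. A l t} t \<partial>lborel)"
    if l: "l > 0" for l
  proof -
    define s where "s = (\<lambda>t. if A l t then h t else 0)"
    define b where "b = (\<lambda>t. if A l t then 0 else h t)"
    have [measurable]: "s \<in> borel_measurable borel" "b \<in> borel_measurable borel" unfolding s_def b_def by measurable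
    have si: "integrable lborel s" by (rule Bochner_Integration.integrable_bound[OF h]) (auto simp: s_def)
    have bi: "integrable lborel b" by (rule Bochner_Integration.integrable_bound[OF h]) (auto simp: b_def)
    have hsb: "fourier h u = fourier s u + fourier b u" for u
    proof -
      have "fourier h u = (\<integral>t. s t * cis (- (t * u)) + b t * cis (- (t * u)) \<partial>lborel)"
        unfolding fourier_def by (rule Bochner_Integration.integral_cong) (auto simp: s_def b_def)
      then show ?thesis unfolding fourier_def
        by (subst (asm) Bochner_Integration.integral_add) (auto intro!: integrable_mult_cis si bi)
    qed
    have b_le: "norm (b t) \<le> l / N * norm (h t) powr p" for t
    proof (cases "A l t")
      case False
      then have "1 \<le> l / N * norm (h t) powr (p - 1)" using N(2) by (simp add: A_def field_simps)
      then have "norm (h t) * 1 \<le> norm (h t) * (l / N * norm (h t) powr (p - 1))" by (intro mult_left_mono) auto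
      also have "\<dots> = l / N * norm (h t) powr p"
        by (cases "h t = 0") (auto simp: powr_diff)
      finally show ?thesis using False by (simp add: b_def)
    qed (use l N in \<open>simp add: b_def\<close>)
    have "(\<integral>t. norm (b t) \<partial>lborel) \<le> (\<integral>t. l / N * norm (h t) powr p \<partial>lborel)"
      by (rule integral_mono) (use bi hp b_le in auto)
    then have "(\<integral>t. norm (b t) \<partial>lborel) \<le> l" using N by simp
    then have big: "norm (fourier b u) \<le> l" for u using norm_fourier_le[of b u] by simp
    have sub: "l \<le> norm (fourier s u)" if "2 * l < norm (fourier h u)" for u
      using that big[of u] norm_triangle_ineq[of "fourier s u" "fourier b u"] hsb[of u] by simp
    have "emeasure lborel {u. 2 * l < norm (fourier h u)} = (\<integral>\<^sup>+u. indicator {u. 2 * l < norm (fourier h u)} u \<partial>lborel)"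
      by (rule nn_integral_indicator[symmetric]) measurable
    also have "\<dots> \<le> (\<integral>\<^sup>+u. ennreal (l powr (- 2)) * ennreal ((norm (fourier s u))\<^sup>2) \<partial>lborel)"
    proof (rule nn_integral_mono)
      fix u
      have "1 \<le> l powr (-2) * (norm (fourier s u))\<^sup>2" if "2 * l < norm (fourier h u)"
      proof -
        have "l\<^sup>2 \<le> (norm (fourier s u))\<^sup>2" using sub[OF that] l by (intro power_mono) auto
        then show ?thesis using l by (simp add: powr_minus powr_numeral field_simps)
      qed
      then show "indicator {u. 2 * l < norm (fourier h u)} u \<le> ennreal (l powr (- 2)) * ennreal ((norm (fourier s u))\<^sup>2)"
        by (auto split: split_indicator simp flip: ennreal_mult ennreal_1 simp del: ennreal_1 intro!: ennreal_leI)
    qed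
    also have "\<dots> = ennreal (l powr (- 2)) * (\<integral>\<^sup>+u. ennreal ((norm (fourier s u))\<^sup>2) \<partial>lborel)"
      by (rule nn_integral_cmult) simp
    also have "\<dots> \<le> ennreal (l powr (- 2)) * (ennreal (2 * pi) * (\<integral>\<^sup>+t. ennreal ((norm (s t))\<^sup>2) \<partial>lborel))"
      by (intro mult_left_mono plancherel_le si) simp_all
    also have "(\<integral>\<^sup>+t. ennreal ((norm (s t))\<^sup>2) \<partial>lborel) = (\<integral>\<^sup>+t. ennreal ((norm (h t))\<^sup>2) * indicator {t. A l t} t \<partial>lborel)"
      by (intro nn_integral_cong) (auto simp: s_def split: split_indicator)
    finally show ?thesis by (simp add: ennreal_mult mult_ac)
  qed
  have "(\<integral>\<^sup>+u. ennreal (norm (fourier h u) powr q) \<partial>lborel)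
     = (\<integral>\<^sup>+u. \<integral>\<^sup>+l. ennreal (q * 2 powr q * l powr (q - 1)) * indicator {0..norm (fourier h u) / 2} l \<partial>lborel \<partial>lborel)"
    using q2 by (intro nn_integral_cong powr_layer_cake) auto
  also have "\<dots> = (\<integral>\<^sup>+u. \<integral>\<^sup>+l. ennreal (q * 2 powr q * l powr (q - 1)) * indicator {0<..} l * indicator {u. 2 * l < norm (fourier h u)} u \<partial>lborel \<partial>lborel)"
  proof (rule nn_integral_cong)
    fix u
    \<comment> \<open>The closed interval of levels and the strict level sets differ at two points only.\<close>
    have "AE l in lborel. l \<noteq> 0 \<and> l \<noteq> norm (fourier h u) / 2"
      using AE_lborel_singleton[of 0] AE_lborel_singleton[of "norm (fourier h u) / 2"] by eventually_elim auto
    then show "(\<integral>\<^sup>+l. ennreal (q * 2 powr q * l powr (q - 1)) * indicator {0..norm (fourier h u) / 2} l \<partial>lborel)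
      = (\<integral>\<^sup>+l. ennreal (q * 2 powr q * l powr (q - 1)) * indicator {0<..} l * indicator {u. 2 * l < norm (fourier h u)} u \<partial>lborel)"
      by (intro nn_integral_cong_AE, elim eventually_mono) (auto split: split_indicator)
  qed
  also have "\<dots> = (\<integral>\<^sup>+l. \<integral>\<^sup>+u. ennreal (q * 2 powr q * l powr (q - 1)) * indicator {0<..} l * indicator {u. 2 * l < norm (fourier h u)} u \<partial>lborel \<partial>lborel)"
    by (rule lborel_pair.Fubini') measurable
  also have "\<dots> \<le> (\<integral>\<^sup>+l. \<integral>\<^sup>+t. ennreal (2 * pi * q * 2 powr q) * ennreal ((norm (h t))\<^sup>2) * (ennreal (l powr (q - 2 - 1)) * indicator {0<..} l * indicator {t. A l t} t) \<partial>lborel \<partial>lborel)"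
  proof (rule nn_integral_mono)
    fix l :: real
    show "(\<integral>\<^sup>+u. ennreal (q * 2 powr q * l powr (q - 1)) * indicator {0<..} l * indicator {u. 2 * l < norm (fourier h u)} u \<partial>lborel)
      \<le> (\<integral>\<^sup>+t. ennreal (2 * pi * q * 2 powr q) * ennreal ((norm (h t))\<^sup>2) * (ennreal (l powr (q - 2 - 1)) * indicator {0<..} l * indicator {t. A l t} t) \<partial>lborel)"
    proof (cases "l > 0")
      case True
      have "(\<integral>\<^sup>+u. ennreal (q * 2 powr q * l powr (q - 1)) * indicator {0<..} l * indicator {u. 2 * l < norm (fourier h u)} u \<partial>lborel)
        = ennreal (q * 2 powr q * l powr (q - 1)) * emeasure lborel {u. 2 * l < norm (fourier h u)}"
        using True by (simp add: nn_integral_cmult)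
      also have "\<dots> \<le> ennreal (q * 2 powr q * l powr (q - 1)) * (ennreal (2 * pi * l powr (- 2)) * (\<integral>\<^sup>+t. ennreal ((norm (h t))\<^sup>2) * indicator {t. A l t} t \<partial>lborel))"
        by (rule mult_left_mono[OF level[OF True]]) simp
      also have "\<dots> = ennreal (2 * pi * q * 2 powr q * l powr (q - 2 - 1)) * (\<integral>\<^sup>+t. ennreal ((norm (h t))\<^sup>2) * indicator {t. A l t} t \<partial>lborel)"
      proof -
        have "l powr (q - 2 - 1) = l powr (q - 1) * l powr (-2)" by (simp flip: powr_add)
        then have "2 * pi * q * 2 powr q * l powr (q - 2 - 1) = (q * 2 powr q * l powr (q - 1)) * (2 * pi * l powr (- 2))" by simp
        then show ?thesis using q2 by (simp only: mult.assoc[symmetric] ennreal_mult[symmetric] mult_nonneg_nonneg powr_ge_zero pi_ge_zero zero_le_numeral)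
      qed
      also have "\<dots> = (\<integral>\<^sup>+t. ennreal (2 * pi * q * 2 powr q * l powr (q - 2 - 1)) * (ennreal ((norm (h t))\<^sup>2) * indicator {t. A l t} t) \<partial>lborel)"
        by (rule nn_integral_cmult[symmetric]) measurable
      also have "\<dots> = (\<integral>\<^sup>+t. ennreal (2 * pi * q * 2 powr q) * ennreal ((norm (h t))\<^sup>2) * (ennreal (l powr (q - 2 - 1)) * indicator {0<..} l * indicator {t. A l t} t) \<partial>lborel)"
        using True q2 by (intro nn_integral_cong) (simp add: ennreal_mult mult_ac)
      finally show ?thesis by simp
    qed simp
  qed
  also have "\<dots> = (\<integral>\<^sup>+t. \<integral>\<^sup>+l. ennreal (2 * pi * q * 2 powr q) * ennreal ((norm (h t))\<^sup>2) * (ennreal (l powr (q - 2 - 1)) * indicator {0<..} l * indicator {t. A l t} t) \<partial>lborel \<partial>lborel)"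
    unfolding A_def by (rule lborel_pair.Fubini') measurable
  also have "\<dots> \<le> (\<integral>\<^sup>+t. ennreal (2 * pi * q * 2 powr q / (q - 2) * N powr (q - 2)) * ennreal (norm (h t) powr p) \<partial>lborel)"
  proof (rule nn_integral_mono)
    fix t
    show "(\<integral>\<^sup>+l. ennreal (2 * pi * q * 2 powr q) * ennreal ((norm (h t))\<^sup>2) * (ennreal (l powr (q - 2 - 1)) * indicator {0<..} l * indicator {t. A l t} t) \<partial>lborel)
      \<le> ennreal (2 * pi * q * 2 powr q / (q - 2) * N powr (q - 2)) * ennreal (norm (h t) powr p)"
    proof (cases "h t = 0")
      case False
      define r where "r = norm (h t)"
      have r: "r > 0" using False by (simp add: r_def)
      have "(\<integral>\<^sup>+l. ennreal (2 * pi * q * 2 powr q) * ennreal (r\<^sup>2) * (ennreal (l powr (q - 2 - 1)) * indicator {0<..} l * indicator {t. A l t} t) \<partial>lborel)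
        = ennreal (2 * pi * q * 2 powr q) * ennreal (r\<^sup>2) * (\<integral>\<^sup>+l. ennreal (l powr (q - 2 - 1)) * indicator {0<..} l * indicator {t. A l t} t \<partial>lborel)"
        by (rule nn_integral_cmult) measurable
      also have "\<dots> \<le> ennreal (2 * pi * q * 2 powr q) * ennreal (r\<^sup>2) * (\<integral>\<^sup>+l. ennreal (l powr (q - 2 - 1)) * indicator {0..N / r powr (p - 1)} l \<partial>lborel)"
      proof (intro mult_left_mono nn_integral_mono)
        fix l :: real
        have "l \<le> N / r powr (p - 1)" if "A l t"
          using that r by (simp add: A_def r_def pos_le_divide_eq)
        then show "ennreal (l powr (q - 2 - 1)) * indicator {0<..} l * indicator {t. A l t} t \<le> ennreal (l powr (q - 2 - 1)) * indicator {0..N / r powr (p - 1)} l"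
          by (simp split: split_indicator)
      qed simp
      also have "\<dots> = ennreal (2 * pi * q * 2 powr q) * ennreal (r\<^sup>2) * ennreal ((N / r powr (p - 1)) powr (q - 2) / (q - 2))"
        using q2 N r by (subst nn_integral_powr_upto) auto
      also have "\<dots> = ennreal (2 * pi * q * 2 powr q * r\<^sup>2 * ((N / r powr (p - 1)) powr (q - 2) / (q - 2)))"
        using q2 N r by (simp only: ennreal_mult[symmetric] mult_nonneg_nonneg divide_nonneg_pos powr_ge_zero zero_le_power2 zero_le_numeral pi_ge_zero less_imp_le diff_gt_0_iff_gt)
      also have "2 * pi * q * 2 powr q * r\<^sup>2 * ((N / r powr (p - 1)) powr (q - 2) / (q - 2)) = 2 * pi * q * 2 powr q / (q - 2) * N powr (q - 2) * (r powr p)"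
      proof -
        have "(N / r powr (p - 1)) powr (q - 2) = N powr (q - 2) / r powr (2 - p)"
          using N r by (simp add: powr_divide powr_powr pq)
        moreover have "r\<^sup>2 / r powr (2 - p) = r powr p" using r by (simp add: powr_diff powr_numeral)
        moreover have "2 * pi * q * 2 powr q * r\<^sup>2 * (N powr (q - 2) / r powr (2 - p) / (q - 2)) = 2 * pi * q * 2 powr q / (q - 2) * N powr (q - 2) * (r\<^sup>2 / r powr (2 - p))"
          by (simp add: mult_ac)
        ultimately show ?thesis by (simp only:)
      qed
      also have "ennreal \<dots> = ennreal (2 * pi * q * 2 powr q / (q - 2) * N powr (q - 2)) * ennreal (r powr p)"
        by (rule ennreal_mult) (use q2 in simp_all)
      finally show ?thesis unfolding r_def .
    qed simp
  qed
  also have "\<dots> = ennreal (2 * pi * q * 2 powr q / (q - 2) * N powr (q - 2)) * (\<integral>\<^sup>+t. ennreal (norm (h t) powr p) \<partial>lborel)"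
    by (rule nn_integral_cmult) measurable
  also have "(\<integral>\<^sup>+t. ennreal (norm (h t) powr p) \<partial>lborel) = ennreal N"
    unfolding N(1) by (rule nn_integral_eq_integral[OF hp]) simp
  also have "ennreal (2 * pi * q * 2 powr q / (q - 2) * N powr (q - 2)) * ennreal N = ennreal (2 * pi * q * 2 powr q / (q - 2) * N powr (q - 1))"
  proof -
    have "N powr (q - 1) = N powr ((q - 2) + 1)" by simp
    also have "\<dots> = N powr (q - 2) * N" unfolding powr_add using N(2) by simp
    finally have eq: "2 * pi * q * 2 powr q / (q - 2) * N powr (q - 2) * N = 2 * pi * q * 2 powr q / (q - 2) * N powr (q - 1)"
      by (simp only: mult.assoc)
    have "0 \<le> 2 * pi * q * 2 powr q / (q - 2) * N powr (q - 2)" using q2 by simp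
    from ennreal_mult[OF this, of N] show ?thesis unfolding eq using N(2) by simp
  qed
  finally show ?thesis .
qed

text \<open>
  The constant is the same for all \<open>h\<close>, which is what an extension by density needs.
\<close>

lemma hausdorff_young:
  fixes p q :: real
  assumes p: "1 < p" "p \<le> 2" and q: "q = p / (p - 1)"
  shows "\<exists>C\<ge>0. \<forall>h. h \<in> borel_measurable borel \<longrightarrow> integrable lborel h \<longrightarrow> integrable lborel (\<lambda>t. norm (h t) powr p)
     \<longrightarrow> (\<integral>\<^sup>+u. ennreal (norm (fourier h u) powr q) \<partial>lborel) \<le> ennreal (C * (\<integral>t. norm (h t) powr p \<partial>lborel) powr (q - 1))"
proof (cases "p = 2")
  case True
  then have q': "q = 2" using q by simp
  have bd: "(\<integral>\<^sup>+u. ennreal (norm (fourier h u) powr q) \<partial>lborel) \<le> ennreal (2 * pi * (\<integral>t. norm (h t) powr p \<partial>lborel) powr (q - 1))"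
    if h: "h \<in> borel_measurable borel" "integrable lborel h" "integrable lborel (\<lambda>t. norm (h t) powr p)" for h
  proof -
    have hp: "integrable lborel (\<lambda>t. (norm (h t))\<^sup>2)" using h(3) True by (simp add: powr_numeral)
    have "(\<integral>\<^sup>+u. ennreal ((norm (fourier h u))\<^sup>2) \<partial>lborel) \<le> ennreal (2 * pi) * (\<integral>\<^sup>+t. ennreal ((norm (h t))\<^sup>2) \<partial>lborel)"
      by (rule plancherel_le) (use h in auto)
    also have "(\<integral>\<^sup>+t. ennreal ((norm (h t))\<^sup>2) \<partial>lborel) = ennreal (\<integral>t. (norm (h t))\<^sup>2 \<partial>lborel)"
      by (rule nn_integral_eq_integral[OF hp]) simp
    finally show ?thesis using True q' by (simp add: powr_numeral ennreal_mult)
  qed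
  show ?thesis
  proof (rule exI, intro conjI allI impI)
    show "0 \<le> 2 * pi" by simp
    fix h :: "real \<Rightarrow> complex"
    assume "h \<in> borel_measurable borel" "integrable lborel h" "integrable lborel (\<lambda>t. norm (h t) powr p)"
    from bd[OF this] show "(\<integral>\<^sup>+u. ennreal (norm (fourier h u) powr q) \<partial>lborel) \<le> ennreal (2 * pi * (\<integral>t. norm (h t) powr p \<partial>lborel) powr (q - 1))" .
  qed
next
  case False
  then have p2: "p < 2" using p by simp
  have q2: "q > 2" using p p2 unfolding q by (simp add: field_simps)
  have bd: "(\<integral>\<^sup>+u. ennreal (norm (fourier h u) powr q) \<partial>lborel) \<le> ennreal (2 * pi * q * 2 powr q / (q - 2) * (\<integral>t. norm (h t) powr p \<partial>lborel) powr (q - 1))"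
    if h: "h \<in> borel_measurable borel" "integrable lborel h" "integrable lborel (\<lambda>t. norm (h t) powr p)" for h
  proof (cases "(\<integral>t. norm (h t) powr p \<partial>lborel) > 0")
    case True
    then show ?thesis by (rule hausdorff_young_below_2[OF h(1,2) p(1) p2 q h(3) refl])
  next
    case False
    moreover have "0 \<le> (\<integral>t. norm (h t) powr p \<partial>lborel)"
      by (rule Bochner_Integration.integral_nonneg) simp
    ultimately have "(\<integral>t. norm (h t) powr p \<partial>lborel) = 0" by linarith
    then have "AE t in lborel. norm (h t) powr p = 0"
      using integral_nonneg_eq_0_iff_AE[OF h(3)] by simp
    then have "AE t in lborel. h t = 0" by eventually_elim auto
    then have "AE t in lborel. h t * cis (- (t * u)) = 0" for u
      by eventually_elim simp
    then have "fourier h u = 0" for u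
      unfolding fourier_def by (rule integral_eq_zero_AE)
    then show ?thesis by simp
  qed
  show ?thesis
  proof (rule exI, intro conjI allI impI)
    show "0 \<le> 2 * pi * q * 2 powr q / (q - 2)" using q2 by simp
    fix h :: "real \<Rightarrow> complex"
    assume "h \<in> borel_measurable borel" "integrable lborel h" "integrable lborel (\<lambda>t. norm (h t) powr p)"
    from bd[OF this] show "(\<integral>\<^sup>+u. ennreal (norm (fourier h u) powr q) \<partial>lborel) \<le> ennreal (2 * pi * q * 2 powr q / (q - 2) * (\<integral>t. norm (h t) powr p \<partial>lborel) powr (q - 1))" .
  qed
qed

section \<open>Fourier transforms in the mean\<close>

definition truncate_at :: "(real \<Rightarrow> complex) \<Rightarrow> real \<Rightarrow> real \<Rightarrow> complex" where
  "truncate_at h T = (\<lambda>t. indicat_real {- T..T} t *\<^sub>R h t)"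

definition tail_power :: "(real \<Rightarrow> complex) \<Rightarrow> real \<Rightarrow> real \<Rightarrow> real" where
  "tail_power h p T = (\<integral>t. indicat_real (- {- T..T}) t * norm (h t) powr p \<partial>lborel)"

lemma measurable_truncate_at [measurable]:
  "h \<in> borel_measurable borel \<Longrightarrow> truncate_at h T \<in> borel_measurable borel"
  unfolding truncate_at_def by measurable

lemma le_one_plus_powr:
  fixes x p :: real
  assumes "0 \<le> x" "1 \<le> p"
  shows "x \<le> 1 + x powr p"
proof (cases "x \<le> 1")
  case False
  then have "x powr 1 \<le> x powr p" using assms by (intro powr_mono) auto
  then show ?thesis using False by simp
qed (simp add: add_increasing2)

lemma integrable_truncate_at:
  assumes [measurable]: "h \<in> borel_measurable borel" and hp: "integrable lborel (\<lambda>t. norm (h t) powr p)" and p: "1 \<le> p"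
  shows "integrable lborel (truncate_at h T)"
proof (rule Bochner_Integration.integrable_bound)
  show "integrable lborel (\<lambda>t. indicat_real {- T..T} t + norm (h t) powr p)"
    using hp by (intro Bochner_Integration.integrable_add integrable_real_indicator) (auto simp: emeasure_lborel_Icc_eq)
  show "AE t in lborel. norm (truncate_at h T t) \<le> norm (indicat_real {- T..T} t + norm (h t) powr p)"
  proof (rule AE_I2)
    fix t
    show "norm (truncate_at h T t) \<le> norm (indicat_real {- T..T} t + norm (h t) powr p)"
      using le_one_plus_powr[OF norm_ge_zero p, of "h t"] by (auto simp: truncate_at_def split: split_indicator)
  qed
qed simp

lemma integrable_tail_power:
  fixes h :: "real \<Rightarrow> complex"
  assumes [measurable]: "h \<in> borel_measurable borel" and hp: "integrable lborel (\<lambda>t. norm (h t) powr p)"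
  shows "integrable lborel (\<lambda>t. indicat_real (- {- T..T}) t * norm (h t) powr p)"
proof (rule Bochner_Integration.integrable_bound[OF hp])
  show "(\<lambda>t. indicat_real (- {- T..T}) t * norm (h t) powr p) \<in> borel_measurable lborel" by measurable
qed (auto split: split_indicator)

lemma tail_power_nonneg: "0 \<le> tail_power h p T"
  unfolding tail_power_def by (rule Bochner_Integration.integral_nonneg) simp

lemma tail_power_antimono:
  assumes "h \<in> borel_measurable borel" "integrable lborel (\<lambda>t. norm (h t) powr p)" "S \<le> T"
  shows "tail_power h p T \<le> tail_power h p S"
  unfolding tail_power_def
  using assms(3) by (intro integral_mono integrable_tail_power assms(1,2)) (auto split: split_indicator)

lemma tail_power_tendsto_0:
  assumes [measurable]: "h \<in> borel_measurable borel" and hp: "integrable lborel (\<lambda>t. norm (h t) powr p)"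
  shows "((\<lambda>T. tail_power h p T) \<longlongrightarrow> 0) at_top"
proof -
  have "((\<lambda>T. tail_power h p T) \<longlongrightarrow> (\<integral>t. 0 \<partial>(lborel :: real measure))) at_top"
    unfolding tail_power_def
  proof (rule integral_dominated_convergence_at_top[OF _ _ hp])
    show "AE t in lborel. ((\<lambda>T. indicat_real (- {- T..T}) t * norm (h t) powr p) \<longlongrightarrow> 0) at_top"
    proof (rule AE_I2)
      fix t :: real
      have "\<forall>\<^sub>F T in at_top. indicat_real (- {- T..T}) t * norm (h t) powr p = 0"
        using eventually_ge_at_top[of "\<bar>t\<bar>"] by eventually_elim (auto split: split_indicator)
      then show "((\<lambda>T. indicat_real (- {- T..T}) t * norm (h t) powr p) \<longlongrightarrow> 0) at_top"
        by (rule tendsto_eventually)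
    qed
    show "\<forall>\<^sub>F T in at_top. AE t in lborel. norm (indicat_real (- {- T..T}) t * norm (h t) powr p) \<le> norm (h t) powr p"
      by (intro always_eventually allI AE_I2) (auto split: split_indicator)
  qed measurable
  then show ?thesis by simp
qed

lemma fourier_diff:
  assumes [measurable]: "f \<in> borel_measurable borel" "g \<in> borel_measurable borel" and "integrable lborel f" "integrable lborel g"
  shows "fourier (\<lambda>t. f t - g t) u = fourier f u - fourier g u"
proof -
  have "fourier f u - fourier g u = (\<integral>t. f t * cis (- (t * u)) - g t * cis (- (t * u)) \<partial>lborel)"
    unfolding fourier_def by (rule Bochner_Integration.integral_diff[symmetric]) (intro integrable_mult_cis assms; measurable)+
  then show ?thesis unfolding fourier_def by (simp add: left_diff_distrib)
qed

text \<open>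
  By the Hausdorff-Young inequality the transforms of the truncations form a Cauchy family in \<open>L\<^sub>q\<close>, with
  differences bounded by tails of \<open>h\<close>. A fast subsequence converges almost everywhere, and Fatou's lemma
  passes the bound on the differences to the limit \<open>\<psi>\<close>.
\<close>

lemma fourier_truncations_converge:
  fixes p q :: real
  assumes p: "1 < p" "p \<le> 2" and q: "q = p / (p - 1)"
    and hm[measurable]: "h \<in> borel_measurable borel" and hp: "integrable lborel (\<lambda>t. norm (h t) powr p)"
  obtains \<psi> C where "\<psi> \<in> borel_measurable borel" "C \<ge> 0"
    "\<And>T. (\<integral>\<^sup>+u. ennreal (norm (fourier (truncate_at h T) u - \<psi> u) powr q) \<partial>lborel) \<le> ennreal (C * tail_power h p T powr (q - 1))"
proof -
  have q1: "q > 1" using p unfolding q by (simp add: field_simps)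
  obtain C where C: "C \<ge> 0" and HY: "\<And>h. \<lbrakk>h \<in> borel_measurable borel; integrable lborel h; integrable lborel (\<lambda>t. norm (h t) powr p)\<rbrakk>
     \<Longrightarrow> (\<integral>\<^sup>+u. ennreal (norm (fourier h u) powr q) \<partial>lborel) \<le> ennreal (C * (\<integral>t. norm (h t) powr p \<partial>lborel) powr (q - 1))"
    using hausdorff_young[OF p q] by (elim exE conjE) blast
  define R where "R = (\<lambda>T. C * tail_power h p T powr (q - 1))"
  have R0: "R T \<ge> 0" for T using C by (simp add: R_def)
  have Rmono: "R T \<le> R S" if "S \<le> T" for S T
    unfolding R_def using tail_power_antimono[OF hm hp that] tail_power_nonneg q1 C
    by (intro mult_left_mono powr_mono2) auto
  have Rlim: "(R \<longlongrightarrow> 0) at_top"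
  proof -
    have "((\<lambda>T. tail_power h p T powr (q - 1)) \<longlongrightarrow> 0 powr (q - 1)) at_top"
      by (rule tendsto_powr'[OF tail_power_tendsto_0[OF hm hp] tendsto_const]) (use q1 tail_power_nonneg in \<open>auto intro: always_eventually\<close>)
    from tendsto_mult_left[OF this, of C] show ?thesis using q1 unfolding R_def by simp
  qed
  define F where "F = (\<lambda>T. fourier (truncate_at h T))"
  have Fm[measurable]: "F T \<in> borel_measurable borel" for T unfolding F_def by measurable
  have D: "(\<integral>\<^sup>+u. ennreal (norm (F T u - F S u) powr q) \<partial>lborel) \<le> ennreal (R (min S T))" for S T
  proof -
    define d where "d = (\<lambda>t. truncate_at h T t - truncate_at h S t)"
    have dm[measurable]: "d \<in> borel_measurable borel" unfolding d_def by measurable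
    have di: "integrable lborel d" unfolding d_def using p by (intro Bochner_Integration.integrable_diff integrable_truncate_at[OF hm hp]) auto
    have dle: "norm (d t) powr p \<le> indicat_real (- {- (min S T)..min S T}) t * norm (h t) powr p" for t
      by (auto simp: d_def truncate_at_def split: split_indicator)
    have dp: "integrable lborel (\<lambda>t. norm (d t) powr p)"
      by (rule Bochner_Integration.integrable_bound[OF integrable_tail_power[OF hm hp, of "min S T"]]) (use dle in auto)
    have "(\<integral>t. norm (d t) powr p \<partial>lborel) \<le> tail_power h p (min S T)"
      unfolding tail_power_def by (rule integral_mono[OF dp integrable_tail_power[OF hm hp]]) (rule dle)
    then have "C * (\<integral>t. norm (d t) powr p \<partial>lborel) powr (q - 1) \<le> R (min S T)"
      unfolding R_def using C q1 by (intro mult_left_mono powr_mono2) (auto intro: Bochner_Integration.integral_nonneg)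
    then have "(\<integral>\<^sup>+u. ennreal (norm (fourier d u) powr q) \<partial>lborel) \<le> ennreal (R (min S T))"
      by (intro order_trans[OF HY[OF dm di dp]] ennreal_leI)
    moreover have "fourier d u = F T u - F S u" for u
      unfolding d_def F_def using p by (intro fourier_diff integrable_truncate_at[OF hm hp]) auto
    ultimately show ?thesis by simp
  qed
  \<comment> \<open>The factor \<open>2\<^bsup>nq\<^esup>\<close> compensated here forces \<open>\<bar>e n u\<bar>\<close> below a multiple of \<open>2\<^bsup>-n\<^esup>\<close> for almost every \<open>u\<close>.\<close>
  define eps where "eps = (\<lambda>n. 2 powr (- (real n * q)) * (1 / 2) ^ n)"
  have eps0: "eps n > 0" for n by (simp add: eps_def)
  have "\<exists>T. T \<ge> real n \<and> R T \<le> eps n" for n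
  proof -
    have "\<forall>\<^sub>F T in at_top. R T < eps n" using order_tendstoD(2)[OF Rlim eps0] .
    then have "\<forall>\<^sub>F T in at_top. T \<ge> real n \<and> R T \<le> eps n"
      using eventually_ge_at_top[of "real n"] by eventually_elim auto
    then show ?thesis by (rule eventually_happens'[OF trivial_limit_at_top_linorder])
  qed
  then have "\<exists>T. \<forall>n. T n \<ge> real n \<and> R (T n) \<le> eps n" by (intro choice allI)
  then obtain T where T: "\<And>n. T n \<ge> real n" "\<And>n. R (T n) \<le> eps n" by blast
  have epsSuc: "eps (Suc n) \<le> eps n" for n
    unfolding eps_def using q1 by (intro mult_mono) (auto simp: algebra_simps)
  define e where "e = (\<lambda>n u. F (T (Suc n)) u - F (T n) u)"
  have [measurable]: "e n \<in> borel_measurable borel" for n unfolding e_def by measurable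
  have enorm: "(\<integral>\<^sup>+u. ennreal (2 powr (real n * q)) * ennreal (norm (e n u) powr q) \<partial>lborel) \<le> ennreal ((1 / 2) ^ n)" for n
  proof -
    have "R (min (T n) (T (Suc n))) \<le> eps n"
      using T(2)[of n] T(2)[of "Suc n"] epsSuc[of n] by (auto simp: min_def)
    then have "(\<integral>\<^sup>+u. ennreal (norm (e n u) powr q) \<partial>lborel) \<le> ennreal (eps n)"
      unfolding e_def by (intro order_trans[OF D] ennreal_leI)
    then have "ennreal (2 powr (real n * q)) * (\<integral>\<^sup>+u. ennreal (norm (e n u) powr q) \<partial>lborel) \<le> ennreal (2 powr (real n * q)) * ennreal (eps n)"
      by (rule mult_left_mono) simp
    also have "\<dots> = ennreal ((1 / 2) ^ n)"
      by (simp add: eps_def ennreal_mult[symmetric] powr_minus)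
    finally show ?thesis by (subst nn_integral_cmult) auto
  qed
  have "(\<integral>\<^sup>+u. (\<Sum>n. ennreal (2 powr (real n * q)) * ennreal (norm (e n u) powr q)) \<partial>lborel) \<le> (\<Sum>n. ennreal ((1 / 2) ^ n))"
    by (subst nn_integral_suminf) (auto intro!: suminf_le enorm)
  also have "\<dots> = ennreal (\<Sum>n. (1 / 2) ^ n)"
    by (rule suminf_ennreal2) (auto intro: summable_geometric)
  finally have "(\<integral>\<^sup>+u. (\<Sum>n. ennreal (2 powr (real n * q)) * ennreal (norm (e n u) powr q)) \<partial>lborel) \<noteq> \<infinity>"
    using le_less_trans[OF _ ennreal_less_top] by fastforce
  then have "AE u in lborel. (\<Sum>n. ennreal (2 powr (real n * q)) * ennreal (norm (e n u) powr q)) \<noteq> \<infinity>"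
    by (intro nn_integral_PInf_AE) measurable
  then have conv: "AE u in lborel. convergent (\<lambda>n. F (T n) u)"
  proof eventually_elim
    case (elim u)
    then obtain M where M: "M \<ge> 0" "(\<Sum>n. ennreal (2 powr (real n * q)) * ennreal (norm (e n u) powr q)) = ennreal M"
      by (cases "(\<Sum>n. ennreal (2 powr (real n * q)) * ennreal (norm (e n u) powr q))") auto
    have b: "norm (e n u) \<le> M powr (1 / q) * (1 / 2) ^ n" for n
    proof -
      have "ennreal (2 powr (real n * q)) * ennreal (norm (e n u) powr q) \<le> ennreal M"
        unfolding M(2)[symmetric] using sum_le_suminf[of "\<lambda>n. ennreal (2 powr (real n * q)) * ennreal (norm (e n u) powr q)" "{n}"]
        by auto
      then have "2 powr (real n * q) * norm (e n u) powr q \<le> M" using M(1) by (simp flip: ennreal_mult)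
      moreover have "(2 ^ n * norm (e n u)) powr q = 2 powr (real n * q) * norm (e n u) powr q"
        by (simp add: powr_mult powr_powr flip: powr_realpow)
      ultimately have "((2 ^ n * norm (e n u)) powr q) powr (1 / q) \<le> M powr (1 / q)"
        using q1 by (intro powr_mono2) auto
      then have "2 ^ n * norm (e n u) \<le> M powr (1 / q)" using q1 by (simp add: powr_powr)
      then show ?thesis by (simp add: field_simps power_one_over)
    qed
    have "summable (\<lambda>n. M powr (1 / q) * (1 / 2) ^ n)" by (intro summable_mult summable_geometric) auto
    then have "summable (\<lambda>n. e n u)" by (rule summable_comparison_test') (rule b)
    then have "convergent (\<lambda>n. \<Sum>k<n. e k u)" by (simp add: summable_iff_convergent)
    then have "convergent (\<lambda>n. (\<Sum>k<n. e k u) + F (T 0) u)" by (intro convergent_add convergent_const)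
    moreover have "(\<Sum>k<n. e k u) + F (T 0) u = F (T n) u" for n
      unfolding e_def by (subst sum_lessThan_telescope) simp
    ultimately show ?case by simp
  qed
  define \<psi> where "\<psi> = (\<lambda>u. lim (\<lambda>n. F (T n) u))"
  have [measurable]: "\<psi> \<in> borel_measurable borel" unfolding \<psi>_def by (rule borel_measurable_lim_metric) simp
  have conv': "AE u in lborel. (\<lambda>n. F (T n) u) \<longlonglongrightarrow> \<psi> u"
    using conv by eventually_elim (simp add: \<psi>_def convergent_LIMSEQ_iff)
  have "(\<integral>\<^sup>+u. ennreal (norm (F S u - \<psi> u) powr q) \<partial>lborel) \<le> ennreal (R S)" for S
  proof -
    have "(\<integral>\<^sup>+u. ennreal (norm (F S u - \<psi> u) powr q) \<partial>lborel) = (\<integral>\<^sup>+u. liminf (\<lambda>n. ennreal (norm (F S u - F (T n) u) powr q)) \<partial>lborel)"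
    proof (rule nn_integral_cong_AE)
      show "AE u in lborel. ennreal (norm (F S u - \<psi> u) powr q) = liminf (\<lambda>n. ennreal (norm (F S u - F (T n) u) powr q))"
        using conv'
      proof eventually_elim
        case (elim u)
        have "(\<lambda>n. norm (F S u - F (T n) u) powr q) \<longlonglongrightarrow> norm (F S u - \<psi> u) powr q"
          by (rule tendsto_powr') (use q1 elim in \<open>auto intro!: tendsto_intros\<close>)
        then have "(\<lambda>n. ennreal (norm (F S u - F (T n) u) powr q)) \<longlonglongrightarrow> ennreal (norm (F S u - \<psi> u) powr q)"
          by (rule tendsto_ennrealI)
        from lim_imp_Liminf[OF _ this] show ?case by simp
      qed
    qed
    also have "\<dots> \<le> liminf (\<lambda>n. \<integral>\<^sup>+u. ennreal (norm (F S u - F (T n) u) powr q) \<partial>lborel)"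
      by (rule nn_integral_liminf) measurable
    also have "\<dots> \<le> liminf (\<lambda>n. ennreal (R S))"
    proof (rule Liminf_mono)
      obtain N where N: "real N \<ge> S" using real_arch_simple by blast
      show "\<forall>\<^sub>F n in sequentially. (\<integral>\<^sup>+u. ennreal (norm (F S u - F (T n) u) powr q) \<partial>lborel) \<le> ennreal (R S)"
        using eventually_ge_at_top[of N]
      proof eventually_elim
        case (elim n)
        then have "T n \<ge> S" using T(1)[of n] N by linarith
        then show ?case using D[of S "T n"] by (simp add: min_def split: if_splits)
      qed
    qed
    finally show ?thesis by (simp add: Liminf_const)
  qed
  then have "(\<integral>\<^sup>+u. ennreal (norm (fourier (truncate_at h S) u - \<psi> u) powr q) \<partial>lborel) \<le> ennreal (C * tail_power h p S powr (q - 1))" for S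
    unfolding F_def R_def .
  then show ?thesis using that[of \<psi> C] C by simp
qed

section \<open>Euler integrals and the Gamma function on vertical lines\<close>

text \<open>
  Euler's integrand for \<open>\<Gamma>(z) a\<^bsup>-z\<^esup>\<close> in the logarithmic variable.
\<close>

definition gamma_weight :: "real \<Rightarrow> complex \<Rightarrow> real \<Rightarrow> complex" where
  "gamma_weight a z u = exp (z * of_real u - of_real (a * exp u))"

lemma continuous_on_gamma_weight [continuous_intros]: "continuous_on A (gamma_weight a z)"
  unfolding gamma_weight_def by (intro continuous_intros)

lemma measurable_gamma_weight [measurable]: "gamma_weight a z \<in> borel_measurable borel"
  by (rule borel_measurable_continuous_onI) (rule continuous_on_gamma_weight)

lemma norm_gamma_weight: "norm (gamma_weight a z u) = exp (Re z * u - a * exp u)"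
  by (simp add: gamma_weight_def)

lemma gamma_weight_integral:
  assumes z: "Re z > 0" and a: "a > 0"
  shows "integrable lborel (gamma_weight a z)"
    and "(\<integral>u. gamma_weight a z u \<partial>lborel) = Gamma z * of_real a powr (- z)"
proof -
  define f where "f = (\<lambda>t::real. complex_of_real t powr (z - 1) / complex_of_real (exp t))"
  define G where "G = (\<lambda>u::real. exp ((z - 1) * of_real u) / complex_of_real (exp (exp u)))"
  have Gm: "G \<in> borel_measurable borel" unfolding G_def by (intro borel_measurable_continuous_onI continuous_intros) auto
  have ae: "AE u in lborel. f (exp u) = G u"
    by (rule AE_I2) (simp add: f_def G_def powr_def Ln_of_real)
  have i: "set_integrable lebesgue {0<..} f" unfolding f_def by (rule absolutely_integrable_Gamma_integral'[OF z])
  have "(LINT t:{0<..}|lebesgue. f t) = integral {0<..} f"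
    by (rule set_lebesgue_integral_eq_integral(2)[OF i])
  also have "\<dots> = Gamma z" unfolding f_def using Gamma_integral_complex'[OF z] by (rule integral_unique)
  finally have v: "(LINT t:{0<..}|lebesgue. f t) = Gamma z" .
  have eq: "exp u *\<^sub>R G u = gamma_weight 1 z u" for u
  proof -
    have "gamma_weight 1 z u = exp ((of_real u + (z - 1) * of_real u) - of_real (exp u))"
      by (simp add: gamma_weight_def left_diff_distrib)
    also have "\<dots> = exp (of_real u) * exp ((z - 1) * of_real u) / exp (of_real (exp u))"
      by (simp only: exp_diff exp_add)
    finally show ?thesis by (simp add: G_def scaleR_conv_of_real exp_of_real)
  qed
  have i1: "integrable lborel (gamma_weight 1 z)" and v1: "(\<integral>u. gamma_weight 1 z u \<partial>lborel) = Gamma z"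
    using half_line_integral_log[OF Gm ae] i v unfolding eq by auto
  have sh: "gamma_weight a z u = of_real a powr (- z) * gamma_weight 1 z (ln a + 1 * u)" for u
  proof -
    have "exp (ln a + u) = a * exp u" using a by (simp add: exp_add)
    then have "gamma_weight 1 z (ln a + 1 * u) = exp (z * of_real (ln a) + (z * of_real u - of_real (a * exp u)))"
      by (simp add: gamma_weight_def distrib_left add_diff_eq)
    also have "\<dots> = exp (z * of_real (ln a)) * gamma_weight a z u"
      by (simp only: exp_add gamma_weight_def)
    finally show ?thesis
      using a by (simp add: powr_def Ln_of_real exp_minus)
  qed
  have i2: "integrable lborel (\<lambda>u. gamma_weight 1 z (ln a + 1 * u))"
    by (rule lborel_integrable_real_affine[OF i1]) simp
  show "integrable lborel (gamma_weight a z)" unfolding sh using i2 by (intro integrable_mult_right)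
  have "(\<integral>u. gamma_weight 1 z (ln a + 1 * u) \<partial>lborel) = Gamma z"
    using lborel_integral_real_affine[of 1 "gamma_weight 1 z" "ln a"] v1 by simp
  then show "(\<integral>u. gamma_weight a z u \<partial>lborel) = Gamma z * of_real a powr (- z)"
    unfolding sh by simp
qed

lemma gamma_weight_integral_real:
  fixes \<sigma> a :: real
  assumes "\<sigma> > 0" "a > 0"
  shows "integrable lborel (\<lambda>u. exp (\<sigma> * u - a * exp u))"
    and "(\<integral>u. exp (\<sigma> * u - a * exp u) \<partial>lborel) = Gamma \<sigma> * a powr (- \<sigma>)"
proof -
  have eq: "gamma_weight a (of_real \<sigma>) u = of_real (exp (\<sigma> * u - a * exp u))" for u
    unfolding gamma_weight_def exp_of_real[symmetric] by simp
  have 1: "integrable lborel (\<lambda>u. complex_of_real (exp (\<sigma> * u - a * exp u)))"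
    using gamma_weight_integral(1)[of "of_real \<sigma>" a] assms unfolding eq[abs_def] by simp
  show "integrable lborel (\<lambda>u. exp (\<sigma> * u - a * exp u))" using integrable_Re[OF 1] by simp
  have "(\<integral>u. complex_of_real (exp (\<sigma> * u - a * exp u)) \<partial>lborel) = Gamma (of_real \<sigma>) * of_real a powr (- of_real \<sigma>)"
    using gamma_weight_integral(2)[of "of_real \<sigma>" a] assms unfolding eq[abs_def] by simp
  also have "\<dots> = of_real (Gamma \<sigma> * a powr (- \<sigma>))"
    using assms powr_of_real[of a "- \<sigma>"] by (simp add: Gamma_complex_of_real)
  finally show "(\<integral>u. exp (\<sigma> * u - a * exp u) \<partial>lborel) = Gamma \<sigma> * a powr (- \<sigma>)"
    unfolding integral_complex_of_real of_real_eq_iff .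
qed

lemma norm_Gamma_le:
  assumes "Re z > 0"
  shows "norm (Gamma z) \<le> Gamma (Re z)"
proof -
  have "norm (Gamma z) = norm (\<integral>u. gamma_weight 1 z u \<partial>lborel)"
    using gamma_weight_integral(2)[of z 1] assms by simp
  also have "\<dots> \<le> (\<integral>u. norm (gamma_weight 1 z u) \<partial>lborel)" by (rule integral_norm_bound)
  also have "\<dots> = Gamma (Re z)"
    unfolding norm_gamma_weight using gamma_weight_integral_real(2)[of "Re z" 1] assms by simp
  finally show ?thesis .
qed

text \<open>
  Two applications of the functional equation trade \<open>\<bar>z (z + 1)\<bar>\<close> for the value at \<open>z + 2\<close>, which is
  bounded on the line. Quadratic decay is all that is needed for integrability.
\<close>

lemma norm_Gamma_decay:
  assumes n: "0 < n" "n \<le> 1"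
  shows "norm (Gamma (Complex n t)) \<le> Gamma (n + 2) / n\<^sup>2 * inverse (1 + t\<^sup>2)"
proof -
  define z where "z = Complex n t"
  have z0: "z \<noteq> 0" "z + 1 \<noteq> 0" using n by (auto simp: z_def complex_eq_iff)
  have notnp: "z \<notin> \<int>\<^sub>\<le>\<^sub>0" "z + 1 \<notin> \<int>\<^sub>\<le>\<^sub>0" using n by (auto simp: z_def nonpos_Ints_def complex_eq_iff)
  have G: "Gamma (z + 2) = (z + 1) * z * Gamma z"
    using Gamma_plus1[OF notnp(1)] Gamma_plus1[OF notnp(2)] by (simp add: add.assoc mult.assoc)
  \<comment> \<open>Since \<open>n \<le> 1\<close>, \<open>n\<^sup>2 + t\<^sup>2\<close> is at least \<open>n\<^sup>2 (1 + t\<^sup>2)\<close>.\<close>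
  have nz: "n\<^sup>2 * (1 + t\<^sup>2) \<le> (norm z)\<^sup>2"
    using n mult_right_mono[of "n\<^sup>2" 1 "t\<^sup>2"] by (simp add: z_def cmod_power2 algebra_simps power_le_one)
  have "(norm z)\<^sup>2 \<le> norm (z + 1) * norm z"
  proof -
    have "norm z \<le> norm (z + 1)"
    proof (rule power2_le_imp_le)
      show "(norm z)\<^sup>2 \<le> (norm (z + 1))\<^sup>2"
        unfolding cmod_power2 using n by (simp add: z_def power2_eq_square algebra_simps)
    qed simp
    then show ?thesis by (simp add: power2_eq_square mult_right_mono)
  qed
  then have "n\<^sup>2 * (1 + t\<^sup>2) * norm (Gamma z) \<le> norm (z + 1) * norm z * norm (Gamma z)"
    using nz by (intro mult_right_mono) auto
  also have "\<dots> = norm (Gamma (z + 2))" unfolding G by (simp add: norm_mult)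
  also have "\<dots> \<le> Gamma (n + 2)" using norm_Gamma_le[of "z + 2"] n by (simp add: z_def)
  finally show ?thesis using n unfolding z_def by (simp add: field_simps add_pos_nonneg)
qed

lemma integrable_inverse_one_plus_square: "integrable lborel (\<lambda>t::real. inverse (1 + t\<^sup>2))"
  using integrable_inverse_1_plus_square by (simp add: set_integrable_def)

section \<open>Modified Bessel functions of the first kind\<close>

text \<open>
  The entire factor of the Bessel function, \<open>I\<^sub>\<nu>(z) = (z/2)\<^bsup>\<nu>\<^esup> E\<^sub>\<nu>(z\<^sup>2/4)\<close>. It has no branch point, and
  differentiation raises its order by one.
\<close>

definition bessel_E :: "complex \<Rightarrow> complex \<Rightarrow> complex" where
  "bessel_E \<nu> z = (\<Sum>k. rGamma (of_nat k + \<nu> + 1) / fact k * z ^ k)"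

text \<open>
  The lower bound \<open>m\<close> may be kept fixed while \<open>w\<close> varies, which makes the resulting bounds locally uniform in
  the order of the Bessel functions.
\<close>

lemma norm_rGamma_add_of_nat_le:
  fixes w :: complex
  assumes m: "0 < m" "m \<le> 1" "m \<le> Re w"
  shows "norm (rGamma (w + of_nat k)) \<le> norm (rGamma w) / (m ^ k * fact k)"
proof -
  have "m ^ k * fact k \<le> norm (pochhammer w k)"
  proof (induction k)
    case (Suc k)
    have "m * (real k + 1) \<le> Re (w + of_nat k)"
      using m mult_left_mono[of m 1 "real k"] by (simp add: algebra_simps)
    also have "\<dots> \<le> norm (w + of_nat k)" by (rule complex_Re_le_cmod)
    finally have "(m ^ k * fact k) * (m * (real k + 1)) \<le> norm (pochhammer w k) * norm (w + of_nat k)"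
      using Suc m by (intro mult_mono) auto
    moreover have "norm (pochhammer w (Suc k)) = norm (pochhammer w k) * norm (w + of_nat k)"
      by (simp add: pochhammer_Suc norm_mult)
    ultimately show ?case by (simp add: algebra_simps)
  qed simp
  then have "(m ^ k * fact k) * norm (rGamma (w + of_nat k)) \<le> norm (pochhammer w k) * norm (rGamma (w + of_nat k))"
    by (rule mult_right_mono) simp
  also have "\<dots> = norm (rGamma w)" by (subst pochhammer_rGamma[of w k]) (simp add: norm_mult)
  finally show ?thesis using m by (simp add: field_simps)
qed

lemma norm_bessel_E_term_le:
  assumes m: "0 < m" "m \<le> 1" "m \<le> Re \<nu> + 1"
  shows "norm (rGamma (of_nat k + \<nu> + 1) / fact k * z ^ k) \<le> norm (rGamma (\<nu> + 1)) * ((norm z / m) ^ k / (fact k)\<^sup>2)"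
proof -
  have "norm (rGamma (of_nat k + \<nu> + 1)) \<le> norm (rGamma (\<nu> + 1)) / (m ^ k * fact k)"
    using norm_rGamma_add_of_nat_le[of m "\<nu> + 1" k] m by (simp add: add_ac)
  then have "norm (rGamma (of_nat k + \<nu> + 1)) * (norm z ^ k / fact k) \<le> norm (rGamma (\<nu> + 1)) / (m ^ k * fact k) * (norm z ^ k / fact k)"
    by (rule mult_right_mono) simp
  then show ?thesis by (simp add: norm_mult norm_divide norm_power power_divide power2_eq_square mult_ac)
qed

lemma summable_power_over_fact_squared: "summable (\<lambda>k. x ^ k / (fact k)\<^sup>2 :: real)"
proof (rule summable_comparison_test')
  show "summable (\<lambda>k. inverse (fact k) * \<bar>x\<bar> ^ k)" by (rule summable_exp)
  fix k :: nat
  have "\<bar>x\<bar> ^ k / (fact k)\<^sup>2 \<le> \<bar>x\<bar> ^ k / fact k"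
    by (intro divide_left_mono) (auto simp: power2_eq_square)
  then show "norm (x ^ k / (fact k)\<^sup>2) \<le> inverse (fact k) * \<bar>x\<bar> ^ k" by (simp add: power_abs divide_inverse mult.commute abs_mult)
qed

lemma summable_bessel_E:
  assumes "Re \<nu> > - 1"
  shows "summable (\<lambda>k. norm (rGamma (of_nat k + \<nu> + 1) / fact k * z ^ k))"
proof -
  define m where "m = min 1 (Re \<nu> + 1)"
  have m: "0 < m" "m \<le> 1" "m \<le> Re \<nu> + 1" using assms by (auto simp: m_def)
  show ?thesis
    by (rule summable_comparison_test'[OF summable_mult[OF summable_power_over_fact_squared]])
       (use norm_bessel_E_term_le[OF m] in auto)
qed

lemma has_field_derivative_bessel_E:
  assumes "Re \<nu> > - 1"
  shows "(bessel_E \<nu> has_field_derivative bessel_E (\<nu> + 1) z) (at z)"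
proof -
  define c where "c = (\<lambda>k. rGamma (of_nat k + \<nu> + 1) / fact k)"
  have "((\<lambda>x. \<Sum>n. c n * x ^ n) has_field_derivative (\<Sum>n. diffs c n * z ^ n)) (at z)"
    by (rule termdiffs_strong_converges_everywhere)
       (unfold c_def, rule summable_norm_cancel, rule summable_bessel_E[OF assms])
  moreover have "diffs c = (\<lambda>k. rGamma (of_nat k + (\<nu> + 1) + 1) / fact k)"
  proof (rule ext)
    fix k :: nat
    have "of_nat (Suc k) + \<nu> + 1 = of_nat k + (\<nu> + 1) + (1 :: complex)" by simp
    then show "diffs c k = rGamma (of_nat k + (\<nu> + 1) + 1) / fact k"
      by (simp add: diffs_def c_def divide_simps del: of_nat_Suc)
  qed
  ultimately show ?thesis unfolding bessel_E_def[abs_def] c_def by simp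
qed

lemma continuous_on_bessel_E:
  assumes "Re \<nu> > - 1" shows "continuous_on A (bessel_E \<nu>)"
  using has_field_derivative_bessel_E[OF assms] DERIV_continuous_on[of A "bessel_E \<nu>" "bessel_E (\<nu> + 1)"]
  by (simp add: has_field_derivative_at_within)

text \<open>
  Tannery's theorem: for orders near \<open>\<nu>\<close> the terms of the series have a common summable majorant.
\<close>

lemma isCont_bessel_E_order:
  assumes "Re \<nu> > - 1"
  shows "isCont (\<lambda>\<nu>. bessel_E \<nu> z) \<nu>"
proof -
  \<comment> \<open>Half the distance of \<open>Re \<nu> + 1\<close> to 0 leaves room for the orders near \<open>\<nu>\<close>.\<close>
  define m where "m = min 1 ((Re \<nu> + 1) / 2)"
  have m: "0 < m" "m \<le> 1" "m < Re \<nu> + 1" using assms by (auto simp: m_def min_def)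
  define K where "K = norm (rGamma (\<nu> + 1)) + 1"
  have lim: "((\<lambda>\<mu>. rGamma (of_nat k + \<mu> + 1) / fact k * z ^ k) \<longlongrightarrow> rGamma (of_nat k + \<nu> + 1) / fact k * z ^ k) (at \<nu>)" for k
  proof -
    have "isCont (\<lambda>\<mu>. rGamma (of_nat k + \<mu> + 1) / fact k * z ^ k) \<nu>" by (intro continuous_intros) auto
    then show ?thesis by (simp add: isCont_def)
  qed
  have e1: "\<forall>\<^sub>F \<mu> in at \<nu>. m < Re \<mu> + 1"
    using m(3) by (intro order_tendstoD(1)[of _ "Re \<nu> + 1"] tendsto_intros) auto
  have e2: "\<forall>\<^sub>F \<mu> in at \<nu>. norm (rGamma (\<mu> + 1)) < K"
  proof (rule order_tendstoD(2)[of _ "norm (rGamma (\<nu> + 1))"])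
    have "isCont (\<lambda>\<mu>. norm (rGamma (\<mu> + 1))) \<nu>" by (intro continuous_intros)
    then show "((\<lambda>\<mu>. norm (rGamma (\<mu> + 1))) \<longlongrightarrow> norm (rGamma (\<nu> + 1))) (at \<nu>)" by (simp add: isCont_def)
  qed (simp add: K_def)
  have "\<forall>\<^sub>F \<mu> in at \<nu>. \<forall>k. norm (rGamma (of_nat k + \<mu> + 1) / fact k * z ^ k) \<le> K * ((norm z / m) ^ k / (fact k)\<^sup>2)"
    using e1 e2
  proof eventually_elim
    case (elim \<mu>)
    show ?case
    proof
      fix k
      have "norm (rGamma (of_nat k + \<mu> + 1) / fact k * z ^ k) \<le> norm (rGamma (\<mu> + 1)) * ((norm z / m) ^ k / (fact k)\<^sup>2)"
        by (rule norm_bessel_E_term_le) (use m elim in auto)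
      also have "\<dots> \<le> K * ((norm z / m) ^ k / (fact k)\<^sup>2)"
        using elim m by (intro mult_right_mono) auto
      finally show "norm (rGamma (of_nat k + \<mu> + 1) / fact k * z ^ k) \<le> K * ((norm z / m) ^ k / (fact k)\<^sup>2)" .
    qed
  qed
  then have ev: "\<forall>\<^sub>F (k, \<mu>) in at_top \<times>\<^sub>F at \<nu>. norm (rGamma (of_nat k + \<mu> + 1) / fact k * z ^ k) \<le> K * ((norm z / m) ^ k / (fact k)\<^sup>2)"
    unfolding eventually_prod_filter
    by (intro exI[of _ "\<lambda>_. True"] exI[of _ "\<lambda>\<mu>. \<forall>k. norm (rGamma (of_nat k + \<mu> + 1) / fact k * z ^ k) \<le> K * ((norm z / m) ^ k / (fact k)\<^sup>2)"]) auto
  have "((\<lambda>\<mu>. bessel_E \<mu> z) \<longlongrightarrow> bessel_E \<nu> z) (at \<nu>)"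
    unfolding bessel_E_def
    using tannerys_theorem[OF lim ev summable_mult[OF summable_power_over_fact_squared] at_neq_bot] by blast
  then show ?thesis by (simp add: isCont_def)
qed

lemma bessel_I_eq_bessel_E:
  assumes "z \<noteq> 0" "Re \<nu> > - 1"
  shows "bessel_I \<nu> z = (z / 2) powr \<nu> * bessel_E \<nu> ((z / 2)\<^sup>2)"
proof -
  have eq: "(z / 2) powr (2 * of_nat k + \<nu>) * rGamma (of_nat k + \<nu> + 1) / fact k
    = (z / 2) powr \<nu> * (rGamma (of_nat k + \<nu> + 1) / fact k * ((z / 2)\<^sup>2) ^ k)" for k
  proof -
    have "(z / 2) powr (2 * of_nat k + \<nu>) = (z / 2) powr (of_nat (2 * k)) * (z / 2) powr \<nu>"
      by (simp add: powr_add)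
    also have "(z / 2) powr (of_nat (2 * k)) = ((z / 2)\<^sup>2) ^ k"
      using assms(1) by (subst powr_nat) (simp_all add: power_mult)
    finally show ?thesis by simp
  qed
  show ?thesis unfolding bessel_I_def bessel_E_def eq
    by (rule suminf_mult) (rule summable_norm_cancel, rule summable_bessel_E[OF assms(2)])
qed

section \<open>Growth of Bessel functions and bounds for the kernel\<close>

text \<open>
  The value of \<open>E\<^sub>0\<close>, that is, \<open>I\<^sub>0(2 \<surd>x)\<close>.
\<close>

definition bessel_majorant :: "real \<Rightarrow> real" where
  "bessel_majorant x = (\<Sum>k. x ^ k / (fact k)\<^sup>2)"

lemma bessel_majorant_nonneg: "0 \<le> x \<Longrightarrow> 0 \<le> bessel_majorant x"
  unfolding bessel_majorant_def by (intro suminf_nonneg summable_power_over_fact_squared) auto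

lemma bessel_majorant_mono: "0 \<le> x \<Longrightarrow> x \<le> y \<Longrightarrow> bessel_majorant x \<le> bessel_majorant y"
  unfolding bessel_majorant_def
  by (intro suminf_le summable_power_over_fact_squared divide_right_mono power_mono) auto

lemma norm_bessel_E_le:
  assumes "Re \<nu> \<ge> 0"
  shows "norm (bessel_E \<nu> z) \<le> norm (rGamma (\<nu> + 1)) * bessel_majorant (norm z)"
proof -
  have s: "summable (\<lambda>k. norm (rGamma (of_nat k + \<nu> + 1) / fact k * z ^ k))"
    by (rule summable_bessel_E) (use assms in auto)
  have "norm (bessel_E \<nu> z) \<le> (\<Sum>k. norm (rGamma (of_nat k + \<nu> + 1) / fact k * z ^ k))"
    unfolding bessel_E_def by (rule summable_norm[OF s])
  also have "\<dots> \<le> (\<Sum>k. norm (rGamma (\<nu> + 1)) * (norm z ^ k / (fact k)\<^sup>2))"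
    using norm_bessel_E_term_le[of 1 \<nu> _ z] assms
    by (intro suminf_le s summable_mult summable_power_over_fact_squared) auto
  also have "\<dots> = norm (rGamma (\<nu> + 1)) * bessel_majorant (norm z)"
    unfolding bessel_majorant_def by (rule suminf_mult[OF summable_power_over_fact_squared])
  finally show ?thesis .
qed

text \<open>
  The probability \<open>(2k choose k) / 4\<^bsup>k\<^esup>\<close> of a tie in \<open>2 k\<close> tosses of a coin. It is the quotient of the \<open>k\<close>-th
  term of \<open>I\<^sub>0(x)\<close> by the term of degree \<open>2 k\<close> of \<open>exp x\<close>.
\<close>

definition central_ratio :: "nat \<Rightarrow> real" where
  "central_ratio k = fact (2 * k) / ((fact k)\<^sup>2 * 4 ^ k)"

lemma central_ratio_Suc: "central_ratio (Suc k) = central_ratio k * ((2 * real k + 1) / (2 * real k + 2))"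
proof -
  have "fact (2 * Suc k) = (2 * real k + 2) * ((2 * real k + 1) * fact (2 * k))"
    by (simp add: algebra_simps)
  then show ?thesis unfolding central_ratio_def
    by (simp add: divide_simps power2_eq_square) (simp add: algebra_simps)
qed

text \<open>
  The inductive step is \<open>(2 k + 1) (2 k + 3) \<le> (2 k + 2)\<^sup>2\<close>.
\<close>

lemma central_ratio_squared_le: "(central_ratio k)\<^sup>2 * (2 * real k + 1) \<le> 1"
proof (induction k)
  case 0
  show ?case by (simp add: central_ratio_def)
next
  case (Suc k)
  have "(central_ratio (Suc k))\<^sup>2 * (2 * real (Suc k) + 1)
      = ((central_ratio k)\<^sup>2 * (2 * real k + 1)) * ((2 * real k + 1) * (2 * real k + 3) / (2 * real k + 2)\<^sup>2)"
    unfolding central_ratio_Suc by (simp add: power_mult_distrib power_divide power2_eq_square add_ac)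
  also have "\<dots> \<le> 1 * 1"
  proof (rule mult_mono[OF Suc])
    show "(2 * real k + 1) * (2 * real k + 3) / (2 * real k + 2)\<^sup>2 \<le> 1"
      by (subst pos_divide_le_eq, simp) (simp add: power2_eq_square algebra_simps)
  qed auto
  finally show ?case by simp
qed

lemma sum_subseries_exp_le:
  fixes x :: real and g :: "nat \<Rightarrow> nat"
  assumes x: "0 \<le> x" and inj: "inj_on g {..<n}"
  shows "(\<Sum>k<n. x ^ g k / fact (g k)) \<le> exp x"
proof -
  have "(\<Sum>k<n. x ^ g k / fact (g k)) = (\<Sum>j\<in>g ` {..<n}. x ^ j / fact j)"
    by (simp add: sum.reindex[OF inj])
  also have "\<dots> \<le> (\<Sum>j. x ^ j / fact j)"
    using summable_exp[of x] x by (intro sum_le_suminf finite_imageI finite_lessThan) (auto simp: divide_inverse mult.commute)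
  also have "\<dots> = exp x" by (simp add: exp_def divide_inverse mult.commute)
  finally show ?thesis .
qed

lemma power_over_fact_squared_eq: "(r\<^sup>2) ^ k / (fact k)\<^sup>2 = (2 * r) ^ (2 * k) / fact (2 * k) * central_ratio k"
  by (simp add: central_ratio_def power_mult power_mult_distrib)

text \<open>
  Each term is at most the corresponding even term of the exponential series, as central ratios do not
  exceed 1.
\<close>

lemma bessel_majorant_le_exp:
  assumes r: "0 \<le> r"
  shows "bessel_majorant (r\<^sup>2) \<le> exp (2 * r)"
  unfolding bessel_majorant_def
proof (rule suminf_le_const[OF summable_power_over_fact_squared])
  fix n
  have "central_ratio k \<le> 1" for k
  proof (rule power2_le_imp_le)
    have "(central_ratio k)\<^sup>2 * 1 \<le> (central_ratio k)\<^sup>2 * (2 * real k + 1)" by (intro mult_left_mono) auto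
    then show "(central_ratio k)\<^sup>2 \<le> 1\<^sup>2" using central_ratio_squared_le[of k] by simp
  qed simp
  then have "(\<Sum>k<n. (r\<^sup>2) ^ k / (fact k)\<^sup>2) \<le> (\<Sum>k<n. (2 * r) ^ (2 * k) / fact (2 * k))"
    unfolding power_over_fact_squared_eq using r by (intro sum_mono mult_left_le) auto
  also have "\<dots> \<le> exp (2 * r)" by (rule sum_subseries_exp_le) (use r in \<open>auto simp: inj_on_def\<close>)
  finally show "(\<Sum>k<n. (r\<^sup>2) ^ k / (fact k)\<^sup>2) \<le> exp (2 * r)" .
qed

text \<open>
  The central ratios decrease like \<open>k\<^bsup>-1/2\<^esup>\<close>, and the terms with \<open>2 k\<close> near \<open>2 r\<close> dominate; this is the source
  of the factor \<open>r\<^bsup>-1/2\<^esup>\<close>. To avoid locating the dominant terms, the ratio is bounded through the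
  arithmetic-geometric mean inequality by a combination of \<open>1\<close> and \<open>1 / (2 k + 1)\<close>, which produce the
  even and the odd part of the exponential series respectively.
\<close>

lemma bessel_majorant_le_exp_over_sqrt:
  assumes r: "0 < r"
  shows "bessel_majorant (r\<^sup>2) \<le> exp (2 * r) / sqrt (2 * r)"
  unfolding bessel_majorant_def
proof (rule suminf_le_const[OF summable_power_over_fact_squared])
  fix n
  define x where "x = 2 * r"
  have x: "x > 0" using r by (simp add: x_def)
  \<comment> \<open>The arithmetic-geometric mean inequality with the weight \<open>\<surd>x\<close>, which balances both parts.\<close>
  have le: "central_ratio k \<le> 1 / (2 * sqrt x) + sqrt x / 2 * (1 / (2 * real k + 1))" for k
  proof -
    have c: "(central_ratio k)\<^sup>2 \<le> 1 / (2 * real k + 1)"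
      using central_ratio_squared_le[of k] by (simp add: field_simps)
    have "(1 - sqrt x * central_ratio k)\<^sup>2 = 1 - 2 * sqrt x * central_ratio k + x * (central_ratio k)\<^sup>2"
      using x by (simp add: power2_diff power_mult_distrib)
    then have "2 * sqrt x * central_ratio k \<le> 1 + x * (central_ratio k)\<^sup>2"
      using zero_le_power2[of "1 - sqrt x * central_ratio k"] by linarith
    also have "\<dots> \<le> 1 + x * (1 / (2 * real k + 1))" using c x by (intro add_left_mono mult_left_mono) auto
    finally have "central_ratio k \<le> (1 + x * (1 / (2 * real k + 1))) / (2 * sqrt x)"
      using x by (simp add: pos_le_divide_eq mult_ac)
    also have "\<dots> = 1 / (2 * sqrt x) + (x / sqrt x) / 2 * (1 / (2 * real k + 1))"
      by (simp add: add_divide_distrib)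
    also have "x / sqrt x = sqrt x" using x by (simp add: real_div_sqrt)
    finally show ?thesis .
  qed
  have "(\<Sum>k<n. (r\<^sup>2) ^ k / (fact k)\<^sup>2) \<le> (\<Sum>k<n. 1 / (2 * sqrt x) * (x ^ (2 * k) / fact (2 * k)) + sqrt x / (2 * x) * (x ^ (2 * k + 1) / fact (2 * k + 1)))"
  proof (rule sum_mono)
    fix k
    have "(r\<^sup>2) ^ k / (fact k)\<^sup>2 \<le> x ^ (2 * k) / fact (2 * k) * (1 / (2 * sqrt x) + sqrt x / 2 * (1 / (2 * real k + 1)))"
      unfolding power_over_fact_squared_eq x_def[symmetric] using x by (intro mult_left_mono le) auto
    also have "\<dots> = 1 / (2 * sqrt x) * (x ^ (2 * k) / fact (2 * k)) + sqrt x / (2 * x) * (x ^ (2 * k + 1) / fact (2 * k + 1))"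
    proof -
      have "x ^ (2 * k + 1) / fact (2 * k + 1) = x * (x ^ (2 * k) / fact (2 * k)) * (1 / (2 * real k + 1))"
        by (simp add: divide_simps)
      then have "sqrt x / (2 * x) * (x ^ (2 * k + 1) / fact (2 * k + 1)) = x ^ (2 * k) / fact (2 * k) * (sqrt x / 2 * (1 / (2 * real k + 1)))"
        using x by simp (simp add: field_simps)
      then show ?thesis by (simp only: distrib_left mult.commute)
    qed
    finally show "(r\<^sup>2) ^ k / (fact k)\<^sup>2 \<le> 1 / (2 * sqrt x) * (x ^ (2 * k) / fact (2 * k)) + sqrt x / (2 * x) * (x ^ (2 * k + 1) / fact (2 * k + 1))" .
  qed
  also have "\<dots> = 1 / (2 * sqrt x) * (\<Sum>k<n. x ^ (2 * k) / fact (2 * k)) + sqrt x / (2 * x) * (\<Sum>k<n. x ^ (2 * k + 1) / fact (2 * k + 1))"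
    by (simp only: sum.distrib sum_distrib_left)
  also have "\<dots> \<le> 1 / (2 * sqrt x) * exp x + sqrt x / (2 * x) * exp x"
    using x by (intro add_mono mult_left_mono sum_subseries_exp_le) (auto simp: inj_on_def)
  also have "\<dots> = exp x / sqrt x"
  proof -
    have "sqrt x / (2 * x) = 1 / (2 * sqrt x)" using x by (simp add: field_simps)
    then show ?thesis by simp
  qed
  finally show "(\<Sum>k<n. (r\<^sup>2) ^ k / (fact k)\<^sup>2) \<le> exp (2 * r) / sqrt (2 * r)" unfolding x_def .
qed

lemma sinh_le_mult_cosh:
  fixes x :: real
  assumes "0 \<le> x"
  shows "sinh x \<le> x * cosh x"
proof -
  have "(\<lambda>x. x * cosh x - sinh x) 0 \<le> (\<lambda>x. x * cosh x - sinh x) x"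
  proof (rule DERIV_nonneg_imp_nondecreasing[OF assms])
    fix y :: real
    assume "0 \<le> y"
    then show "\<exists>d. ((\<lambda>x. x * cosh x - sinh x) has_real_derivative d) (at y) \<and> 0 \<le> d"
      by (intro exI[of _ "y * sinh y"]) (auto intro!: derivative_eq_intros)
  qed
  then show ?thesis by simp
qed

text \<open>
  By the reflection formula \<open>\<bar>\<Gamma>(1 + i\<tau>)\<bar>\<^bsup>-2\<^esup> = sinh (\<pi>\<tau>) / (\<pi>\<tau>)\<close>, which is at most \<open>cosh (\<pi>\<tau>)\<close> and hence at
  most its square.
\<close>

lemma norm_rGamma_imaginary_le: "norm (rGamma (\<i> * of_real \<tau> + 1)) \<le> cosh (pi * \<tau>)"
proof (cases "\<tau> = 0")
  case False
  define r where "r = norm (rGamma (\<i> * of_real \<tau> + 1))"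
  have "sinh (complex_of_real y) = of_real (sinh y)" for y
    unfolding sinh_def of_real_minus[symmetric] exp_of_real by (simp add: scaleR_conv_of_real)
  from this[of "pi * \<tau>"] have sh: "sinh (complex_of_real pi * complex_of_real \<tau>) = of_real (sinh (pi * \<tau>))" by simp
  have "rGamma (\<i> * of_real \<tau>) * rGamma (1 - \<i> * of_real \<tau>) = sin (of_real pi * (\<i> * of_real \<tau>)) / of_real pi"
    by (rule rGamma_reflection_complex)
  moreover have "rGamma (\<i> * of_real \<tau>) = \<i> * of_real \<tau> * rGamma (\<i> * of_real \<tau> + 1)"
    by (rule rGamma_plus1[symmetric])
  moreover have "rGamma (1 - \<i> * of_real \<tau>) = cnj (rGamma (\<i> * of_real \<tau> + 1))"
    by (simp add: cnj_rGamma)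
  ultimately have "\<i> * of_real \<tau> * (rGamma (\<i> * of_real \<tau> + 1) * cnj (rGamma (\<i> * of_real \<tau> + 1))) = sin (\<i> * of_real (pi * \<tau>)) / of_real pi"
    by (simp add: mult_ac)
  also have "sin (\<i> * of_real (pi * \<tau>)) = \<i> * sinh (of_real (pi * \<tau>))"
    by (simp add: sinh_conv_sin)
  also have "rGamma (\<i> * of_real \<tau> + 1) * cnj (rGamma (\<i> * of_real \<tau> + 1)) = of_real (r\<^sup>2)"
    unfolding r_def by (rule complex_norm_square[symmetric])
  finally have "\<i> * of_real (\<tau> * r\<^sup>2) = \<i> * complex_of_real (sinh (pi * \<tau>) / pi)"
    by (simp add: sh mult.assoc)
  then have "of_real (\<tau> * r\<^sup>2) = complex_of_real (sinh (pi * \<tau>) / pi)"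
    by (metis complex_i_not_zero mult_cancel_left)
  then have eq: "\<tau> * r\<^sup>2 = sinh (pi * \<tau>) / pi" unfolding of_real_eq_iff .
  have "\<bar>\<tau>\<bar> * r\<^sup>2 = sinh (pi * \<bar>\<tau>\<bar>) / pi"
    using eq by (cases "\<tau> \<ge> 0") auto
  also have "\<dots> \<le> pi * \<bar>\<tau>\<bar> * cosh (pi * \<bar>\<tau>\<bar>) / pi"
    by (intro divide_right_mono sinh_le_mult_cosh) auto
  finally have "r\<^sup>2 \<le> cosh (pi * \<bar>\<tau>\<bar>)" using False by simp
  also have "\<dots> \<le> (cosh (pi * \<bar>\<tau>\<bar>))\<^sup>2"
    using cosh_real_ge_1[of "pi * \<bar>\<tau>\<bar>"] by (simp add: power2_eq_square)
  finally have "r \<le> cosh (pi * \<bar>\<tau>\<bar>)" by (rule power2_le_imp_le) simp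
  also have "cosh (pi * \<bar>\<tau>\<bar>) = cosh (pi * \<tau>)" by (cases "\<tau> \<ge> 0") auto
  finally show ?thesis unfolding r_def .
qed simp

lemma F_kernel_eq_bessel_E:
  assumes "x > 0"
  shows "F_kernel \<tau> x = exp (- x / 2) * Re (exp (\<i> * of_real (\<tau> * ln (x / 4))) * bessel_E (\<i> * of_real \<tau>) (of_real ((x / 4)\<^sup>2)))"
proof -
  have "bessel_I (\<i> * of_real \<tau>) (of_real (x / 2)) = (of_real (x / 2) / 2) powr (\<i> * of_real \<tau>) * bessel_E (\<i> * of_real \<tau>) ((of_real (x / 2) / 2)\<^sup>2)"
    by (rule bessel_I_eq_bessel_E) (use assms in auto)
  also have "of_real (x / 2) / 2 = complex_of_real (x / 4)" by simp
  also have "complex_of_real (x / 4) powr (\<i> * of_real \<tau>) = exp (\<i> * of_real (\<tau> * ln (x / 4)))"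
    unfolding powr_def using assms Ln_of_real[of "x / 4"] by (simp add: mult.assoc)
  finally show ?thesis unfolding F_kernel_def by simp
qed

lemma abs_F_kernel_le_majorant:
  assumes "x > 0"
  shows "\<bar>F_kernel \<tau> x\<bar> \<le> cosh (pi * \<tau>) * (exp (- x / 2) * bessel_majorant ((x / 4)\<^sup>2))"
proof -
  have "\<bar>F_kernel \<tau> x\<bar> \<le> exp (- x / 2) * norm (exp (\<i> * of_real (\<tau> * ln (x / 4))) * bessel_E (\<i> * of_real \<tau>) (of_real ((x / 4)\<^sup>2)))"
    unfolding F_kernel_eq_bessel_E[OF assms] abs_mult by (intro mult_mono abs_Re_le_cmod) auto
  also have "\<dots> = exp (- x / 2) * norm (bessel_E (\<i> * of_real \<tau>) (of_real ((x / 4)\<^sup>2)))"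
    by (simp add: norm_mult)
  also have "\<dots> \<le> exp (- x / 2) * (norm (rGamma (\<i> * of_real \<tau> + 1)) * bessel_majorant (norm (of_real ((x / 4)\<^sup>2) :: complex)))"
    by (intro mult_left_mono norm_bessel_E_le) auto
  finally have "\<bar>F_kernel \<tau> x\<bar> \<le> exp (- x / 2) * (norm (rGamma (\<i> * of_real \<tau> + 1)) * bessel_majorant (norm (of_real ((x / 4)\<^sup>2) :: complex)))" .
  also have "\<dots> \<le> exp (- x / 2) * (cosh (pi * \<tau>) * bessel_majorant (norm (of_real ((x / 4)\<^sup>2) :: complex)))"
    by (intro mult_left_mono mult_right_mono norm_rGamma_imaginary_le bessel_majorant_nonneg) auto
  finally have "\<bar>F_kernel \<tau> x\<bar> \<le> exp (- x / 2) * (cosh (pi * \<tau>) * bessel_majorant (norm (of_real ((x / 4)\<^sup>2) :: complex)))" .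
  moreover have "norm (of_real ((x / 4)\<^sup>2) :: complex) = (x / 4)\<^sup>2" by (simp only: norm_of_real) simp
  ultimately show ?thesis by (simp only: mult.left_commute)
qed

text \<open>
  At imaginary order the power \<open>(x/4)\<^bsup>i\<tau>\<^esup>\<close> has modulus 1, so both bounds are those for \<open>I\<^sub>0\<close>, whose growth
  \<open>exp (x/2)\<close> is cancelled by the exponential factor of the kernel.
\<close>

lemma abs_F_kernel_le:
  assumes x: "x > 0"
  shows "\<bar>F_kernel \<tau> x\<bar> \<le> cosh (pi * \<tau>)"
    and "\<bar>F_kernel \<tau> x\<bar> \<le> cosh (pi * \<tau>) * (sqrt 2 * x powr (- 1 / 2))"
proof -
  have "exp (- x / 2) * bessel_majorant ((x / 4)\<^sup>2) \<le> exp (- x / 2) * exp (2 * (x / 4))"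
    by (intro mult_left_mono bessel_majorant_le_exp) (use x in auto)
  then have 1: "exp (- x / 2) * bessel_majorant ((x / 4)\<^sup>2) \<le> 1" by (simp flip: exp_add)
  show "\<bar>F_kernel \<tau> x\<bar> \<le> cosh (pi * \<tau>)"
    using order_trans[OF abs_F_kernel_le_majorant[OF x] mult_left_mono[OF 1]] by simp
  have "exp (- x / 2) * bessel_majorant ((x / 4)\<^sup>2) \<le> exp (- x / 2) * (exp (2 * (x / 4)) / sqrt (2 * (x / 4)))"
    by (intro mult_left_mono bessel_majorant_le_exp_over_sqrt) (use x in auto)
  also have "\<dots> = 1 / sqrt (x / 2)" by (simp flip: exp_add)
  also have "\<dots> = sqrt 2 * x powr (- 1 / 2)"
    using x by (simp add: real_sqrt_divide powr_minus_divide powr_half_sqrt)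
  finally have 2: "exp (- x / 2) * bessel_majorant ((x / 4)\<^sup>2) \<le> sqrt 2 * x powr (- 1 / 2)" .
  show "\<bar>F_kernel \<tau> x\<bar> \<le> cosh (pi * \<tau>) * (sqrt 2 * x powr (- 1 / 2))"
    by (rule order_trans[OF abs_F_kernel_le_majorant[OF x] mult_left_mono[OF 2]]) simp
qed

lemma continuous_on_F_kernel_exp: "continuous_on UNIV (\<lambda>u. F_kernel \<tau> (exp u))"
proof -
  have eq: "(\<lambda>u. F_kernel \<tau> (exp u)) = (\<lambda>u. exp (- exp u / 2) * Re (exp (\<i> * of_real (\<tau> * (u - ln 4))) * bessel_E (\<i> * of_real \<tau>) (of_real ((exp u / 4)\<^sup>2))))"
    by (rule ext, subst F_kernel_eq_bessel_E) (simp_all add: ln_div)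
  have "continuous_on UNIV (\<lambda>u::real. bessel_E (\<i> * of_real \<tau>) (of_real ((exp u / 4)\<^sup>2)))"
    by (rule continuous_on_compose2[OF continuous_on_bessel_E[of _ UNIV]]) (auto intro!: continuous_intros)
  then show ?thesis unfolding eq by (intro continuous_intros) auto
qed

lemma isCont_F_kernel_order:
  assumes "x > 0"
  shows "isCont (\<lambda>\<tau>. F_kernel \<tau> x) \<tau>"
proof -
  have "isCont (\<lambda>\<tau>. bessel_E (\<i> * of_real \<tau>) (of_real ((x / 4)\<^sup>2))) \<tau>"
    by (rule isCont_o2[where g = "\<lambda>\<nu>. bessel_E \<nu> (of_real ((x / 4)\<^sup>2))"]) (auto intro!: continuous_intros isCont_bessel_E_order)
  then have "isCont (\<lambda>\<tau>. exp (\<i> * of_real (\<tau> * ln (x / 4))) * bessel_E (\<i> * of_real \<tau>) (of_real ((x / 4)\<^sup>2))) \<tau>"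
    by (intro continuous_intros)
  from isCont_Re[OF this] show ?thesis unfolding F_kernel_eq_bessel_E[OF assms] by (intro continuous_intros)
qed

section \<open>The Macdonald function as an exponential integral\<close>

text \<open>
  The mean value inequality on the convex set \<open>S\<close> turns the bound on the derivative into one on the
  difference quotients, to which dominated convergence applies.
\<close>

lemma has_field_derivative_integral_dominated:
  fixes f f' :: "complex \<Rightarrow> real \<Rightarrow> complex"
  assumes S: "open S" "convex S" "y \<in> S"
    and deriv: "\<And>y u. y \<in> S \<Longrightarrow> ((\<lambda>y. f y u) has_field_derivative f' y u) (at y)"
    and bound: "\<And>y u. y \<in> S \<Longrightarrow> norm (f' y u) \<le> w u"
    and w: "integrable lborel w"
    and f: "\<And>y. y \<in> S \<Longrightarrow> integrable lborel (f y)"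
    and f': "f' y \<in> borel_measurable borel"
  shows "((\<lambda>y. \<integral>u. f y u \<partial>lborel) has_field_derivative (\<integral>u. f' y u \<partial>lborel)) (at y)"
proof -
  have "(\<lambda>n. ((\<integral>u. f (X n) u \<partial>lborel) - (\<integral>u. f y u \<partial>lborel)) / (X n - y)) \<longlonglongrightarrow> (\<integral>u. f' y u \<partial>lborel)"
    if X: "\<And>n. X n \<noteq> y" "X \<longlonglongrightarrow> y" for X
  proof -
    have "\<forall>\<^sub>F n in sequentially. X n \<in> S" using topological_tendstoD[OF X(2) S(1,3)] .
    then obtain N where N: "\<And>n. n \<ge> N \<Longrightarrow> X n \<in> S" by (auto simp: eventually_sequentially)
    define Y where "Y = (\<lambda>n. X (n + N))"
    have YS: "Y n \<in> S" for n by (simp add: Y_def N)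
    have Yn: "Y n - y \<noteq> 0" for n using X(1) by (simp add: Y_def)
    have Yl: "Y \<longlonglongrightarrow> y" unfolding Y_def by (rule LIMSEQ_ignore_initial_segment[OF X(2)])
    have Yat: "filterlim Y (at y) sequentially"
      using Yl Yn by (simp add: filterlim_at)
    have "(\<lambda>n. \<integral>u. (f (Y n) u - f y u) / (Y n - y) \<partial>lborel) \<longlonglongrightarrow> (\<integral>u. f' y u \<partial>lborel)"
    proof (rule integral_dominated_convergence[OF _ _ w])
      show "f' y \<in> borel_measurable lborel" using f' by simp
      show "(\<lambda>u. (f (Y n) u - f y u) / (Y n - y)) \<in> borel_measurable lborel" for n
        using f[OF YS, of n] f[OF S(3)] by (intro borel_measurable_divide borel_measurable_diff borel_measurable_const borel_measurable_integrable)
      show "AE u in lborel. (\<lambda>n. (f (Y n) u - f y u) / (Y n - y)) \<longlonglongrightarrow> f' y u"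
      proof (rule AE_I2)
        fix u
        have "((\<lambda>z. (f z u - f y u) / (z - y)) \<longlongrightarrow> f' y u) (at y)"
          using deriv[OF S(3), of u] by (simp add: has_field_derivative_iff)
        then show "(\<lambda>n. (f (Y n) u - f y u) / (Y n - y)) \<longlonglongrightarrow> f' y u"
          by (rule filterlim_compose[OF _ Yat])
      qed
      show "AE u in lborel. norm ((f (Y n) u - f y u) / (Y n - y)) \<le> w u" for n
      proof (rule AE_I2)
        fix u
        have "norm (f (Y n) u - f y u) \<le> w u * norm (Y n - y)"
          by (rule field_differentiable_bound[OF S(2), where f' = "\<lambda>z. f' z u"])
             (use YS S(3) deriv bound in \<open>auto intro: has_field_derivative_at_within\<close>)
        then show "norm ((f (Y n) u - f y u) / (Y n - y)) \<le> w u"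
          using Yn[of n] by (simp add: norm_divide divide_le_eq)
      qed
    qed
    moreover have "(\<integral>u. (f (Y n) u - f y u) / (Y n - y) \<partial>lborel) = ((\<integral>u. f (Y n) u \<partial>lborel) - (\<integral>u. f y u \<partial>lborel)) / (Y n - y)" for n
      using f[OF YS, of n] f[OF S(3)] by (simp only: integral_divide_zero Bochner_Integration.integral_diff)
    ultimately have "(\<lambda>n. ((\<integral>u. f (X (n + N)) u \<partial>lborel) - (\<integral>u. f y u \<partial>lborel)) / (X (n + N) - y)) \<longlonglongrightarrow> (\<integral>u. f' y u \<partial>lborel)"
      by (simp only: Y_def)
    then show ?thesis by (rule LIMSEQ_offset)
  qed
  then have "((\<lambda>z. ((\<integral>u. f z u \<partial>lborel) - (\<integral>u. f y u \<partial>lborel)) / (z - y)) \<longlongrightarrow> (\<integral>u. f' y u \<partial>lborel)) (at y)"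
    by (subst LIMSEQ_SEQ_conv[symmetric]) blast
  then show ?thesis by (simp add: has_field_derivative_iff)
qed

definition macdonald_weight :: "complex \<Rightarrow> complex \<Rightarrow> real \<Rightarrow> complex" where
  "macdonald_weight \<nu> y u = exp (\<nu> * of_real u - of_real (exp u) - y * of_real (exp (- u)))"

text \<open>
  At \<open>y = (z/2)\<^sup>2\<close> this is \<open>2 (z/2)\<^bsup>\<nu>\<^esup> K\<^sub>\<nu>(z)\<close>. In this normalisation it is holomorphic in the right half-plane,
  and differentiation lowers the order by one.
\<close>

definition macdonald_integral :: "complex \<Rightarrow> complex \<Rightarrow> complex" where
  "macdonald_integral \<nu> y = (\<integral>u. macdonald_weight \<nu> y u \<partial>lborel)"

lemma measurable_macdonald_weight [measurable]: "macdonald_weight \<nu> y \<in> borel_measurable borel"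
  unfolding macdonald_weight_def by (intro borel_measurable_continuous_onI continuous_intros)

lemma norm_macdonald_weight: "norm (macdonald_weight \<nu> y u) = exp (Re \<nu> * u - exp u - Re y * exp (- u))"
  by (simp add: macdonald_weight_def)

text \<open>
  The factor \<open>exp (- c exp (- u))\<close> is smaller than any power of \<open>exp u\<close> as \<open>u\<close> tends to minus infinity, so
  after a shift of \<open>\<sigma>\<close> to a positive value the integrand of a Gamma integral dominates.
\<close>

lemma integrable_macdonald_real_scaled:
  fixes \<sigma> a c :: real
  assumes a: "a > 0" and c: "c > 0"
  shows "integrable lborel (\<lambda>u. exp (\<sigma> * u - a * exp u - c * exp (- u)))"
proof -
  obtain N :: nat where N: "real N > - \<sigma>" using reals_Archimedean2 by blast
  define K where "K = fact N / c ^ N"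
  show ?thesis
  proof (rule Bochner_Integration.integrable_bound)
    show "integrable lborel (\<lambda>u. K * exp ((\<sigma> + real N) * u - a * exp u))"
      using gamma_weight_integral_real(1)[of "\<sigma> + real N" a] N a by (intro integrable_mult_right) auto
    show "(\<lambda>u. exp (\<sigma> * u - a * exp u - c * exp (- u))) \<in> borel_measurable lborel" by measurable
    have "exp (\<sigma> * u - a * exp u - c * exp (- u)) \<le> K * exp ((\<sigma> + real N) * u - a * exp u)" for u
    proof -
      have "(c * exp (- u)) ^ N / fact N \<le> exp (c * exp (- u))"
        using sum_subseries_exp_le[of "c * exp (- u)" "\<lambda>_. N" 1] c by (simp add: inj_on_def)
      then have "exp (- (c * exp (- u))) \<le> fact N / (c * exp (- u)) ^ N"
        using c by (simp add: exp_minus field_simps)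
      also have "\<dots> = K * exp (real N * u)"
      proof -
        have "exp (- u) ^ N = inverse (exp (real N * u))"
          by (simp add: exp_of_nat_mult exp_minus power_inverse)
        then show ?thesis by (simp add: K_def power_mult_distrib divide_inverse)
      qed
      finally have "exp (\<sigma> * u - a * exp u) * exp (- (c * exp (- u))) \<le> exp (\<sigma> * u - a * exp u) * (K * exp (real N * u))"
        by (rule mult_left_mono) simp
      moreover have "exp (\<sigma> * u - a * exp u - c * exp (- u)) = exp (\<sigma> * u - a * exp u) * exp (- (c * exp (- u)))"
        by (simp flip: exp_add)
      moreover have "exp (\<sigma> * u - a * exp u) * (K * exp (real N * u)) = K * exp ((\<sigma> + real N) * u - a * exp u)"
      proof -
        have "(\<sigma> + real N) * u - a * exp u = (\<sigma> * u - a * exp u) + real N * u" by (simp add: distrib_right)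
        then show ?thesis by (simp only: exp_add) simp
      qed
      ultimately show ?thesis by simp
    qed
    then show "AE u in lborel. norm (exp (\<sigma> * u - a * exp u - c * exp (- u))) \<le> norm (K * exp ((\<sigma> + real N) * u - a * exp u))"
      by (intro AE_I2) (use c in \<open>simp add: K_def\<close>)
  qed
qed

lemma integrable_macdonald_real:
  fixes \<sigma> c :: real
  assumes c: "c > 0"
  shows "integrable lborel (\<lambda>u. exp (\<sigma> * u - exp u - c * exp (- u)))"
  using integrable_macdonald_real_scaled[of 1 c \<sigma>] c by simp

lemma integrable_macdonald_weight:
  assumes "Re y > 0"
  shows "integrable lborel (macdonald_weight \<nu> y)"
  by (rule Bochner_Integration.integrable_bound[OF integrable_macdonald_real[OF assms, of "Re \<nu>"]])
     (auto simp: norm_macdonald_weight)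

lemma has_field_derivative_macdonald_integral:
  assumes y: "Re y > 0"
  shows "(macdonald_integral \<nu> has_field_derivative - macdonald_integral (\<nu> - 1) y) (at y)"
proof -
  define S where "S = {z. Re z > Re y / 2}"
  have "((\<lambda>y. \<integral>u. macdonald_weight \<nu> y u \<partial>lborel) has_field_derivative (\<integral>u. - macdonald_weight (\<nu> - 1) y u \<partial>lborel)) (at y)"
  proof (rule has_field_derivative_integral_dominated[where S = S])
    show "open S" unfolding S_def by (rule open_halfspace_Re_gt)
    show "convex S" unfolding S_def by (rule convex_halfspace_Re_gt)
    show "y \<in> S" using y by (simp add: S_def)
    show "integrable lborel (\<lambda>u. exp (Re (\<nu> - 1) * u - exp u - (Re y / 2) * exp (- u)))"
      by (rule integrable_macdonald_real) (use y in simp)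
    show "integrable lborel (macdonald_weight \<nu> z)" if "z \<in> S" for z
      by (rule integrable_macdonald_weight) (use that y in \<open>simp add: S_def\<close>)
    show "(\<lambda>u. - macdonald_weight (\<nu> - 1) y u) \<in> borel_measurable borel" by measurable
    show "norm (- macdonald_weight (\<nu> - 1) z u) \<le> exp (Re (\<nu> - 1) * u - exp u - (Re y / 2) * exp (- u))" if "z \<in> S" for z u
      using that by (auto simp: norm_macdonald_weight S_def)
    show "((\<lambda>y. macdonald_weight \<nu> y u) has_field_derivative - macdonald_weight (\<nu> - 1) z u) (at z)" for z u
    proof -
      have "macdonald_weight (\<nu> - 1) z u = macdonald_weight \<nu> z u * of_real (exp (- u))"
        by (simp add: macdonald_weight_def exp_of_real[symmetric] algebra_simps flip: exp_add)
      then show ?thesis unfolding macdonald_weight_def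
        by (auto intro!: derivative_eq_intros simp: macdonald_weight_def)
    qed
  qed
  then show ?thesis unfolding macdonald_integral_def[abs_def] by simp
qed

lemma macdonald_integral_holomorphic: "macdonald_integral \<nu> holomorphic_on {z. Re z > 0}"
  by (rule holomorphic_onI)
     (use has_field_derivative_macdonald_integral field_differentiable_def field_differentiable_at_within in blast)

text \<open>
  The reflection of \<open>u\<close> at \<open>(ln y) / 2\<close> exchanges the two exponentials in the integrand.
\<close>

lemma macdonald_integral_uminus:
  assumes y: "y > (0::real)"
  shows "macdonald_integral (- \<nu>) (of_real y) = of_real y powr (- \<nu>) * macdonald_integral \<nu> (of_real y)"
proof -
  have "macdonald_integral (- \<nu>) (of_real y) = \<bar>- 1\<bar> *\<^sub>R (\<integral>u. macdonald_weight (- \<nu>) (of_real y) (ln y + (- 1) * u) \<partial>lborel)"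
    unfolding macdonald_integral_def by (rule lborel_integral_real_affine) simp
  also have "\<dots> = (\<integral>u. of_real y powr (- \<nu>) * macdonald_weight \<nu> (of_real y) u \<partial>lborel)"
  proof -
    have "macdonald_weight (- \<nu>) (of_real y) (ln y + (- 1) * u) = of_real y powr (- \<nu>) * macdonald_weight \<nu> (of_real y) u" for u
    proof -
      have e1: "exp (ln y + (- 1) * u) = y * exp (- u)" using y by (simp add: exp_diff exp_minus field_simps)
      have e2: "y * exp (- (ln y + (- 1) * u)) = exp u" using y by (simp add: exp_diff exp_minus field_simps)
      have "macdonald_weight (- \<nu>) (of_real y) (ln y + (- 1) * u)
        = exp (- \<nu> * of_real (ln y + (- 1) * u) - of_real (exp (ln y + (- 1) * u)) - of_real (y * exp (- (ln y + (- 1) * u))))"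
        by (simp add: macdonald_weight_def)
      also have "\<dots> = exp ((- \<nu> * of_real (ln y)) + (\<nu> * of_real u - of_real (exp u) - of_real y * of_real (exp (- u))))"
        unfolding e1 e2 by (simp add: algebra_simps)
      finally show ?thesis unfolding exp_add using y
        by (simp add: powr_def Ln_of_real macdonald_weight_def)
    qed
    then show ?thesis by simp
  qed
  finally show ?thesis unfolding macdonald_integral_def by simp
qed

lemma macdonald_integral_tendsto_Gamma:
  assumes \<nu>: "Re \<nu> > 0"
  shows "((\<lambda>y. macdonald_integral \<nu> (of_real y)) \<longlongrightarrow> Gamma \<nu>) (at_right 0)"
proof (rule tendsto_at_right_sequentially[of 0 1])
  fix X :: "nat \<Rightarrow> real"
  assume X: "\<And>n. 0 < X n" "X \<longlonglongrightarrow> 0"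
  \<comment> \<open>The dominating function is the integrand at \<open>y = 0\<close>, integrable because \<open>Re \<nu> > 0\<close>.\<close>
  have "(\<lambda>n. macdonald_integral \<nu> (of_real (X n))) \<longlonglongrightarrow> (\<integral>u. gamma_weight 1 \<nu> u \<partial>lborel)"
    unfolding macdonald_integral_def
  proof (rule integral_dominated_convergence[where w = "\<lambda>u. exp (Re \<nu> * u - 1 * exp u)"])
    show "integrable lborel (\<lambda>u. exp (Re \<nu> * u - 1 * exp u))"
      by (rule gamma_weight_integral_real) (use \<nu> in auto)
    show "AE u in lborel. (\<lambda>n. macdonald_weight \<nu> (of_real (X n)) u) \<longlonglongrightarrow> gamma_weight 1 \<nu> u"
    proof (rule AE_I2)
      fix u
      have "(\<lambda>n. exp (\<nu> * of_real u - of_real (exp u) - of_real (X n) * of_real (exp (- u)))) \<longlonglongrightarrow> exp (\<nu> * of_real u - of_real (exp u) - of_real 0 * of_real (exp (- u)))"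
        by (intro tendsto_intros X)
      then show "(\<lambda>n. macdonald_weight \<nu> (of_real (X n)) u) \<longlonglongrightarrow> gamma_weight 1 \<nu> u"
        by (simp add: macdonald_weight_def gamma_weight_def)
    qed
    show "AE u in lborel. norm (macdonald_weight \<nu> (of_real (X n)) u) \<le> exp (Re \<nu> * u - 1 * exp u)" for n
      by (intro AE_I2) (use X(1)[of n] in \<open>simp add: norm_macdonald_weight\<close>)
  qed measurable
  then show "(\<lambda>n. macdonald_integral \<nu> (of_real (X n))) \<longlonglongrightarrow> Gamma \<nu>"
    using gamma_weight_integral(2)[OF \<nu>, of 1] by simp
qed simp

lemma isCont_macdonald_integral_order:
  assumes y: "Re y > 0"
  shows "isCont (\<lambda>\<nu>. macdonald_integral \<nu> y) \<nu>"
proof (rule continuous_at_sequentiallyI)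
  fix X :: "nat \<Rightarrow> complex"
  assume X: "X \<longlonglongrightarrow> \<nu>"
  have "\<forall>\<^sub>F n in sequentially. dist (X n) \<nu> < 1" using tendstoD[OF X, of 1] by simp
  then obtain N where N: "\<And>n. n \<ge> N \<Longrightarrow> dist (X n) \<nu> < 1" by (auto simp: eventually_sequentially)
  \<comment> \<open>The sum of the integrands at the ends of a strip around \<open>Re \<nu>\<close> dominates those inside.\<close>
  define w where "w = (\<lambda>u. exp ((Re \<nu> + 1) * u - exp u - Re y * exp (- u)) + exp ((Re \<nu> - 1) * u - exp u - Re y * exp (- u)))"
  have "(\<lambda>n. macdonald_integral (X (n + N)) y) \<longlonglongrightarrow> macdonald_integral \<nu> y"
    unfolding macdonald_integral_def
  proof (rule integral_dominated_convergence[where w = w])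
    show "integrable lborel w" unfolding w_def by (intro Bochner_Integration.integrable_add integrable_macdonald_real y)
    show "AE u in lborel. (\<lambda>n. macdonald_weight (X (n + N)) y u) \<longlonglongrightarrow> macdonald_weight \<nu> y u"
      unfolding macdonald_weight_def
      by (intro AE_I2 tendsto_intros LIMSEQ_ignore_initial_segment[OF X])
    show "AE u in lborel. norm (macdonald_weight (X (n + N)) y u) \<le> w u" for n
    proof (rule AE_I2)
      fix u
      have "\<bar>Re (X (n + N) - \<nu>)\<bar> < 1"
        using N[of "n + N"] abs_Re_le_cmod[of "X (n + N) - \<nu>"] by (simp add: dist_norm)
      then have "Re \<nu> - 1 \<le> Re (X (n + N))" "Re (X (n + N)) \<le> Re \<nu> + 1" by auto
      then have "Re (X (n + N)) * u \<le> (Re \<nu> + 1) * u \<or> Re (X (n + N)) * u \<le> (Re \<nu> - 1) * u"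
        by (cases "u \<ge> 0") (auto intro: mult_right_mono mult_right_mono_neg)
      then show "norm (macdonald_weight (X (n + N)) y u) \<le> w u"
        unfolding norm_macdonald_weight w_def
        by (elim disjE) (auto intro: add_increasing add_increasing2)
    qed
  qed measurable
  then show "(\<lambda>n. macdonald_integral (X n) y) \<longlonglongrightarrow> macdonald_integral \<nu> y" by (rule LIMSEQ_offset)
qed

text \<open>
  The contribution of \<open>k\<close> in \<open>rGamma (k + \<nu>) = (k + \<nu>) rGamma (k + \<nu> + 1)\<close> shifts the series by one index.
\<close>

lemma bessel_E_recurrence:
  assumes "Re \<nu> > 0"
  shows "bessel_E (\<nu> - 1) z = \<nu> * bessel_E \<nu> z + z * bessel_E (\<nu> + 1) z"
proof -
  define c where "c = (\<lambda>k. rGamma (of_nat k + \<nu> + 1) / fact k)"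
  have s: "summable (\<lambda>k. c k * z ^ k)" unfolding c_def
    by (rule summable_norm_cancel, rule summable_bessel_E) (use assms in auto)
  have s1: "summable (\<lambda>k. rGamma (of_nat k + (\<nu> + 1) + 1) / fact k * z ^ k)"
    by (rule summable_norm_cancel, rule summable_bessel_E) (use assms in auto)
  have shift: "of_nat (Suc k) * (c (Suc k) * z ^ Suc k) = z * (rGamma (of_nat k + (\<nu> + 1) + 1) / fact k * z ^ k)" for k
  proof -
    have "of_nat (Suc k) + \<nu> + 1 = of_nat k + (\<nu> + 1) + (1 :: complex)" by simp
    moreover have "of_nat (Suc k) / fact (Suc k) = 1 / (fact k :: complex)"
      by (simp only: fact_Suc of_nat_mult of_nat_fact) (simp del: of_nat_Suc)
    ultimately show ?thesis unfolding c_def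
      by (metis (no_types, lifting) mult.commute mult.left_commute power_Suc times_divide_eq_left times_divide_eq_right mult_1)
  qed
  have "(\<lambda>k. z * (rGamma (of_nat k + (\<nu> + 1) + 1) / fact k * z ^ k)) sums (z * bessel_E (\<nu> + 1) z)"
    unfolding bessel_E_def by (intro sums_mult summable_sums s1)
  then have "(\<lambda>k. of_nat k * (c k * z ^ k)) sums (z * bessel_E (\<nu> + 1) z)"
    using sums_Suc[of "\<lambda>k. of_nat k * (c k * z ^ k)"] unfolding shift[symmetric] by simp
  moreover have "(\<lambda>k. \<nu> * (c k * z ^ k)) sums (\<nu> * bessel_E \<nu> z)"
    unfolding bessel_E_def using s by (intro sums_mult) (simp add: c_def summable_sums)
  ultimately have "(\<lambda>k. \<nu> * (c k * z ^ k) + of_nat k * (c k * z ^ k)) sums (\<nu> * bessel_E \<nu> z + z * bessel_E (\<nu> + 1) z)"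
    by (intro sums_add)
  moreover have "\<nu> * (c k * z ^ k) + of_nat k * (c k * z ^ k) = rGamma (of_nat k + (\<nu> - 1) + 1) / fact k * z ^ k" for k
  proof -
    have "rGamma (of_nat k + (\<nu> - 1) + 1) = (\<nu> + of_nat k) * rGamma (of_nat k + \<nu> + 1)"
      using rGamma_plus1[of "of_nat k + \<nu>"] by (simp add: add.commute)
    then show ?thesis by (simp only: c_def) (simp add: distrib_right add_divide_distrib mult.assoc)
  qed
  ultimately show ?thesis unfolding bessel_E_def by (simp add: sums_iff)
qed


text \<open>
  Uniqueness for a linear system with the singular coefficients \<open>y\<^bsup>\<nu>-1\<^esup>\<close> and \<open>y\<^bsup>-\<nu>\<^esup>\<close>, both integrable at 0 for
  \<open>0 < Re \<nu> < 1\<close>. Integrating the two equations in turn from 0 gains a factor \<open>\<kappa> y / n\<close> in the \<open>n\<close>-th round,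
  so \<open>a\<close> is bounded by all terms of an exponential series.
\<close>

lemma powr_system_unique:
  fixes a b :: "real \<Rightarrow> complex" and \<nu> :: complex
  assumes \<nu>: "0 < Re \<nu>" "Re \<nu> < 1"
    and a': "\<And>y. y > 0 \<Longrightarrow> (a has_vector_derivative - (of_real y powr (\<nu> - 1) * b y)) (at y)"
    and b': "\<And>y. y > 0 \<Longrightarrow> (b has_vector_derivative - (of_real y powr (- \<nu>) * a y)) (at y)"
    and a0: "(a \<longlongrightarrow> 0) (at_right 0)" and b0: "(b \<longlongrightarrow> 0) (at_right 0)"
    and y: "y > 0"
  shows "a y = 0"
proof -
  define \<sigma> where "\<sigma> = Re \<nu>"
  \<comment> \<open>Both functions are extended by 0 to be continuous on the closed interval.\<close>
  define A where "A = (\<lambda>t. if t \<le> 0 then 0 else a t)"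
  define B where "B = (\<lambda>t. if t \<le> 0 then 0 else b t)"
  have cont: "continuous_on {0..y} F" if F: "F = (\<lambda>t. if t \<le> 0 then 0 else f t)" and
      f': "\<And>t. t > 0 \<Longrightarrow> \<exists>D. (f has_vector_derivative D) (at t)" and f0: "(f \<longlongrightarrow> 0) (at_right 0)" for F f :: "real \<Rightarrow> complex"
  proof (rule continuous_on_eq_continuous_within[THEN iffD2], rule ballI)
    fix t assume t: "t \<in> {0..y}"
    show "continuous (at t within {0..y}) F"
    proof (cases "t = 0")
      case True
      have "(F \<longlongrightarrow> 0) (at_right 0)"
        by (rule Lim_transform_eventually[OF f0]) (auto simp: F eventually_at_right_field intro!: exI[of _ 1])
      moreover have "at 0 within {0..y} \<le> at_right 0"
        using y by (simp add: at_within_Icc_at_right)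
      ultimately have "(F \<longlongrightarrow> 0) (at 0 within {0..y})" by (rule tendsto_mono[rotated])
      then show ?thesis using True by (simp add: continuous_within F)
    next
      case False
      then have t0: "t > 0" using t by auto
      have "isCont f t" using f'[OF t0] has_vector_derivative_continuous by blast
      moreover have "\<forall>\<^sub>F s in nhds t. F s = f s"
        using eventually_gt_at_top[of 0] t0 eventually_nhds_in_open[of "{0<..}" t] by (auto simp: F elim!: eventually_mono)
      ultimately have "isCont F t" by (subst isCont_cong)
      then show ?thesis by (rule continuous_at_imp_continuous_at_within)
    qed
  qed
  have cA: "continuous_on {0..y} A" by (rule cont[OF A_def]) (use a' a0 in auto)
  have cB: "continuous_on {0..y} B" by (rule cont[OF B_def]) (use b' b0 in auto)
  have A': "(A has_vector_derivative - (of_real t powr (\<nu> - 1) * b t)) (at t)" if "t > 0" for t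
    by (rule has_vector_derivative_transform_within_open[OF a'[OF that], of "{0<..}"]) (use that in \<open>auto simp: A_def\<close>)
  have B': "(B has_vector_derivative - (of_real t powr (- \<nu>) * a t)) (at t)" if "t > 0" for t
    by (rule has_vector_derivative_transform_within_open[OF b'[OF that], of "{0<..}"]) (use that in \<open>auto simp: B_def\<close>)
  have npow: "norm (complex_of_real t powr z) = t powr Re z" if "t > 0" for t z
    using that by (simp add: norm_powr_real_powr)
  obtain M where M: "\<And>t. t \<in> {0..y} \<Longrightarrow> norm (A t) \<le> M"
    using compact_imp_bounded[OF compact_continuous_image[OF cA compact_Icc]] unfolding bounded_iff by blast
  have M0: "M \<ge> 0" using M[of 0] y norm_ge_zero[of "A 0"] by (simp add: A_def)
  define \<kappa> where "\<kappa> = 1 / (1 - \<sigma>)"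
  have \<kappa>: "\<kappa> > 0" using \<nu> by (simp add: \<kappa>_def \<sigma>_def)
  have bound: "\<forall>t\<in>{0..y}. norm (A t) \<le> M * (\<kappa> * t) ^ n / fact n" for n
  proof (induction n)
    case 0
    then show ?case using M by simp
  next
    case (Suc n)
    define K where "K = M * \<kappa> ^ n / fact n"
    have K0: "K \<ge> 0" using M0 \<kappa> by (simp add: K_def)
    define s where "s = real n + 1 - \<sigma>"
    have s: "s > 0" using \<nu> by (simp add: s_def \<sigma>_def)
    have s\<kappa>: "1 / s \<le> \<kappa>" using \<nu> unfolding \<kappa>_def s_def \<sigma>_def by (intro divide_left_mono) auto
    \<comment> \<open>First half of a round: the equation for \<open>b\<close> with the bound on \<open>a\<close> inserted.\<close>
    have bB: "norm (b t) \<le> K / s * t powr s" if t: "t \<in> {0<..y}" for t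
    proof -
      have "norm (B t - B 0) \<le> K / s * t powr s - K / s * 0 powr s"
      proof (rule differentiable_bound_general)
        show "0 < t" using t by simp
        show "continuous_on {0..t} B" using cB t by (auto intro: continuous_on_subset)
        show "continuous_on {0..t} (\<lambda>t. K / s * t powr s)"
          using s by (intro continuous_intros continuous_on_powr') auto
        fix r assume r: "0 < r" "r < t"
        show "(B has_vector_derivative - (of_real r powr (- \<nu>) * a r)) (at r)" by (rule B'[OF r(1)])
        show "((\<lambda>t. K / s * t powr s) has_vector_derivative K * r powr (s - 1)) (at r)"
          unfolding has_real_derivative_iff_has_vector_derivative[symmetric]
          using r s by (auto intro!: derivative_eq_intros)
        have "norm (- (of_real r powr (- \<nu>) * a r)) = r powr (- \<sigma>) * norm (A r)"
          using r by (simp add: norm_mult npow A_def \<sigma>_def)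
        also have "\<dots> \<le> r powr (- \<sigma>) * (M * (\<kappa> * r) ^ n / fact n)"
          using Suc.IH r t by (intro mult_left_mono) auto
        also have "\<dots> = K * (r powr (- \<sigma>) * r powr (real n))"
          using r by (simp add: K_def power_mult_distrib powr_realpow)
        also have "r powr (- \<sigma>) * r powr (real n) = r powr (s - 1)"
          by (simp add: s_def flip: powr_add)
        finally show "norm (- (of_real r powr (- \<nu>) * a r)) \<le> K * r powr (s - 1)" .
      qed
      then show ?thesis using t s by (simp add: B_def)
    qed
    show ?case
    proof
      fix t assume t: "t \<in> {0..y}"
      show "norm (A t) \<le> M * (\<kappa> * t) ^ Suc n / fact (Suc n)"
      proof (cases "t = 0")
        case False
        then have t0: "t > 0" using t by auto
        \<comment> \<open>Second half of a round: the equation for \<open>a\<close> with the bound on \<open>b\<close> inserted.\<close>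
        have "norm (A t - A 0) \<le> K * \<kappa> / (real n + 1) * t ^ Suc n - K * \<kappa> / (real n + 1) * 0 ^ Suc n"
        proof (rule differentiable_bound_general)
          show "0 < t" by fact
          show "continuous_on {0..t} A" using cA t by (auto intro: continuous_on_subset)
          show "continuous_on {0..t} (\<lambda>t. K * \<kappa> / (real n + 1) * t ^ Suc n)" by (intro continuous_intros)
          fix r assume r: "0 < r" "r < t"
          show "(A has_vector_derivative - (of_real r powr (\<nu> - 1) * b r)) (at r)" by (rule A'[OF r(1)])
          show "((\<lambda>t. K * \<kappa> / (real n + 1) * t ^ Suc n) has_vector_derivative K * \<kappa> * r ^ n) (at r)"
            unfolding has_real_derivative_iff_has_vector_derivative[symmetric]
            by (auto intro!: derivative_eq_intros simp del: power_Suc simp: add.commute[of 1])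
          have "norm (- (of_real r powr (\<nu> - 1) * b r)) = r powr (\<sigma> - 1) * norm (b r)"
            using r by (simp add: norm_mult npow \<sigma>_def)
          also have "\<dots> \<le> r powr (\<sigma> - 1) * (K / s * r powr s)"
            using r t by (intro mult_left_mono bB) auto
          also have "\<dots> = K * (1 / s) * (r powr (\<sigma> - 1) * r powr s)" by simp
          also have "r powr (\<sigma> - 1) * r powr s = r ^ n"
            using r by (simp add: s_def powr_realpow flip: powr_add)
          also have "K * (1 / s) * r ^ n \<le> K * \<kappa> * r ^ n"
            using K0 s\<kappa> r by (intro mult_right_mono mult_left_mono) auto
          finally show "norm (- (of_real r powr (\<nu> - 1) * b r)) \<le> K * \<kappa> * r ^ n" .
        qed
        then show ?thesis using t0 by (simp add: A_def K_def power_mult_distrib mult_ac add.commute[of 1])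
      qed (simp add: A_def)
    qed
  qed
  have "(\<lambda>n. M * (inverse (fact n) * (\<kappa> * y) ^ n)) \<longlonglongrightarrow> M * 0"
    by (intro tendsto_mult tendsto_const summable_LIMSEQ_zero summable_exp)
  then have "(\<lambda>n. M * (\<kappa> * y) ^ n / fact n) \<longlonglongrightarrow> 0" by (simp add: divide_inverse mult_ac)
  then have "norm (A y) \<le> 0"
    by (rule LIMSEQ_le_const) (use bound y in auto)
  then show ?thesis using y by (simp add: A_def)
qed

lemma bessel_E_at_0: "bessel_E \<nu> 0 = rGamma (\<nu> + 1)"
proof -
  show ?thesis unfolding bessel_E_def by (subst powser_zero) simp
qed

lemma has_vector_derivative_powr_mult_bessel_E:
  assumes y: "y > 0" and \<nu>: "Re \<nu> > 0"
  shows "((\<lambda>y. of_real y powr \<nu> * bessel_E \<nu> (of_real y)) has_vector_derivative of_real y powr (\<nu> - 1) * bessel_E (\<nu> - 1) (of_real y)) (at y)"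
proof (rule has_vector_derivative_real_field)
  have np: "complex_of_real y \<notin> \<real>\<^sub>\<le>\<^sub>0" using y by (simp add: complex_nonpos_Reals_iff)
  have "((\<lambda>z. z powr \<nu> * bessel_E \<nu> z) has_field_derivative
     (of_real y powr \<nu> * bessel_E (\<nu> + 1) (of_real y) + (\<nu> * of_real y powr (\<nu> - 1)) * bessel_E \<nu> (of_real y))) (at (of_real y))"
    by (rule DERIV_mult'[OF has_field_derivative_powr[OF np] has_field_derivative_bessel_E]) (use \<nu> in auto)
  also have "of_real y powr \<nu> = of_real y powr (\<nu> - 1) * of_real y"
    using y by (simp add: powr_diff)
  finally show "((\<lambda>z. z powr \<nu> * bessel_E \<nu> z) has_field_derivative of_real y powr (\<nu> - 1) * bessel_E (\<nu> - 1) (of_real y)) (at (of_real y))"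
    unfolding bessel_E_recurrence[OF \<nu>] by (simp add: algebra_simps)
qed

lemma has_vector_derivative_bessel_E:
  assumes "Re \<nu> > - 1"
  shows "((\<lambda>y. bessel_E \<nu> (of_real y)) has_vector_derivative bessel_E (\<nu> + 1) (of_real y)) (at y)"
  by (rule has_vector_derivative_real_field) (rule has_field_derivative_bessel_E[OF assms])

text \<open>
  The difference of Bessel functions that defines \<open>K\<^sub>\<nu>\<close>, in the normalisation of the exponential integral.
\<close>

definition macdonald_series :: "complex \<Rightarrow> real \<Rightarrow> complex" where
  "macdonald_series \<nu> y = of_real pi / sin (of_real pi * \<nu>) * (bessel_E (- \<nu>) (of_real y) - of_real y powr \<nu> * bessel_E \<nu> (of_real y))"

lemma sin_pi_nonzero_strip:
  assumes "\<bar>Re \<nu>\<bar> < 1" "\<nu> \<noteq> 0"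
  shows "sin (of_real pi * \<nu>) \<noteq> 0"
proof
  assume "sin (of_real pi * \<nu>) = 0"
  then obtain n :: int where "of_real pi * \<nu> = of_real n * of_real pi" by (auto simp: sin_eq_0 complex_is_Int_iff)
  then have n: "\<nu> = of_int n" by simp
  then have "\<bar>n\<bar> < 1" using assms(1) by simp
  then show False using n assms(2) by simp
qed

lemma has_vector_derivative_macdonald_series:
  assumes y: "y > 0" and \<nu>: "0 < Re \<nu>" "Re \<nu> < 1"
  shows "(macdonald_series \<nu> has_vector_derivative - (of_real y powr (\<nu> - 1) * macdonald_series (1 - \<nu>) y)) (at y)"
proof -
  have sn: "sin (of_real pi * (1 - \<nu>)) = sin (of_real pi * \<nu>)"
    by (simp add: right_diff_distrib sin_diff)
  have eq: "of_real y powr (\<nu> - 1) * (of_real y powr (1 - \<nu>) * bessel_E (1 - \<nu>) (of_real y)) = bessel_E (1 - \<nu>) (of_real y)"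
    using y by (simp add: powr_add[symmetric] flip: mult.assoc)
  have "(macdonald_series \<nu> has_vector_derivative of_real pi / sin (of_real pi * \<nu>) * (bessel_E (- \<nu> + 1) (of_real y) - of_real y powr (\<nu> - 1) * bessel_E (\<nu> - 1) (of_real y))) (at y)"
    unfolding macdonald_series_def[abs_def]
    by (intro has_vector_derivative_mult_right has_vector_derivative_diff has_vector_derivative_bessel_E has_vector_derivative_powr_mult_bessel_E) (use y \<nu> in auto)
  also have "of_real pi / sin (of_real pi * \<nu>) * (bessel_E (- \<nu> + 1) (of_real y) - of_real y powr (\<nu> - 1) * bessel_E (\<nu> - 1) (of_real y))
     = - (of_real y powr (\<nu> - 1) * macdonald_series (1 - \<nu>) y)"
  proof -
    have "of_real y powr (\<nu> - 1) * macdonald_series (1 - \<nu>) y = of_real pi / sin (of_real pi * \<nu>) *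
       (of_real y powr (\<nu> - 1) * bessel_E (\<nu> - 1) (of_real y) - of_real y powr (\<nu> - 1) * (of_real y powr (1 - \<nu>) * bessel_E (1 - \<nu>) (of_real y)))"
      unfolding macdonald_series_def sn by (simp add: right_diff_distrib mult.left_commute)
    also have "\<dots> = of_real pi / sin (of_real pi * \<nu>) * (of_real y powr (\<nu> - 1) * bessel_E (\<nu> - 1) (of_real y) - bessel_E (1 - \<nu>) (of_real y))"
      unfolding eq ..
    finally show ?thesis by (simp add: right_diff_distrib)
  qed
  finally show ?thesis .
qed

lemma macdonald_series_tendsto_Gamma:
  assumes \<nu>: "0 < Re \<nu>" "Re \<nu> < 1"
  shows "(macdonald_series \<nu> \<longlongrightarrow> Gamma \<nu>) (at_right 0)"
proof -
  have E: "((\<lambda>y. bessel_E \<mu> (of_real y)) \<longlongrightarrow> bessel_E \<mu> (of_real 0)) (at_right (0::real))" if "Re \<mu> > - 1" for \<mu>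
    using has_vector_derivative_continuous[OF has_vector_derivative_bessel_E[OF that, of 0]]
    by (simp add: isCont_def filterlim_at_split)
  have p: "((\<lambda>y. complex_of_real y powr \<nu>) \<longlongrightarrow> 0) (at_right 0)"
  proof (rule tendsto_norm_zero_cancel)
    have "((\<lambda>y::real. y powr Re \<nu>) \<longlongrightarrow> 0 powr Re \<nu>) (at_right 0)"
      by (rule tendsto_powr') (use \<nu> in \<open>auto intro!: tendsto_intros simp: eventually_at_right_field intro!: exI[of _ 1]\<close>)
    then have "((\<lambda>y::real. y powr Re \<nu>) \<longlongrightarrow> 0) (at_right 0)" using \<nu> by simp
    then show "((\<lambda>y. norm (complex_of_real y powr \<nu>)) \<longlongrightarrow> 0) (at_right 0)"
      by (rule Lim_transform_eventually) (auto simp: eventually_at_right_field norm_powr_real_powr intro!: exI[of _ 1])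
  qed
  have "(macdonald_series \<nu> \<longlongrightarrow> of_real pi / sin (of_real pi * \<nu>) * (bessel_E (- \<nu>) (of_real 0) - 0 * bessel_E \<nu> (of_real 0))) (at_right 0)"
    unfolding macdonald_series_def[abs_def]
    by (rule tendsto_mult[OF tendsto_const tendsto_diff[OF E tendsto_mult[OF p E]]]) (use \<nu> in auto)
  also have "of_real pi / sin (of_real pi * \<nu>) * (bessel_E (- \<nu>) (of_real 0) - 0 * bessel_E \<nu> (of_real 0)) = Gamma \<nu> * (Gamma (1 - \<nu>) * rGamma (1 - \<nu>))"
    by (simp add: bessel_E_at_0 Gamma_reflection_complex flip: mult.assoc)
  also have "Gamma (1 - \<nu>) * rGamma (1 - \<nu>) = 1"
  proof -
    have "1 - \<nu> \<notin> \<int>\<^sub>\<le>\<^sub>0"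
    proof
      assume "1 - \<nu> \<in> \<int>\<^sub>\<le>\<^sub>0"
      then obtain n where n: "1 - \<nu> = of_int n" "n \<le> 0" by (rule nonpos_Ints_cases)
      from arg_cong[OF n(1), of Re] n(2) \<nu> show False by simp
    qed
    then show ?thesis by (simp add: rGamma_inverse_Gamma Gamma_eq_zero_iff)
  qed
  finally show ?thesis by simp
qed

text \<open>
  Both sides, each together with its counterpart of order \<open>1 - \<nu>\<close>, solve the same first-order system and
  have the limits \<open>\<Gamma>(\<nu>)\<close> and \<open>\<Gamma>(1 - \<nu>)\<close> at 0. The reflection formula supplies the limit of the series.
\<close>

lemma macdonald_integral_eq_series_open_strip:
  assumes \<nu>: "0 < Re \<nu>" "Re \<nu> < 1" and y: "y > 0"
  shows "macdonald_integral \<nu> (of_real y) = macdonald_series \<nu> y"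
proof -
  have d: "((\<lambda>y. macdonald_integral \<mu> (of_real y)) has_vector_derivative - (of_real y powr (\<mu> - 1) * macdonald_integral (1 - \<mu>) (of_real y))) (at y)" if "y > 0" for \<mu> and y :: real
  proof -
    have "((\<lambda>y. macdonald_integral \<mu> (of_real y)) has_vector_derivative - macdonald_integral (\<mu> - 1) (of_real y)) (at y)"
      by (rule has_vector_derivative_real_field[OF has_field_derivative_macdonald_integral]) (use that in simp)
    then show ?thesis using macdonald_integral_uminus[OF that, of "1 - \<mu>"] by simp
  qed
  define a where "a = (\<lambda>y. macdonald_integral \<nu> (of_real y) - macdonald_series \<nu> y)"
  define b where "b = (\<lambda>y. macdonald_integral (1 - \<nu>) (of_real y) - macdonald_series (1 - \<nu>) y)"
  have \<nu>': "0 < Re (1 - \<nu>)" "Re (1 - \<nu>) < 1" using \<nu> by auto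
  have "a y = 0"
  proof (rule powr_system_unique[OF \<nu>, of a b])
    fix t :: real assume t: "t > 0"
    show "(a has_vector_derivative - (of_real t powr (\<nu> - 1) * b t)) (at t)"
      unfolding a_def b_def
      using has_vector_derivative_diff[OF d[OF t, of \<nu>] has_vector_derivative_macdonald_series[OF t \<nu>]]
      by (simp add: right_diff_distrib)
    show "(b has_vector_derivative - (of_real t powr (- \<nu>) * a t)) (at t)"
      unfolding a_def b_def
      using has_vector_derivative_diff[OF d[OF t, of "1 - \<nu>"] has_vector_derivative_macdonald_series[OF t \<nu>']]
      by (simp add: right_diff_distrib)
  next
    show "(a \<longlongrightarrow> 0) (at_right 0)" unfolding a_def
      using tendsto_diff[OF macdonald_integral_tendsto_Gamma[OF \<nu>(1)] macdonald_series_tendsto_Gamma[OF \<nu>]] by simp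
    show "(b \<longlongrightarrow> 0) (at_right 0)" unfolding b_def
      using tendsto_diff[OF macdonald_integral_tendsto_Gamma[OF \<nu>'(1)] macdonald_series_tendsto_Gamma[OF \<nu>']] by simp
  qed (rule y)
  then show ?thesis by (simp add: a_def)
qed

text \<open>
  Imaginary orders, the ones of the index transform, lie on the boundary of the strip and are reached by
  continuity in the order.
\<close>

lemma macdonald_integral_eq_series:
  assumes \<nu>: "0 \<le> Re \<nu>" "Re \<nu> < 1" "\<nu> \<noteq> 0" and y: "y > 0"
  shows "macdonald_integral \<nu> (of_real y) = macdonald_series \<nu> y"
proof -
  define X where "X = (\<lambda>n. \<nu> + of_real ((1 - Re \<nu>) / (real n + 2)))"
  have X: "X \<longlonglongrightarrow> \<nu>"
  proof -
    have "(\<lambda>n. (1 - Re \<nu>) / (real n + 2)) \<longlonglongrightarrow> 0" by real_asymp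
    then have "(\<lambda>n. \<nu> + of_real ((1 - Re \<nu>) / (real n + 2))) \<longlonglongrightarrow> \<nu> + of_real 0" by (intro tendsto_intros)
    then show ?thesis by (simp add: X_def)
  qed
  have Xs: "0 < Re (X n)" "Re (X n) < 1" for n
  proof -
    have "0 < (1 - Re \<nu>) / (real n + 2)" using \<nu> by (intro divide_pos_pos) auto
    moreover have "(1 - Re \<nu>) / (real n + 2) < 1 - Re \<nu>" using \<nu> by (simp add: divide_less_eq)
    moreover have "Re (X n) = Re \<nu> + (1 - Re \<nu>) / (real n + 2)" unfolding X_def by (simp only: plus_complex.sel Re_complex_of_real)
    ultimately show "0 < Re (X n)" "Re (X n) < 1" using \<nu>(1) by linarith+
  qed
  have sn: "sin (of_real pi * \<nu>) \<noteq> 0" using \<nu> by (intro sin_pi_nonzero_strip) auto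
  have E1: "isCont (\<lambda>\<mu>. bessel_E (- \<mu>) (of_real y)) \<nu>"
    by (rule isCont_o2[where g = "\<lambda>\<nu>. bessel_E \<nu> (of_real y)" and f = uminus]) (use \<nu> in \<open>auto intro!: isCont_bessel_E_order\<close>)
  have "isCont (\<lambda>\<mu>. macdonald_series \<mu> y) \<nu>"
    unfolding macdonald_series_def using sn y \<nu>
    by (intro continuous_intros E1 isCont_bessel_E_order) auto
  from isCont_tendsto_compose[OF this X] have 1: "(\<lambda>n. macdonald_series (X n) y) \<longlonglongrightarrow> macdonald_series \<nu> y" .
  have "isCont (\<lambda>\<mu>. macdonald_integral \<mu> (of_real y)) \<nu>" by (rule isCont_macdonald_integral_order) (use y in simp)
  from isCont_tendsto_compose[OF this X] have "(\<lambda>n. macdonald_integral (X n) (of_real y)) \<longlonglongrightarrow> macdonald_integral \<nu> (of_real y)" .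
  then have 2: "(\<lambda>n. macdonald_series (X n) y) \<longlonglongrightarrow> macdonald_integral \<nu> (of_real y)"
    by (simp add: macdonald_integral_eq_series_open_strip[OF Xs y])
  show ?thesis by (rule LIMSEQ_unique[OF 2 1])
qed

lemma bessel_K_quot_eq_macdonald_integral:
  assumes \<nu>: "0 \<le> Re \<nu>" "Re \<nu> < 1" "\<nu> \<noteq> 0" and z: "z > 0"
  shows "bessel_K_quot \<nu> (of_real z) = of_real (z / 2) powr (- \<nu>) * macdonald_integral \<nu> (of_real ((z / 2)\<^sup>2)) / 2"
proof -
  have I: "bessel_I \<mu> (of_real z) = of_real (z / 2) powr \<mu> * bessel_E \<mu> (of_real ((z / 2)\<^sup>2))" if "Re \<mu> > - 1" for \<mu>
    using bessel_I_eq_bessel_E[of "of_real z" \<mu>] that z by simp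
  have "of_real ((z / 2)\<^sup>2) powr \<nu> = (of_real (z / 2) * of_real (z / 2)) powr \<nu>" by (simp add: power2_eq_square)
  also have "\<dots> = of_real (z / 2) powr \<nu> * of_real (z / 2) powr \<nu>"
    by (rule powr_times_real) (use z in auto)
  finally have sq: "of_real ((z / 2)\<^sup>2) powr \<nu> = of_real (z / 2) powr \<nu> * complex_of_real (z / 2) powr \<nu>" .
  have inv: "of_real (z / 2) powr (- \<nu>) * complex_of_real (z / 2) powr \<nu> = 1"
    using z by (simp add: powr_minus)
  have zz: "(z / 2)\<^sup>2 > 0" using z by simp
  have "of_real (z / 2) powr (- \<nu>) * macdonald_integral \<nu> (of_real ((z / 2)\<^sup>2)) / 2
     = of_real pi / sin (of_real pi * \<nu>) * (of_real (z / 2) powr (- \<nu>) * bessel_E (- \<nu>) (of_real ((z / 2)\<^sup>2))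
        - (of_real (z / 2) powr (- \<nu>) * of_real (z / 2) powr \<nu>) * (of_real (z / 2) powr \<nu> * bessel_E \<nu> (of_real ((z / 2)\<^sup>2)))) / 2"
    unfolding macdonald_integral_eq_series[OF \<nu> zz] macdonald_series_def sq by (simp add: algebra_simps)
  also have "\<dots> = bessel_K_quot \<nu> (of_real z)"
    unfolding inv bessel_K_quot_def using I[of \<nu>] I[of "- \<nu>"] \<nu> by simp
  finally show ?thesis ..
qed

lemma bessel_K_quot_uminus: "bessel_K_quot (- \<nu>) z = bessel_K_quot \<nu> z"
proof -
  have "of_real pi / (2 * sin (of_real pi * (- \<nu>))) = - (of_real pi / (2 * sin (of_real pi * \<nu>)))" by simp
  then show ?thesis unfolding bessel_K_quot_def minus_minus
    by (metis minus_diff_eq minus_mult_minus)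
qed

text \<open>
  At order 0 the Macdonald function is a limit in the order. Nonzero orders near 0 with nonnegative real
  part are covered by the previous formula, the others by symmetry in the order.
\<close>

lemma bessel_K_eq_macdonald_integral:
  assumes z: "z > 0"
  shows "bessel_K (\<i> * of_real \<tau>) (of_real z) = of_real (z / 2) powr (- \<i> * of_real \<tau>) * macdonald_integral (\<i> * of_real \<tau>) (of_real ((z / 2)\<^sup>2)) / 2"
proof (cases "\<tau> = 0")
  case False
  then have "\<i> * of_real \<tau> \<notin> \<int>" by (auto simp: complex_is_Int_iff)
  then have "bessel_K (\<i> * of_real \<tau>) (of_real z) = bessel_K_quot (\<i> * of_real \<tau>) (of_real z)" by (simp add: bessel_K_def)
  then show ?thesis using bessel_K_quot_eq_macdonald_integral[of "\<i> * of_real \<tau>" z] False z by simp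
next
  case True
  define T where "T = (\<lambda>\<nu>. of_real (z / 2) powr (- \<nu>) * macdonald_integral \<nu> (of_real ((z / 2)\<^sup>2)) / 2)"
  have zz: "Re (of_real ((z / 2)\<^sup>2)) > 0" using z by simp
  have T0: "isCont T 0" unfolding T_def using z
    by (intro continuous_intros isCont_macdonald_integral_order[OF zz]) auto
  have l1: "(T \<longlongrightarrow> T 0) (at 0)" using T0 by (simp add: isCont_def)
  have "isCont (\<lambda>\<mu>. T (- \<mu>)) 0" by (rule isCont_o2[where g = T and f = uminus]) (use T0 in auto)
  then have l2: "((\<lambda>\<mu>. T (- \<mu>)) \<longlongrightarrow> T 0) (at 0)" by (simp add: isCont_def)
  have "((\<lambda>\<mu>. bessel_K_quot \<mu> (of_real z)) \<longlongrightarrow> T 0) (at 0)"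
  proof (rule tendstoI)
    fix e :: real assume e: "e > 0"
    have ev: "\<forall>\<^sub>F \<mu>::complex in at 0. norm \<mu> < 1"
      using eventually_at_ball[of 1 "0::complex" UNIV] by (simp add: dist_norm)
    have "\<forall>\<^sub>F \<mu>::complex in at 0. \<mu> \<noteq> 0" by (rule eventually_neq_at_within)
    with tendstoD[OF l1 e] tendstoD[OF l2 e] ev
    show "\<forall>\<^sub>F \<mu> in at 0. dist (bessel_K_quot \<mu> (of_real z)) (T 0) < e"
    proof eventually_elim
      case (elim \<mu>)
      have r: "\<bar>Re \<mu>\<bar> < 1" using elim abs_Re_le_cmod[of \<mu>] by simp
      show ?case
      proof (cases "Re \<mu> \<ge> 0")
        case True
        then have "bessel_K_quot \<mu> (of_real z) = T \<mu>"
          unfolding T_def using r elim z by (intro bessel_K_quot_eq_macdonald_integral) auto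
        then show ?thesis using elim by simp
      next
        case False
        then have "bessel_K_quot (- \<mu>) (of_real z) = T (- \<mu>)"
          unfolding T_def using r elim z by (intro bessel_K_quot_eq_macdonald_integral) auto
        then show ?thesis using elim by (simp add: bessel_K_quot_uminus)
      qed
    qed
  qed
  then have "Lim (at 0) (\<lambda>\<mu>. bessel_K_quot \<mu> (of_real z)) = T 0"
    by (intro tendsto_Lim) auto
  then show ?thesis using True by (simp add: bessel_K_def T_def)
qed

section \<open>An integral for the product of two Bessel functions\<close>

text \<open>
  The integral of the derivative of the weight over the real line vanishes.
\<close>

lemma macdonald_integral_recurrence:
  assumes y: "y > 0"
  shows "macdonald_integral (\<mu> + 1) (of_real y) = \<mu> * macdonald_integral \<mu> (of_real y) + of_real y * macdonald_integral (\<mu> - 1) (of_real y)"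
proof -
  define w where "w = (\<lambda>\<mu>. macdonald_weight \<mu> (of_real y))"
  define f where "f = (\<lambda>u. \<mu> * w \<mu> u - w (\<mu> + 1) u + of_real y * w (\<mu> - 1) u)"
  have wi: "integrable lborel (w \<mu>)" for \<mu>
    unfolding w_def by (rule integrable_macdonald_weight) (use y in simp)
  have fi: "integrable lborel f" unfolding f_def
    by (intro Bochner_Integration.integrable_add Bochner_Integration.integrable_diff integrable_mult_right wi)
  have w1: "w (\<mu> + 1) u = w \<mu> u * of_real (exp u)" and w2: "w (\<mu> - 1) u = w \<mu> u * of_real (exp (- u))" for u
    unfolding w_def macdonald_weight_def exp_of_real[symmetric] exp_add[symmetric]
    by (simp_all add: algebra_simps)
  have deriv: "(w \<mu> has_vector_derivative f u) (at u)" for u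
  proof -
    have "((\<lambda>u. \<mu> * of_real u - of_real (exp u) - of_real y * of_real (exp (- u))) has_vector_derivative (\<mu> * of_real 1 - of_real (exp u) - of_real y * of_real (- exp (- u)))) (at u)"
      by (intro has_vector_derivative_diff has_vector_derivative_mult_right has_vector_derivative_of_real)
         (auto intro!: derivative_eq_intros)
    then have "(w \<mu> has_vector_derivative (\<mu> * of_real 1 - of_real (exp u) - of_real y * of_real (- exp (- u))) * exp (\<mu> * of_real u - of_real (exp u) - of_real y * of_real (exp (- u)))) (at u)"
      unfolding w_def macdonald_weight_def[abs_def]
      using field_vector_diff_chain_at[of _ _ u exp "exp (\<mu> * of_real u - of_real (exp u) - of_real y * of_real (exp (- u)))"] DERIV_exp
      by (fastforce simp: o_def)
    also have "(\<mu> * of_real 1 - of_real (exp u) - of_real y * of_real (- exp (- u))) * exp (\<mu> * of_real u - of_real (exp u) - of_real y * of_real (exp (- u))) = f u"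
      unfolding f_def w1 w2 by (simp add: w_def macdonald_weight_def algebra_simps)
    finally show ?thesis .
  qed
  have cont: "isCont f u" for u
    unfolding f_def w_def macdonald_weight_def by (intro continuous_intros)
  have top: "(w \<mu> \<longlongrightarrow> 0) at_top"
  proof (rule tendsto_norm_zero_cancel)
    show "((\<lambda>u. norm (w \<mu> u)) \<longlongrightarrow> 0) at_top" unfolding w_def norm_macdonald_weight using y by simp real_asymp
  qed
  have bot: "(w \<mu> \<longlongrightarrow> 0) at_bot"
  proof (rule tendsto_norm_zero_cancel)
    show "((\<lambda>u. norm (w \<mu> u)) \<longlongrightarrow> 0) at_bot" unfolding w_def norm_macdonald_weight using y by simp real_asymp
  qed
  have "(LBINT u=-\<infinity>..\<infinity>. f u) = 0 - 0"
    by (rule interval_integral_FTC_integrable[where F = "w \<mu>"])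
       (use deriv cont fi top bot in \<open>auto simp: set_integrable_def ereal_tendsto_simps1 einterval_eq\<close>)
  then have "(\<integral>u. f u \<partial>lborel) = 0" by (simp add: interval_lebesgue_integral_def set_lebesgue_integral_def)
  also have "(\<integral>u. f u \<partial>lborel) = \<mu> * macdonald_integral \<mu> (of_real y) - macdonald_integral (\<mu> + 1) (of_real y) + of_real y * macdonald_integral (\<mu> - 1) (of_real y)"
    unfolding f_def macdonald_integral_def
    using wi[of \<mu>] wi[of "\<mu> + 1"] wi[of "\<mu> - 1"] unfolding w_def by simp
  finally show ?thesis by (simp add: algebra_simps)
qed

text \<open>
  The coefficient of \<open>l\<^bsup>k\<^esup> x\<^bsup>k+j\<^esup>\<close> in \<open>exp (- l x) E\<^sub>\<nu>(l x\<^sup>2)\<close>.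
\<close>

definition product_coeff :: "complex \<Rightarrow> nat \<Rightarrow> nat \<Rightarrow> complex" where
  "product_coeff \<nu> k j = (if j \<le> k then (- 1) ^ (k - j) * rGamma (of_nat j + \<nu> + 1) / (fact (k - j) * fact j) else 0)"

lemma product_coeff_recurrence:
  "of_nat (Suc k) * (of_nat (Suc k) + \<nu>) * product_coeff \<nu> (Suc k) j
     = (if j = 0 then 0 else product_coeff \<nu> k (j - 1)) - (\<nu> + of_nat (Suc k + j)) * product_coeff \<nu> k j"
proof (cases "j \<le> Suc k")
  case True
  define c where "c = product_coeff \<nu> (Suc k) j"
  have A: "(if j = 0 then 0 else product_coeff \<nu> k (j - 1)) = of_nat j * (of_nat j + \<nu>) * c"
  proof (cases j)
    case (Suc i)
    have r: "rGamma (of_nat i + \<nu> + 1) = (of_nat j + \<nu>) * rGamma (of_nat j + \<nu> + 1)"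
      using rGamma_plus1[of "of_nat j + \<nu>"] Suc by (simp add: add_ac)
    have "fact j = of_nat j * (fact i :: complex)" using Suc by simp
    then show ?thesis using Suc True unfolding c_def product_coeff_def
      by (simp add: r del: of_nat_Suc fact_Suc) 
  qed simp
  have B: "product_coeff \<nu> k j = - of_nat (Suc k - j) * c"
  proof (cases "j = Suc k")
    case False
    then have j: "j \<le> k" using True by simp
    then have "Suc k - j = Suc (k - j)" by simp
    then show ?thesis using j True unfolding c_def product_coeff_def
      by (simp del: of_nat_Suc)
  qed (simp add: product_coeff_def)
  have d: "of_nat (Suc k - j) = (of_nat (Suc k) - of_nat j :: complex)" using True by (rule of_nat_diff)
  show ?thesis unfolding A B c_def[symmetric] unfolding d by (simp add: algebra_simps)
qed (auto simp: product_coeff_def)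

text \<open>
  Multiplication of \<open>x = exp u\<close> into the Macdonald weight raises its order, so the left-hand side is the
  integral of the coefficient of \<open>l\<^bsup>k\<^esup>\<close> against the weight. The recurrence of the coefficients in \<open>k\<close> combines
  with the three-term recurrence of the integrals to a factor \<open>y\<close> per step.
\<close>

lemma product_coeff_moments:
  assumes y: "y > 0" and \<nu>: "Re \<nu> \<ge> 0"
  shows "(\<Sum>j\<le>k. product_coeff \<nu> k j * macdonald_integral (\<nu> + of_nat (k + j)) (of_real y))
     = rGamma (of_nat k + \<nu> + 1) / fact k * of_real y ^ k * macdonald_integral \<nu> (of_real y)"
proof (induction k)
  case 0
  show ?case by (simp add: product_coeff_def)
next
  case (Suc k)
  define M where "M = (\<lambda>n. macdonald_integral (\<nu> + of_nat n) (of_real y))"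
  have rec: "of_real y * M n = M (n + 2) - (\<nu> + of_nat (n + 1)) * M (n + 1)" for n
    using macdonald_integral_recurrence[OF y, of "\<nu> + of_nat (n + 1)"] by (simp add: M_def algebra_simps)
  have nz: "of_nat (Suc k) * (of_nat (Suc k) + \<nu>) \<noteq> 0"
  proof -
    have "Re (of_nat (Suc k) + \<nu>) > 0" using \<nu> by simp
    then have "of_nat (Suc k) + \<nu> \<noteq> 0" by (metis zero_complex.sel(1) less_irrefl)
    then show ?thesis by (simp del: of_nat_Suc)
  qed
  have "of_nat (Suc k) * (of_nat (Suc k) + \<nu>) * (\<Sum>j\<le>Suc k. product_coeff \<nu> (Suc k) j * M (Suc k + j))
    = (\<Sum>j\<le>Suc k. (if j = 0 then 0 else product_coeff \<nu> k (j - 1)) * M (Suc k + j)) - (\<Sum>j\<le>Suc k. (\<nu> + of_nat (Suc k + j)) * product_coeff \<nu> k j * M (Suc k + j))"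
    unfolding sum_distrib_left mult.assoc[symmetric] product_coeff_recurrence left_diff_distrib sum_subtractf ..
  also have "(\<Sum>j\<le>Suc k. (if j = 0 then 0 else product_coeff \<nu> k (j - 1)) * M (Suc k + j)) = (\<Sum>j\<le>k. product_coeff \<nu> k j * M (k + j + 2))"
    by (subst sum.atMost_Suc_shift) simp
  also have "(\<Sum>j\<le>Suc k. (\<nu> + of_nat (Suc k + j)) * product_coeff \<nu> k j * M (Suc k + j)) = (\<Sum>j\<le>k. product_coeff \<nu> k j * ((\<nu> + of_nat (k + j + 1)) * M (k + j + 1)))"
    by (simp add: product_coeff_def[of _ k "Suc k"] mult_ac)
  also have "(\<Sum>j\<le>k. product_coeff \<nu> k j * M (k + j + 2)) - (\<Sum>j\<le>k. product_coeff \<nu> k j * ((\<nu> + of_nat (k + j + 1)) * M (k + j + 1)))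
    = (\<Sum>j\<le>k. product_coeff \<nu> k j * (of_real y * M (k + j)))"
    unfolding rec by (simp add: sum_subtractf right_diff_distrib)
  also have "\<dots> = of_real y * (\<Sum>j\<le>k. product_coeff \<nu> k j * M (k + j))"
    by (simp add: sum_distrib_left mult_ac)
  also have "\<dots> = of_real y * (rGamma (of_nat k + \<nu> + 1) / fact k * of_real y ^ k * M 0)"
    using Suc.IH by (simp add: M_def)
  also have "rGamma (of_nat k + \<nu> + 1) = (of_nat (Suc k) + \<nu>) * rGamma (of_nat (Suc k) + \<nu> + 1)"
    using rGamma_plus1[of "of_nat (Suc k) + \<nu>"] by (simp add: add_ac)
  also have "of_real y * ((of_nat (Suc k) + \<nu>) * rGamma (of_nat (Suc k) + \<nu> + 1) / fact k * of_real y ^ k * M 0)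
    = of_nat (Suc k) * (of_nat (Suc k) + \<nu>) * (rGamma (of_nat (Suc k) + \<nu> + 1) / fact (Suc k) * of_real y ^ Suc k * M 0)"
    by (simp add: divide_simps del: of_nat_Suc)
  finally show ?case using nz by (simp only: mult_cancel_left) (simp add: M_def)
qed

lemma sums_integral_dominated:
  fixes f :: "nat \<Rightarrow> real \<Rightarrow> complex"
  assumes f: "\<And>n. integrable lborel (f n)"
    and lim: "\<And>u. (\<lambda>n. f n u) sums g u" and g: "g \<in> borel_measurable borel"
    and w: "integrable lborel w" and bound: "\<And>n u. (\<Sum>k<n. norm (f k u)) \<le> w u"
  shows "(\<lambda>n. \<integral>u. f n u \<partial>lborel) sums (\<integral>u. g u \<partial>lborel)"
proof -
  have "(\<lambda>n. \<integral>u. (\<Sum>k<n. f k u) \<partial>lborel) \<longlonglongrightarrow> (\<integral>u. g u \<partial>lborel)"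
  proof (rule integral_dominated_convergence[OF _ _ w])
    show "(\<lambda>u. \<Sum>k<n. f k u) \<in> borel_measurable lborel" for n
      by (intro borel_measurable_sum borel_measurable_integrable f)
    show "AE u in lborel. (\<lambda>n. \<Sum>k<n. f k u) \<longlonglongrightarrow> g u"
      using lim by (simp add: sums_def)
    show "AE u in lborel. norm (\<Sum>k<n. f k u) \<le> w u" for n
      by (intro AE_I2 order_trans[OF norm_sum bound])
  qed (use g in simp)
  then show ?thesis using f by (simp add: sums_def)
qed

text \<open>
  The integrand for a product of Bessel functions. Both \<open>a\<close> and \<open>b\<close> are parameters because a translation of
  \<open>u\<close>, which rescales \<open>exp u\<close>, changes them together.
\<close>

definition macdonald_product :: "complex \<Rightarrow> complex \<Rightarrow> real \<Rightarrow> complex \<Rightarrow> real \<Rightarrow> complex" where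
  "macdonald_product \<nu> a y b u = exp (\<nu> * of_real u - a * of_real (exp u) - of_real (y * exp (- u))) * bessel_E \<nu> (b * of_real (exp u ^ 2))"

lemma measurable_macdonald_product [measurable]:
  assumes "Re \<nu> \<ge> 0"
  shows "macdonald_product \<nu> a y b \<in> borel_measurable borel"
proof (rule borel_measurable_continuous_onI)
  have "continuous_on UNIV (\<lambda>u::real. bessel_E \<nu> (b * of_real (exp u ^ 2)))"
    by (rule continuous_on_compose2[OF continuous_on_bessel_E[of _ UNIV]]) (use assms in \<open>auto intro!: continuous_intros\<close>)
  then show "continuous_on UNIV (macdonald_product \<nu> a y b)"
    unfolding macdonald_product_def by (intro continuous_intros)
qed

text \<open>
  Expansion in powers of \<open>l\<close> and integration term by term. For \<open>l \<le> 1/16\<close> the absolute values of the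
  expanded terms sum to at most \<open>exp (9/16 exp u)\<close> up to a constant, which the factor \<open>exp (- exp u)\<close> of the
  weight absorbs.
\<close>

lemma product_formula_small:
  assumes y: "y > 0" and \<nu>: "Re \<nu> \<ge> 0" and l: "0 < l" "l \<le> 1 / 16"
  shows "(\<integral>u. macdonald_product \<nu> (of_real (1 + l)) y (of_real l) u \<partial>lborel) = bessel_E \<nu> (of_real (l * y)) * macdonald_integral \<nu> (of_real y)"
proof -
  define w where "w = macdonald_weight \<nu> (of_real y)"
  define A where "A = (\<lambda>u::real. \<lambda>j. rGamma (of_nat j + \<nu> + 1) / fact j * (of_real (l * exp u ^ 2)) ^ j)"
  define B where "B = (\<lambda>u::real. \<lambda>i. (of_real (- l * exp u) :: complex) ^ i /\<^sub>R fact i)"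
  have sA: "summable (\<lambda>j. norm (A u j))" for u unfolding A_def by (rule summable_bessel_E) (use \<nu> in auto)
  have sB: "summable (\<lambda>i. norm (B u i))" for u unfolding B_def by (rule summable_norm_exp)
  have suB: "(\<Sum>i. B u i) = exp (of_real (- l * exp u))" for u unfolding B_def exp_def ..
  have suA: "(\<Sum>j. A u j) = bessel_E \<nu> (of_real (l * exp u ^ 2))" for u unfolding A_def bessel_E_def ..
  define f where "f = (\<lambda>k u. w u * (\<Sum>j\<le>k. A u j * B u (k - j)))"
  have f_eq: "f k u = of_real l ^ k * (\<Sum>j\<le>k. product_coeff \<nu> k j * macdonald_weight (\<nu> + of_nat (k + j)) (of_real y) u)" for k u
  proof -
    have "w u * (A u j * B u (k - j)) = of_real l ^ k * (product_coeff \<nu> k j * macdonald_weight (\<nu> + of_nat (k + j)) (of_real y) u)" if j: "j \<le> k" for j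
    proof -
      have m: "macdonald_weight (\<nu> + of_nat (k + j)) (of_real y) u = w u * of_real (exp u) ^ (k + j)"
        unfolding w_def macdonald_weight_def exp_of_real[symmetric] exp_of_nat_mult[symmetric] exp_add[symmetric]
        by (simp add: algebra_simps)
      have "k + j = 2 * j + (k - j)" using j by simp
      then have e1: "complex_of_real (exp u) ^ (k + j) = (of_real (exp u) ^ 2) ^ j * of_real (exp u) ^ (k - j)"
        by (simp only: power_add[symmetric] power_mult[symmetric])
      have e2: "complex_of_real l ^ k = of_real l ^ j * of_real l ^ (k - j)"
        using j by (simp flip: power_add)
      have e3: "(of_real (- l * exp u) :: complex) ^ (k - j) = (- 1) ^ (k - j) * of_real l ^ (k - j) * of_real (exp u) ^ (k - j)"
        by (simp flip: power_mult_distrib)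
      show ?thesis
        unfolding m e1 e2 A_def B_def e3 product_coeff_def using j
        by (simp add: power_mult_distrib scaleR_conv_of_real divide_simps)
    qed
    then show ?thesis unfolding f_def sum_distrib_left by (intro sum.cong) auto
  qed
  have wi: "integrable lborel (macdonald_weight \<mu> (of_real y))" for \<mu> using y by (intro integrable_macdonald_weight) simp
  have fi: "integrable lborel (f k)" for k unfolding f_eq[abs_def]
    by (intro integrable_mult_right Bochner_Integration.integrable_sum wi)
  have fint: "(\<integral>u. f k u \<partial>lborel) = rGamma (of_nat k + \<nu> + 1) / fact k * of_real (l * y) ^ k * macdonald_integral \<nu> (of_real y)" for k
  proof -
    have "(\<integral>u. f k u \<partial>lborel) = of_real l ^ k * (\<Sum>j\<le>k. product_coeff \<nu> k j * macdonald_integral (\<nu> + of_nat (k + j)) (of_real y))"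
      unfolding f_eq[abs_def] macdonald_integral_def using wi by (simp add: Bochner_Integration.integral_sum)
    then show ?thesis unfolding product_coeff_moments[OF y \<nu>] by (simp add: power_mult_distrib mult_ac)
  qed
  define K where "K = norm (rGamma (\<nu> + 1))"
  have "(\<lambda>k. \<integral>u. f k u \<partial>lborel) sums (\<integral>u. macdonald_product \<nu> (of_real (1 + l)) y (of_real l) u \<partial>lborel)"
  proof (rule sums_integral_dominated[where w = "\<lambda>u. K * exp (Re \<nu> * u - (7 / 16) * exp u - y * exp (- u))", OF fi])
    fix u
    have "(\<lambda>k. \<Sum>j\<le>k. A u j * B u (k - j)) sums ((\<Sum>k. A u k) * (\<Sum>k. B u k))"
      by (rule Cauchy_product_sums[OF sA sB])
    from sums_mult[OF this, of "w u"]
    have "f' sums (w u * (bessel_E \<nu> (of_real (l * exp u ^ 2)) * exp (of_real (- l * exp u))))" if "f' = (\<lambda>k. f k u)" for f'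
      unfolding f_def suA suB that .
    moreover have "w u * (bessel_E \<nu> (of_real (l * exp u ^ 2)) * exp (of_real (- l * exp u))) = macdonald_product \<nu> (of_real (1 + l)) y (of_real l) u"
    proof -
      have "w u * exp (of_real (- l * exp u)) = exp (\<nu> * of_real u - of_real (1 + l) * of_real (exp u) - of_real (y * exp (- u)))"
        unfolding w_def macdonald_weight_def exp_add[symmetric] by (simp add: algebra_simps)
      then have "(w u * exp (of_real (- l * exp u))) * bessel_E \<nu> (of_real l * of_real (exp u ^ 2)) = macdonald_product \<nu> (of_real (1 + l)) y (of_real l) u"
        unfolding macdonald_product_def by (rule arg_cong)
      then show ?thesis unfolding of_real_mult[of l "exp u ^ 2"] by (simp only: mult_ac)
    qed
    ultimately show "(\<lambda>k. f k u) sums macdonald_product \<nu> (of_real (1 + l)) y (of_real l) u" by simp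
  next
    show "macdonald_product \<nu> (of_real (1 + l)) y (of_real l) \<in> borel_measurable borel" using \<nu> by measurable
    show "integrable lborel (\<lambda>u. K * exp (Re \<nu> * u - (7 / 16) * exp u - y * exp (- u)))"
      using y by (intro integrable_mult_right integrable_macdonald_real_scaled) auto
  next
    fix n u
    define r where "r = sqrt l * exp u"
    have r: "r > 0" "r\<^sup>2 = l * exp u ^ 2" using l by (auto simp: r_def power_mult_distrib)
    have "sqrt l \<le> sqrt (1 / 16)" using l(2) by (rule real_sqrt_le_mono)
    also have "sqrt (1 / 16) = (1 / 4 :: real)" by (simp add: real_sqrt_divide)
    finally have rle: "2 * r \<le> exp u / 2" unfolding r_def by simp
    have SA: "(\<Sum>j. norm (A u j)) \<le> K * exp (2 * r)"
    proof -
      have "(\<Sum>j. norm (A u j)) \<le> (\<Sum>j. K * ((r\<^sup>2) ^ j / (fact j)\<^sup>2))"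
      proof (rule suminf_le[OF _ sA])
        show "norm (A u j) \<le> K * ((r\<^sup>2) ^ j / (fact j)\<^sup>2)" for j
        proof -
          have "norm (complex_of_real (l * exp u ^ 2)) = r\<^sup>2" unfolding norm_of_real using l r(2) by simp
          then show ?thesis
            using norm_bessel_E_term_le[of 1 \<nu> j "of_real (l * exp u ^ 2)"] \<nu> unfolding A_def K_def by simp
        qed
        show "summable (\<lambda>j. K * ((r\<^sup>2) ^ j / (fact j)\<^sup>2))" by (intro summable_mult summable_power_over_fact_squared)
      qed
      also have "\<dots> = K * bessel_majorant (r\<^sup>2)" unfolding bessel_majorant_def
        by (rule suminf_mult[OF summable_power_over_fact_squared])
      also have "\<dots> \<le> K * exp (2 * r)" unfolding K_def using r by (intro mult_left_mono bessel_majorant_le_exp) auto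
      finally show ?thesis .
    qed
    have SB: "(\<Sum>i. norm (B u i)) = exp (l * exp u)"
    proof -
      have "norm (B u i) = (l * exp u) ^ i /\<^sub>R fact i" for i
        unfolding B_def using l by (simp add: norm_power norm_mult power_mult_distrib)
      then show ?thesis by (simp add: exp_def)
    qed
    have C: "(\<lambda>k. \<Sum>j\<le>k. norm (A u j) * norm (B u (k - j))) sums ((\<Sum>j. norm (A u j)) * (\<Sum>i. norm (B u i)))"
      by (rule Cauchy_product_sums) (use sA sB in auto)
    have "(\<Sum>k<n. norm (f k u)) \<le> (\<Sum>k<n. norm (w u) * (\<Sum>j\<le>k. norm (A u j) * norm (B u (k - j))))"
      unfolding f_def norm_mult by (intro sum_mono mult_left_mono order_trans[OF norm_sum]) (auto simp: norm_mult)
    also have "\<dots> = norm (w u) * (\<Sum>k<n. \<Sum>j\<le>k. norm (A u j) * norm (B u (k - j)))" by (simp add: sum_distrib_left)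
    also have "\<dots> \<le> norm (w u) * ((\<Sum>j. norm (A u j)) * (\<Sum>i. norm (B u i)))"
    proof (rule mult_left_mono)
      have "(\<Sum>k<n. \<Sum>j\<le>k. norm (A u j) * norm (B u (k - j))) \<le> (\<Sum>k. \<Sum>j\<le>k. norm (A u j) * norm (B u (k - j)))"
        using C by (intro sum_le_suminf) (auto simp: sums_iff intro!: sum_nonneg)
      then show "(\<Sum>k<n. \<Sum>j\<le>k. norm (A u j) * norm (B u (k - j))) \<le> (\<Sum>j. norm (A u j)) * (\<Sum>i. norm (B u i))"
        using C by (simp add: sums_iff)
    qed simp
    also have "\<dots> \<le> norm (w u) * ((K * exp (2 * r)) * exp (l * exp u))"
      unfolding SB by (intro mult_left_mono mult_right_mono SA) auto
    also have "\<dots> \<le> norm (w u) * ((K * exp (exp u / 2)) * exp (1 / 16 * exp u))"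
      using rle l unfolding K_def by (intro mult_left_mono mult_mono) auto
    also have "\<dots> = K * (norm (w u) * (exp (exp u / 2) * exp (1 / 16 * exp u)))" by simp
    also have "norm (w u) * (exp (exp u / 2) * exp (1 / 16 * exp u)) = exp (Re \<nu> * u - (7 / 16) * exp u - y * exp (- u))"
      unfolding w_def norm_macdonald_weight by (simp flip: exp_add)
    finally show "(\<Sum>k<n. norm (f k u)) \<le> K * exp (Re \<nu> * u - (7 / 16) * exp u - y * exp (- u))" .
  qed
  then have "(\<Sum>k. \<integral>u. f k u \<partial>lborel) = (\<integral>u. macdonald_product \<nu> (of_real (1 + l)) y (of_real l) u \<partial>lborel)"
    by (simp add: sums_iff)
  moreover have "(\<lambda>k. rGamma (of_nat k + \<nu> + 1) / fact k * of_real (l * y) ^ k * macdonald_integral \<nu> (of_real y)) sums (bessel_E \<nu> (of_real (l * y)) * macdonald_integral \<nu> (of_real y))"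
    unfolding bessel_E_def by (intro sums_mult2 summable_sums summable_norm_cancel[OF summable_bessel_E]) (use \<nu> in auto)
  ultimately show ?thesis unfolding fint by (simp add: sums_iff)
qed

text \<open>
  The arguments of the two Bessel functions are \<open>y\<close> times the roots \<open>1 \<plusminus> \<surd>(1 - b)\<close> of a quadratic polynomial
  with sum 2 and product \<open>b\<close>.
\<close>

definition product_rhs :: "complex \<Rightarrow> real \<Rightarrow> complex \<Rightarrow> complex" where
  "product_rhs \<nu> y b = (1 + csqrt (1 - b)) powr (- \<nu>) * bessel_E \<nu> ((1 - csqrt (1 - b)) * of_real y)
     * macdonald_integral \<nu> ((1 + csqrt (1 - b)) * of_real y)"

text \<open>
  By the exponential bound on the majorant, the terms of \<open>E\<^sub>\<nu>(b exp (2 u))\<close> sum absolutely to at most a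
  multiple of \<open>exp (2 \<surd>\<bar>b\<bar> exp u)\<close>, which \<open>exp (- 2 exp u)\<close> dominates for \<open>\<bar>b\<bar> < 1\<close>.
\<close>

lemma macdonald_product_power_series:
  assumes y: "y > 0" and \<nu>: "Re \<nu> \<ge> 0"
  shows "\<exists>g. \<forall>b. norm b < 1 \<longrightarrow> (\<lambda>k. g k * b ^ k) sums (\<integral>u. macdonald_product \<nu> 2 y b u \<partial>lborel)"
proof -
  define w where "w = (\<lambda>u. exp (\<nu> * of_real u - 2 * of_real (exp u) - of_real (y * exp (- u))))"
  define h where "h = (\<lambda>k u. w u * of_real (exp u ^ 2) ^ k)"
  define g where "g = (\<lambda>k. rGamma (of_nat k + \<nu> + 1) / fact k * (\<integral>u. h k u \<partial>lborel))"
  define K where "K = norm (rGamma (\<nu> + 1))"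
  have nw: "norm (w u) = exp (Re \<nu> * u - 2 * exp u - y * exp (- u))" for u by (simp add: w_def)
  have hi: "integrable lborel (h k)" for k
  proof (rule Bochner_Integration.integrable_bound)
    show "integrable lborel (\<lambda>u. exp ((Re \<nu> + 2 * real k) * u - 2 * exp u - y * exp (- u)))"
      using y by (intro integrable_macdonald_real_scaled) auto
    show "h k \<in> borel_measurable lborel"
      unfolding h_def w_def measurable_lborel2 by (intro borel_measurable_continuous_onI continuous_intros)
    have "norm (h k u) = exp ((Re \<nu> + 2 * real k) * u - 2 * exp u - y * exp (- u))" for u
    proof -
      have "exp u ^ (2 * k) = exp (2 * real k * u)" by (simp add: exp_of_nat_mult[of "2 * k", symmetric])
      then have "norm (h k u) = exp (Re \<nu> * u - 2 * exp u - y * exp (- u)) * exp (2 * real k * u)"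
        unfolding h_def norm_mult nw by (simp add: norm_power power_mult)
      then show ?thesis by (simp add: exp_add[symmetric] algebra_simps)
    qed
    then show "AE u in lborel. norm (h k u) \<le> norm (exp ((Re \<nu> + 2 * real k) * u - 2 * exp u - y * exp (- u)))" by simp
  qed
  have "(\<lambda>k. g k * b ^ k) sums (\<integral>u. macdonald_product \<nu> 2 y b u \<partial>lborel)" if b: "norm b < 1" for b
  proof -
    define f where "f = (\<lambda>k u. (rGamma (of_nat k + \<nu> + 1) / fact k * b ^ k) * h k u)"
    have f_eq: "f k u = w u * (rGamma (of_nat k + \<nu> + 1) / fact k * (b * of_real (exp u ^ 2)) ^ k)" for k u
      by (simp add: f_def h_def power_mult_distrib mult_ac)
    have "(\<lambda>k. \<integral>u. f k u \<partial>lborel) sums (\<integral>u. macdonald_product \<nu> 2 y b u \<partial>lborel)"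
    proof (rule sums_integral_dominated[where w = "\<lambda>u. K * exp (Re \<nu> * u - (2 - 2 * sqrt (norm b)) * exp u - y * exp (- u))"])
      show "integrable lborel (f k)" for k unfolding f_def by (intro integrable_mult_right hi)
      show "(\<lambda>k. f k u) sums macdonald_product \<nu> 2 y b u" for u
        unfolding f_eq macdonald_product_def bessel_E_def w_def
        by (intro sums_mult summable_sums summable_norm_cancel[OF summable_bessel_E]) (use \<nu> in auto)
      show "macdonald_product \<nu> 2 y b \<in> borel_measurable borel" using \<nu> by measurable
      show "integrable lborel (\<lambda>u. K * exp (Re \<nu> * u - (2 - 2 * sqrt (norm b)) * exp u - y * exp (- u)))"
        using y b by (intro integrable_mult_right integrable_macdonald_real_scaled) auto
      fix n u
      define r where "r = sqrt (norm b) * exp u"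
      have r: "r \<ge> 0" "norm (b * of_real (exp u ^ 2)) = r\<^sup>2"
        by (auto simp: r_def power_mult_distrib norm_mult norm_power)
      have "(\<Sum>k<n. norm (f k u)) = norm (w u) * (\<Sum>k<n. norm (rGamma (of_nat k + \<nu> + 1) / fact k * (b * of_real (exp u ^ 2)) ^ k))"
        unfolding f_eq by (simp only: norm_mult sum_distrib_left)
      also have "\<dots> \<le> norm (w u) * (\<Sum>k<n. K * ((r\<^sup>2) ^ k / (fact k)\<^sup>2))"
        using norm_bessel_E_term_le[of 1 \<nu> _ "b * of_real (exp u ^ 2)"] \<nu>
        unfolding r(2) K_def by (intro mult_left_mono sum_mono) auto
      also have "\<dots> = norm (w u) * (K * (\<Sum>k<n. (r\<^sup>2) ^ k / (fact k)\<^sup>2))" by (simp add: sum_distrib_left)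
      also have "\<dots> \<le> norm (w u) * (K * bessel_majorant (r\<^sup>2))"
        unfolding bessel_majorant_def K_def
        by (intro mult_left_mono sum_le_suminf summable_power_over_fact_squared) auto
      also have "\<dots> \<le> norm (w u) * (K * exp (2 * r))"
        using r unfolding K_def by (intro mult_left_mono bessel_majorant_le_exp) auto
      also have "\<dots> = K * (norm (w u) * exp (2 * r))" by simp
      also have "norm (w u) * exp (2 * r) = exp (Re \<nu> * u - (2 - 2 * sqrt (norm b)) * exp u - y * exp (- u))"
        unfolding nw r_def by (simp add: exp_add[symmetric] algebra_simps)
      finally show "(\<Sum>k<n. norm (f k u)) \<le> K * exp (Re \<nu> * u - (2 - 2 * sqrt (norm b)) * exp u - y * exp (- u))" .
    qed
    moreover have "(\<integral>u. f k u \<partial>lborel) = g k * b ^ k" for k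
      unfolding f_def g_def by simp
    ultimately show ?thesis by simp
  qed
  then show ?thesis by blast
qed

lemma product_rhs_holomorphic:
  assumes y: "y > 0" and \<nu>: "Re \<nu> \<ge> 0"
  shows "product_rhs \<nu> y holomorphic_on ball 0 1"
proof -
  have np: "1 - b \<notin> \<real>\<^sub>\<le>\<^sub>0" if "b \<in> ball 0 1" for b :: complex
    using that abs_Re_le_cmod[of b] by (auto simp: complex_nonpos_Reals_iff)
  have s: "(\<lambda>b. csqrt (1 - b)) holomorphic_on ball 0 1"
    by (intro holomorphic_intros np)
  have re: "Re (1 + csqrt (1 - b)) > 0" for b :: complex
    using Re_csqrt[of "1 - b"] unfolding plus_complex.sel one_complex.sel by linarith
  have p1: "(\<lambda>b. (1 + csqrt (1 - b)) powr (- \<nu>)) holomorphic_on ball 0 1"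
  proof (rule holomorphic_on_powr)
    show "(\<lambda>b. 1 + csqrt (1 - b)) holomorphic_on ball 0 1" by (intro holomorphic_intros s)
    show "1 + csqrt (1 - b) \<notin> \<real>\<^sub>\<le>\<^sub>0" for b using re[of b] by (auto simp only: complex_nonpos_Reals_iff)
  qed (rule holomorphic_on_const)
  have Eh: "bessel_E \<nu> holomorphic_on UNIV"
    using has_field_derivative_bessel_E[of \<nu>] \<nu> by (intro holomorphic_onI) (auto simp: field_differentiable_def)
  have p2: "(\<lambda>b. bessel_E \<nu> ((1 - csqrt (1 - b)) * of_real y)) holomorphic_on ball 0 1"
    using holomorphic_on_compose_gen[OF _ Eh, of "\<lambda>b. (1 - csqrt (1 - b)) * of_real y" "ball 0 1"]
    by (simp add: o_def holomorphic_intros s)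
  have p3: "(\<lambda>b. macdonald_integral \<nu> ((1 + csqrt (1 - b)) * of_real y)) holomorphic_on ball 0 1"
  proof -
    have "(\<lambda>b. (1 + csqrt (1 - b)) * of_real y) ` ball 0 1 \<subseteq> {z. Re z > 0}"
    proof (clarify)
      fix b :: complex
      have "Re ((1 + csqrt (1 - b)) * of_real y) = Re (1 + csqrt (1 - b)) * y" by (simp only: times_complex.sel complex_of_real_def complex.sel mult_zero_right diff_zero)
      then show "Re ((1 + csqrt (1 - b)) * of_real y) > 0" using re[of b] y by (simp only: mult_pos_pos)
    qed
    moreover have "(\<lambda>b. (1 + csqrt (1 - b)) * of_real y) holomorphic_on ball 0 1" by (intro holomorphic_intros s)
    ultimately show ?thesis
      using holomorphic_on_compose_gen[OF _ macdonald_integral_holomorphic, of "\<lambda>b. (1 + csqrt (1 - b)) * of_real y" "ball 0 1" \<nu>]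
      by (simp only: o_def)
  qed
  show ?thesis unfolding product_rhs_def[abs_def] by (intro holomorphic_on_mult p1 p2 p3)
qed

text \<open>
  Translating \<open>u\<close> by the logarithm of the larger root \<open>m = 1 + \<surd>(1 - b)\<close> turns the parameters \<open>2\<close> and \<open>b\<close> into
  \<open>1 + l\<close> and \<open>l\<close>, where \<open>l\<close> is the quotient of the roots.
\<close>

lemma product_formula_real_small:
  assumes y: "y > 0" and \<nu>: "Re \<nu> \<ge> 0" and b: "0 < b" "b \<le> 1 / 16"
  shows "(\<integral>u. macdonald_product \<nu> 2 y (of_real b) u \<partial>lborel) = product_rhs \<nu> y (of_real b)"
proof -
  define s where "s = sqrt (1 - b)"
  have s: "0 < s" "s < 1" "s * s = 1 - b" using b by (auto simp: s_def)
  \<comment> \<open>\<open>m\<close> and \<open>l m\<close> are the two roots, with sum \<open>2 = (1 + l) m\<close> and product \<open>b = l m\<^sup>2\<close>.\<close>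
  define m where "m = 1 + s"
  define l where "l = (1 - s) / m"
  have m: "1 < m" "m \<noteq> 0" using s by (auto simp: m_def)
  have lm: "l * m = 1 - s" using m by (simp add: l_def)
  have b_eq: "b = l * m * m" by (simp only: lm) (use s(3) in \<open>simp add: m_def algebra_simps\<close>)
  have two: "2 = (1 + l) * m" using lm by (simp add: m_def algebra_simps)
  have l: "0 < l" using s m by (simp add: l_def)
  have "l * 1 \<le> l * (m * m)" using l m mult_mono[of 1 m 1 m] by (intro mult_left_mono) auto
  then have l16: "l \<le> 1 / 16" using b b_eq by (simp add: mult.assoc)
  have cs: "csqrt (1 - of_real b) = of_real s" unfolding s_def using b csqrt_of_real_nonneg[of "1 - b"] by simp
  have "(\<integral>u. macdonald_product \<nu> 2 y (of_real b) u \<partial>lborel) = \<bar>1\<bar> *\<^sub>R (\<integral>u. macdonald_product \<nu> 2 y (of_real b) (- ln m + 1 * u) \<partial>lborel)"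
    by (rule lborel_integral_real_affine) simp
  also have "\<dots> = (\<integral>u. of_real m powr (- \<nu>) * macdonald_product \<nu> (of_real (1 + l)) (m * y) (of_real l) u \<partial>lborel)"
  proof -
    have "macdonald_product \<nu> 2 y (of_real b) (- ln m + 1 * u) = of_real m powr (- \<nu>) * macdonald_product \<nu> (of_real (1 + l)) (m * y) (of_real l) u" for u
    proof -
      have e1: "exp (- ln m + 1 * u) = exp u / m" using m by (simp add: exp_diff)
      have e2: "exp (- (- ln m + 1 * u)) = m * exp (- u)" using m by (simp add: exp_diff exp_minus field_simps)
      have f1: "2 * complex_of_real (exp u / m) = of_real (1 + l) * of_real (exp u)"
      proof -
        have "2 * (exp u / m) = (1 + l) * m * (exp u / m)" unfolding two[symmetric] ..
        then have "2 * (exp u / m) = (1 + l) * exp u" using m by simp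
        from arg_cong[OF this, of complex_of_real] show ?thesis by (simp only: of_real_mult of_real_numeral)
      qed
      have f2: "complex_of_real b * of_real ((exp u / m)\<^sup>2) = of_real l * of_real (exp u ^ 2)"
      proof -
        have "b * (exp u / m)\<^sup>2 = l * exp u ^ 2" unfolding b_eq using m by (simp add: power2_eq_square)
        from arg_cong[OF this, of complex_of_real] show ?thesis by (simp only: of_real_mult)
      qed
      have f3: "exp (\<nu> * of_real (- ln m + 1 * u)) = of_real m powr (- \<nu>) * exp (\<nu> * of_real u)"
        using m by (simp add: powr_def Ln_of_real exp_add[symmetric] algebra_simps)
      have f4: "y * (m * exp (- u)) = m * y * exp (- u)" by simp
      show ?thesis unfolding macdonald_product_def e1 e2 f1 f2 f4 exp_diff f3 by simp
    qed
    then show ?thesis by simp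
  qed
  also have "\<dots> = of_real m powr (- \<nu>) * (bessel_E \<nu> (of_real (l * (m * y))) * macdonald_integral \<nu> (of_real (m * y)))"
    using product_formula_small[of "m * y" \<nu> l] y m \<nu> l l16 by simp
  also have "l * (m * y) = (1 - s) * y" using lm by (simp flip: mult.assoc)
  finally show ?thesis unfolding product_rhs_def cs m_def by (simp add: mult_ac)
qed

text \<open>
  Both sides are holomorphic in the unit disc and agree on a segment that accumulates at 0.
\<close>

lemma product_formula_real:
  assumes y: "y > 0" and \<nu>: "Re \<nu> \<ge> 0" and b: "0 < b" "b < 1"
  shows "(\<integral>u. macdonald_product \<nu> 2 y (of_real b) u \<partial>lborel) = product_rhs \<nu> y (of_real b)"
proof -
  obtain g where g: "\<And>b. norm b < 1 \<Longrightarrow> (\<lambda>k. g k * b ^ k) sums (\<integral>u. macdonald_product \<nu> 2 y b u \<partial>lborel)"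
    using macdonald_product_power_series[OF y \<nu>] by blast
  have h1: "(\<lambda>b. \<integral>u. macdonald_product \<nu> 2 y b u \<partial>lborel) holomorphic_on ball 0 1"
    by (rule power_series_holomorphic) (use g in \<open>simp add: dist_norm\<close>)
  have h: "(\<lambda>b. (\<integral>u. macdonald_product \<nu> 2 y b u \<partial>lborel) - product_rhs \<nu> y b) holomorphic_on ball 0 1"
    by (intro holomorphic_on_diff h1 product_rhs_holomorphic[OF y \<nu>])
  define U where "U = complex_of_real ` {0<..1 / 16}"
  have lim: "0 islimpt U"
    unfolding islimpt_sequential
  proof (intro exI conjI allI)
    show "of_real (1 / (16 * (real n + 1))) \<in> U - {0}" for n
    proof -
      have "1 / (16 * (real n + 1)) \<in> {0<..1 / 16}" by (simp add: field_simps)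
      then have "of_real (1 / (16 * (real n + 1))) \<in> U" unfolding U_def by (rule imageI)
      moreover have "complex_of_real (1 / (16 * (real n + 1))) \<noteq> 0"
        unfolding of_real_eq_0_iff by simp
      ultimately show ?thesis by blast
    qed
    have "(\<lambda>n. 1 / (16 * (real n + 1))) \<longlonglongrightarrow> 0" by real_asymp
    then have "(\<lambda>n. complex_of_real (1 / (16 * (real n + 1)))) \<longlonglongrightarrow> of_real 0" by (rule tendsto_of_real)
    then show "(\<lambda>n. complex_of_real (1 / (16 * (real n + 1)))) \<longlonglongrightarrow> 0" by simp
  qed
  have "(\<integral>u. macdonald_product \<nu> 2 y (of_real b) u \<partial>lborel) - product_rhs \<nu> y (of_real b) = 0"
  proof (rule analytic_continuation[OF h _ _ _ _ lim])
    show "U \<subseteq> ball 0 1" unfolding U_def by auto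
    show "(\<integral>u. macdonald_product \<nu> 2 y z u \<partial>lborel) - product_rhs \<nu> y z = 0" if "z \<in> U" for z
      using that product_formula_real_small[OF y \<nu>] unfolding U_def by auto
  qed (use b in auto)
  then show ?thesis by simp
qed

text \<open>
  The limit \<open>b \<rightarrow> 1\<close>, at which the two roots coincide. There the exponential growth of the Bessel factor
  cancels the factor \<open>exp (- 2 exp u)\<close> exactly, and it is the additional decay \<open>exp (- u / 2)\<close> of the sharper
  majorant bound that makes dominated convergence possible.
\<close>

lemma bessel_product_formula:
  assumes y: "y > 0" and \<nu>: "Re \<nu> = 0"
  shows "integrable lborel (macdonald_product \<nu> 2 y 1)"
    and "(\<integral>u. macdonald_product \<nu> 2 y 1 u \<partial>lborel) = bessel_E \<nu> (of_real y) * macdonald_integral \<nu> (of_real y)"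
proof -
  have \<nu>0: "Re \<nu> \<ge> 0" using \<nu> by simp
  define K where "K = norm (rGamma (\<nu> + 1))"
  define W where "W = (\<lambda>u. K / sqrt 2 * exp (- (1 / 2) * u - y * exp (- u)))"
  have Wi: "integrable lborel W"
  proof -
    have "integrable lborel (\<lambda>u. exp ((1 / 2) * (0 + - 1 * u) - y * exp (0 + - 1 * u)))"
      by (rule lborel_integrable_real_affine[OF gamma_weight_integral_real(1)]) (use y in auto)
    then show ?thesis unfolding W_def by (intro integrable_mult_right) simp
  qed
  have bound: "norm (macdonald_product \<nu> 2 y (of_real b) u) \<le> W u" if b: "0 \<le> b" "b \<le> 1" for b u
  proof -
    have "norm (macdonald_product \<nu> 2 y (of_real b) u) = exp (- 2 * exp u - y * exp (- u)) * norm (bessel_E \<nu> (of_real b * of_real (exp u ^ 2)))"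
      unfolding macdonald_product_def norm_mult using \<nu> by simp
    also have "\<dots> \<le> exp (- 2 * exp u - y * exp (- u)) * (K * bessel_majorant (norm (complex_of_real b * of_real (exp u ^ 2))))"
      unfolding K_def by (intro mult_left_mono norm_bessel_E_le \<nu>0) auto
    also have "norm (complex_of_real b * of_real (exp u ^ 2)) = b * exp u ^ 2"
      using b by (simp add: norm_mult norm_power)
    also have "exp (- 2 * exp u - y * exp (- u)) * (K * bessel_majorant (b * exp u ^ 2)) \<le> exp (- 2 * exp u - y * exp (- u)) * (K * (exp (2 * exp u) / sqrt (2 * exp u)))"
    proof (intro mult_left_mono)
      have "bessel_majorant (b * exp u ^ 2) \<le> bessel_majorant (exp u ^ 2)"
        using b by (intro bessel_majorant_mono) (auto intro: mult_left_le_one_le)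
      also have "\<dots> \<le> exp (2 * exp u) / sqrt (2 * exp u)" by (rule bessel_majorant_le_exp_over_sqrt) simp
      finally show "bessel_majorant (b * exp u ^ 2) \<le> exp (2 * exp u) / sqrt (2 * exp u)" .
    qed (auto simp: K_def)
    also have "\<dots> = W u"
    proof -
      have sq: "sqrt (exp u) = exp (u / 2)"
        by (rule real_sqrt_unique) (simp_all add: power2_eq_square exp_add[symmetric])
      have "exp (- (u / 2)) = 1 / exp (u / 2)" by (simp only: exp_minus inverse_eq_divide)
      then have 1: "exp (2 * exp u) / sqrt (2 * exp u) = exp (2 * exp u) * exp (- (u / 2)) / sqrt 2"
        unfolding real_sqrt_mult sq by (simp only: times_divide_eq_right mult_1_right divide_divide_eq_left mult.commute)
      have 2: "exp (- 2 * exp u - y * exp (- u)) * (exp (2 * exp u) * exp (- (u / 2))) = exp (- (1 / 2) * u - y * exp (- u))"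
        by (simp add: exp_add[symmetric])
      have "exp (- 2 * exp u - y * exp (- u)) * (K * (exp (2 * exp u) * exp (- (u / 2)) / sqrt 2)) = K / sqrt 2 * (exp (- 2 * exp u - y * exp (- u)) * (exp (2 * exp u) * exp (- (u / 2))))"
        by simp
      then show ?thesis unfolding W_def 1 2 .
    qed
    finally show ?thesis .
  qed
  have m1: "macdonald_product \<nu> 2 y b \<in> borel_measurable lborel" for b using \<nu>0 by measurable
  have bound1: "norm (macdonald_product \<nu> 2 y 1 u) \<le> W u" for u using bound[of 1 u] by simp
  show "integrable lborel (macdonald_product \<nu> 2 y 1)"
    by (rule Bochner_Integration.integrable_bound[OF Wi m1], rule AE_I2) (use order_trans[OF bound1 abs_ge_self] in simp)
  \<comment> \<open>The choice \<open>b = 1 - s\<^sup>2\<close> makes the square root in the product formula explicit.\<close>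
  define s where "s = (\<lambda>n. 1 / (real n + 2))"
  define b where "b = (\<lambda>n. 1 - (s n)\<^sup>2)"
  have s: "0 < s n" "s n < 1" for n by (auto simp: s_def)
  have s0: "s \<longlonglongrightarrow> 0" unfolding s_def by real_asymp
  have b: "0 < b n" "b n < 1" for n using s[of n] by (simp_all add: b_def abs_square_less_1)
  have b1: "b \<longlonglongrightarrow> 1" unfolding b_def using tendsto_diff[OF tendsto_const tendsto_power[OF s0, of 2], of 1] by simp
  have L: "(\<lambda>n. \<integral>u. macdonald_product \<nu> 2 y (of_real (b n)) u \<partial>lborel) \<longlonglongrightarrow> (\<integral>u. macdonald_product \<nu> 2 y 1 u \<partial>lborel)"
  proof (rule integral_dominated_convergence[OF m1 m1 Wi])
    show "AE u in lborel. (\<lambda>n. macdonald_product \<nu> 2 y (of_real (b n)) u) \<longlonglongrightarrow> macdonald_product \<nu> 2 y 1 u"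
    proof (rule AE_I2)
      fix u
      have "isCont (bessel_E \<nu>) (of_real 1 * of_real (exp u ^ 2))"
        by (rule DERIV_isCont, rule has_field_derivative_bessel_E) (use \<nu> in simp)
      then have "(\<lambda>n. bessel_E \<nu> (of_real (b n) * of_real (exp u ^ 2))) \<longlonglongrightarrow> bessel_E \<nu> (of_real 1 * of_real (exp u ^ 2))"
        by (rule isCont_tendsto_compose) (intro tendsto_intros b1)
      then show "(\<lambda>n. macdonald_product \<nu> 2 y (of_real (b n)) u) \<longlonglongrightarrow> macdonald_product \<nu> 2 y 1 u"
        unfolding macdonald_product_def by (intro tendsto_mult tendsto_const) simp
    qed
    show "AE u in lborel. norm (macdonald_product \<nu> 2 y (of_real (b n)) u) \<le> W u" for n
      using bound[of "b n"] b[of n] by auto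
  qed
  have rhs: "product_rhs \<nu> y (of_real (b n)) = (1 + of_real (s n)) powr (- \<nu>) * bessel_E \<nu> ((1 - of_real (s n)) * of_real y) * macdonald_integral \<nu> ((1 + of_real (s n)) * of_real y)" for n
  proof -
    have "csqrt (1 - of_real (b n)) = csqrt (of_real ((s n)\<^sup>2))" by (simp add: b_def)
    also have "\<dots> = of_real (s n)" using s[of n] by (subst csqrt_of_real_nonneg) auto
    finally show ?thesis unfolding product_rhs_def by simp
  qed
  have "(\<lambda>n. product_rhs \<nu> y (of_real (b n))) \<longlonglongrightarrow> (1 + of_real 0) powr (- \<nu>) * bessel_E \<nu> ((1 - of_real 0) * of_real y) * macdonald_integral \<nu> ((1 + of_real 0) * of_real y)"
    unfolding rhs
  proof (intro tendsto_mult)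
    show "(\<lambda>n. (1 + complex_of_real (s n)) powr (- \<nu>)) \<longlonglongrightarrow> (1 + of_real 0) powr (- \<nu>)"
      by (intro tendsto_intros s0) auto
    have "isCont (bessel_E \<nu>) ((1 - of_real 0) * of_real y)"
      by (rule DERIV_isCont, rule has_field_derivative_bessel_E) (use \<nu> in simp)
    then show "(\<lambda>n. bessel_E \<nu> ((1 - of_real (s n)) * of_real y)) \<longlonglongrightarrow> bessel_E \<nu> ((1 - of_real 0) * of_real y)"
      by (rule isCont_tendsto_compose) (intro tendsto_intros s0)
    have "isCont (macdonald_integral \<nu>) ((1 + of_real 0) * of_real y)"
      by (rule DERIV_isCont, rule has_field_derivative_macdonald_integral) (use y in simp)
    then show "(\<lambda>n. macdonald_integral \<nu> ((1 + of_real (s n)) * of_real y)) \<longlonglongrightarrow> macdonald_integral \<nu> ((1 + of_real 0) * of_real y)"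
      by (rule isCont_tendsto_compose) (intro tendsto_intros s0)
  qed
  then have "(\<lambda>n. product_rhs \<nu> y (of_real (b n))) \<longlonglongrightarrow> bessel_E \<nu> (of_real y) * macdonald_integral \<nu> (of_real y)" by simp
  then have R: "(\<lambda>n. \<integral>u. macdonald_product \<nu> 2 y (of_real (b n)) u \<partial>lborel) \<longlonglongrightarrow> bessel_E \<nu> (of_real y) * macdonald_integral \<nu> (of_real y)"
    using product_formula_real[OF y \<nu>0 b] by simp
  show "(\<integral>u. macdonald_product \<nu> 2 y 1 u \<partial>lborel) = bessel_E \<nu> (of_real y) * macdonald_integral \<nu> (of_real y)"
    by (rule LIMSEQ_unique[OF L R])
qed

section \<open>The Lebedev kernel as a Laplace-type integral\<close>

lemma cnj_macdonald_integral:
  "cnj (macdonald_integral \<nu> (of_real y)) = macdonald_integral (cnj \<nu>) (of_real y)"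
proof -
  have "cnj (macdonald_weight \<nu> (of_real y) u) = macdonald_weight (cnj \<nu>) (of_real y) u" for u
    by (simp add: macdonald_weight_def exp_cnj)
  then show ?thesis
    unfolding macdonald_integral_def by (simp flip: Bochner_Integration.integral_cnj)
qed

text \<open>
  Conjugation replaces the order \<open>i\<tau>\<close> by \<open>- i\<tau>\<close>, in which the Macdonald function is symmetric.
\<close>

lemma bessel_K_imaginary_order_real:
  assumes z: "z > 0"
  shows "bessel_K (\<i> * of_real \<tau>) (of_real z) = of_real (Re (bessel_K (\<i> * of_real \<tau>) (of_real z)))"
proof -
  define \<nu> where "\<nu> = \<i> * complex_of_real \<tau>"
  define L where "L = ln (z / 2)"
  have p1: "complex_of_real (z / 2) powr (- \<nu>) = exp (- \<nu> * of_real L)"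
    using z Ln_of_real[of "z / 2"] by (simp add: powr_def L_def)
  have "ln ((z / 2)\<^sup>2) = 2 * L" using z by (simp add: L_def ln_realpow)
  then have p2: "complex_of_real ((z / 2)\<^sup>2) powr (- \<nu>) = exp (- \<nu> * of_real (2 * L))"
    using z Ln_of_real[of "(z / 2)\<^sup>2"] unfolding powr_def by simp
  have cn: "cnj \<nu> = - \<nu>" by (simp add: \<nu>_def)
  have cC: "cnj (macdonald_integral \<nu> (of_real ((z / 2)\<^sup>2))) = exp (- \<nu> * of_real (2 * L)) * macdonald_integral \<nu> (of_real ((z / 2)\<^sup>2))"
    unfolding cnj_macdonald_integral cn p2[symmetric] by (rule macdonald_integral_uminus) (use z in simp)
  have K: "bessel_K \<nu> (of_real z) = exp (- \<nu> * of_real L) * macdonald_integral \<nu> (of_real ((z / 2)\<^sup>2)) / 2"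
    using bessel_K_eq_macdonald_integral[OF z, of \<tau>] p1 by (simp add: \<nu>_def)
  have cE: "cnj (exp (- \<nu> * of_real L)) = exp (\<nu> * of_real L)" by (simp add: exp_cnj cn)
  have "cnj (bessel_K \<nu> (of_real z)) = exp (\<nu> * of_real L) * (exp (- \<nu> * of_real (2 * L)) * macdonald_integral \<nu> (of_real ((z / 2)\<^sup>2))) / 2"
    unfolding K complex_cnj_divide complex_cnj_mult cC cE complex_cnj_numeral ..
  also have "\<dots> = (exp (\<nu> * of_real L) * exp (- \<nu> * of_real (2 * L))) * macdonald_integral \<nu> (of_real ((z / 2)\<^sup>2)) / 2"
    by (simp only: mult.assoc)
  also have "exp (\<nu> * of_real L) * exp (- \<nu> * of_real (2 * L)) = exp (- \<nu> * of_real L)"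
    unfolding exp_add[symmetric] by (simp add: algebra_simps)
  finally have "cnj (bessel_K \<nu> (of_real z)) = bessel_K \<nu> (of_real z)" unfolding K .
  then show ?thesis unfolding \<nu>_def by (simp add: complex_eq_iff)
qed

text \<open>
  As \<open>K\<^bsub>i\<tau>\<^esub>\<close> is real, the real part may be taken of the whole product, in which the powers of \<open>z/2\<close>
  cancel.
\<close>

lemma lebedev_kernel_eq_Re:
  assumes x: "x > 0"
  shows "lebedev_kernel \<tau> x = of_real (Re (bessel_E (\<i> * of_real \<tau>) (of_real (x / 4)) * macdonald_integral (\<i> * of_real \<tau>) (of_real (x / 4)))) / 2"
proof -
  define \<nu> where "\<nu> = \<i> * complex_of_real \<tau>"
  define z where "z = sqrt x"
  have z: "z > 0" "(z / 2)\<^sup>2 = x / 4" using x by (auto simp: z_def power_divide)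
  have "bessel_I \<nu> (of_real z) = (of_real z / 2) powr \<nu> * bessel_E \<nu> ((of_real z / 2)\<^sup>2)"
    by (rule bessel_I_eq_bessel_E) (use z in \<open>auto simp: \<nu>_def\<close>)
  also have "of_real z / 2 = complex_of_real (z / 2)" by simp
  also have "(complex_of_real (z / 2))\<^sup>2 = of_real (x / 4)" unfolding z(2)[symmetric] by simp
  finally have I: "bessel_I \<nu> (of_real z) = of_real (z / 2) powr \<nu> * bessel_E \<nu> (of_real (x / 4))" .
  have K: "bessel_K \<nu> (of_real z) = of_real (z / 2) powr (- \<nu>) * macdonald_integral \<nu> (of_real (x / 4)) / 2"
    using bessel_K_eq_macdonald_integral[OF z(1), of \<tau>] unfolding z(2) \<nu>_def by simp
  have Kr: "bessel_K \<nu> (of_real z) = of_real (Re (bessel_K \<nu> (of_real z)))"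
    unfolding \<nu>_def by (rule bessel_K_imaginary_order_real[OF z(1)])
  have "of_real (z / 2) powr \<nu> * complex_of_real (z / 2) powr (- \<nu>) = 1" using z by (simp add: powr_minus)
  then have IK: "bessel_I \<nu> (of_real z) * bessel_K \<nu> (of_real z) = bessel_E \<nu> (of_real (x / 4)) * macdonald_integral \<nu> (of_real (x / 4)) / 2"
    unfolding I K by (simp add: mult_ac)
  have "Im (bessel_K \<nu> (of_real z)) = 0" by (subst Kr) simp
  then have "Re (bessel_I \<nu> (of_real z) * bessel_K \<nu> (of_real z)) = Re (bessel_I \<nu> (of_real z)) * Re (bessel_K \<nu> (of_real z))" by simp
  moreover have "lebedev_kernel \<tau> x = of_real (Re (bessel_I \<nu> (of_real z)) * Re (bessel_K \<nu> (of_real z)))"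
    unfolding lebedev_kernel_def \<nu>_def[symmetric] z_def[symmetric] by (subst Kr) simp
  ultimately show ?thesis unfolding IK \<nu>_def[symmetric] by simp
qed

text \<open>
  In the variables \<open>x = exp v\<close> and \<open>y = exp u\<close> this is
  \<open>2 Re [I\<^bsub>i\<tau>\<^esub>(\<surd>x)] K\<^bsub>i\<tau>\<^esub>(\<surd>x) = \<integral> k(y) exp (- x/y) dy/y\<close>. The product formula at the point \<open>x/4\<close> has this form after
  the translation \<open>u = ln 4 + t\<close>.
\<close>

lemma lebedev_kernel_eq_integral:
  shows "integrable lborel (\<lambda>u. F_kernel \<tau> (exp u) * exp (- exp (v - u)))"
    and "lebedev_kernel \<tau> (exp v) = of_real (\<integral>u. F_kernel \<tau> (exp u) * exp (- exp (v - u)) \<partial>lborel) / 2"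
proof -
  define \<nu> where "\<nu> = \<i> * complex_of_real \<tau>"
  define y where "y = exp v / 4"
  have y: "y > 0" by (simp add: y_def)
  have \<nu>: "Re \<nu> = 0" by (simp add: \<nu>_def)
  have eq: "F_kernel \<tau> (exp (ln 4 + 1 * t)) * exp (- exp (v - (ln 4 + 1 * t))) = Re (macdonald_product \<nu> 2 y 1 t)" for t
  proof -
    have e1: "exp (ln 4 + 1 * t) = 4 * exp t" by (simp add: exp_add)
    have e2: "exp (v - (ln 4 + 1 * t)) = y * exp (- t)"
      unfolding exp_diff e1 y_def exp_minus by (simp add: field_simps)
    have F: "F_kernel \<tau> (4 * exp t) = exp (- 2 * exp t) * Re (exp (\<nu> * of_real t) * bessel_E \<nu> (of_real ((exp t)\<^sup>2)))"
      by (subst F_kernel_eq_bessel_E) (simp_all add: \<nu>_def mult.assoc)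
    have "macdonald_product \<nu> 2 y 1 t = of_real (exp (- 2 * exp t) * exp (- (y * exp (- t)))) * (exp (\<nu> * of_real t) * bessel_E \<nu> (of_real ((exp t)\<^sup>2)))"
    proof -
      have "\<nu> * of_real t - 2 * of_real (exp t) - of_real (y * exp (- t)) = of_real (- 2 * exp t + - (y * exp (- t))) + \<nu> * of_real t"
        by simp
      then have "exp (\<nu> * of_real t - 2 * of_real (exp t) - of_real (y * exp (- t))) = of_real (exp (- 2 * exp t) * exp (- (y * exp (- t)))) * exp (\<nu> * of_real t)"
        by (simp only: exp_add exp_of_real)
      then show ?thesis unfolding macdonald_product_def by (simp add: mult.assoc)
    qed
    then show ?thesis unfolding e1 e2 F by simp
  qed
  have i: "integrable lborel (\<lambda>t. Re (macdonald_product \<nu> 2 y 1 t))"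
    by (rule integrable_Re[OF bessel_product_formula(1)[OF y \<nu>]])
  then have i': "integrable lborel (\<lambda>t. F_kernel \<tau> (exp (ln 4 + 1 * t)) * exp (- exp (v - (ln 4 + 1 * t))))" unfolding eq .
  then show "integrable lborel (\<lambda>u. F_kernel \<tau> (exp u) * exp (- exp (v - u)))"
    by (subst (asm) lborel_integrable_real_affine_iff) simp_all
  have "(\<integral>u. F_kernel \<tau> (exp u) * exp (- exp (v - u)) \<partial>lborel) = \<bar>1\<bar> *\<^sub>R (\<integral>t. F_kernel \<tau> (exp (ln 4 + 1 * t)) * exp (- exp (v - (ln 4 + 1 * t))) \<partial>lborel)"
    by (rule lborel_integral_real_affine) simp
  also have "\<dots> = (\<integral>t. Re (macdonald_product \<nu> 2 y 1 t) \<partial>lborel)" unfolding eq by simp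
  also have "\<dots> = Re (\<integral>t. macdonald_product \<nu> 2 y 1 t \<partial>lborel)"
    by (rule integral_Re[OF bessel_product_formula(1)[OF y \<nu>]])
  also have "\<dots> = Re (bessel_E \<nu> (of_real y) * macdonald_integral \<nu> (of_real y))"
    unfolding bessel_product_formula(2)[OF y \<nu>] ..
  finally have "(\<integral>u. F_kernel \<tau> (exp u) * exp (- exp (v - u)) \<partial>lborel) = Re (bessel_E \<nu> (of_real (exp v / 4)) * macdonald_integral \<nu> (of_real (exp v / 4)))"
    unfolding y_def .
  then show "lebedev_kernel \<tau> (exp v) = of_real (\<integral>u. F_kernel \<tau> (exp u) * exp (- exp (v - u)) \<partial>lborel) / 2"
    using lebedev_kernel_eq_Re[of "exp v" \<tau>] unfolding \<nu>_def by simp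
qed

lemma measurable_F_kernel_exp [measurable]: "(\<lambda>u. F_kernel \<tau> (exp u)) \<in> borel_measurable borel"
  by (rule borel_measurable_continuous_onI[OF continuous_on_F_kernel_exp])

section \<open>Boundedness and continuity of the index transform\<close>

lemma L1_pos_log_representative:
  assumes "f \<in> L1_pos"
  obtains G where "G \<in> borel_measurable borel" "AE u in lborel. f (exp u) = G u" "integrable lborel (\<lambda>u. exp u *\<^sub>R G u)"
proof -
  have f: "set_integrable lebesgue {0<..} f" using assms by (simp add: L1_pos_def)
  then have "set_borel_measurable lebesgue {0<..} f"
    unfolding set_integrable_def set_borel_measurable_def by (rule borel_measurable_integrable)
  then obtain G where G: "G \<in> borel_measurable borel" "AE u in lborel. f (exp u) = G u"
    by (rule half_line_log_representative)
  moreover have "integrable lborel (\<lambda>u. exp u *\<^sub>R G u)" using half_line_integral_log(1)[OF G] f by simp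
  ultimately show ?thesis by (rule that)
qed

lemma F_transform_log:
  assumes G: "G \<in> borel_measurable borel" "AE u in lborel. f (exp u) = G u" "integrable lborel (\<lambda>u. exp u *\<^sub>R G u)"
  shows "set_integrable lebesgue {0<..} (\<lambda>x. of_real (F_kernel \<tau> x) * f x)"
    and "F_transform f \<tau> = of_real (sqrt pi / cosh (pi * \<tau>)) * (\<integral>u. of_real (F_kernel \<tau> (exp u)) * (exp u *\<^sub>R G u) \<partial>lborel)"
proof -
  have m: "(\<lambda>u. of_real (F_kernel \<tau> (exp u)) * G u) \<in> borel_measurable borel" using G(1) by measurable
  have ae: "AE u in lborel. of_real (F_kernel \<tau> (exp u)) * f (exp u) = of_real (F_kernel \<tau> (exp u)) * G u"
    using G(2) by eventually_elim simp
  have eq: "exp u *\<^sub>R (of_real (F_kernel \<tau> (exp u)) * G u) = of_real (F_kernel \<tau> (exp u)) * (exp u *\<^sub>R G u)" for u by simp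
  have "integrable lborel (\<lambda>u. of_real (F_kernel \<tau> (exp u)) * (exp u *\<^sub>R G u))"
  proof (rule Bochner_Integration.integrable_bound)
    show "integrable lborel (\<lambda>u. of_real (cosh (pi * \<tau>)) * (exp u *\<^sub>R G u))" by (intro integrable_mult_right G(3))
    show "(\<lambda>u. of_real (F_kernel \<tau> (exp u)) * (exp u *\<^sub>R G u)) \<in> borel_measurable lborel" using G(1) by measurable
    show "AE u in lborel. norm (of_real (F_kernel \<tau> (exp u)) * (exp u *\<^sub>R G u)) \<le> norm (of_real (cosh (pi * \<tau>)) * (exp u *\<^sub>R G u))"
      by (intro AE_I2) (simp add: norm_mult mult_right_mono abs_F_kernel_le(1))
  qed
  then show "set_integrable lebesgue {0<..} (\<lambda>x. of_real (F_kernel \<tau> x) * f x)"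
    using half_line_integral_log(1)[of _ "\<lambda>x. of_real (F_kernel \<tau> x) * f x", OF m ae] unfolding eq by blast
  show "F_transform f \<tau> = of_real (sqrt pi / cosh (pi * \<tau>)) * (\<integral>u. of_real (F_kernel \<tau> (exp u)) * (exp u *\<^sub>R G u) \<partial>lborel)"
    unfolding F_transform_def half_line_integral_log(2)[of _ "\<lambda>x. of_real (F_kernel \<tau> x) * f x", OF m ae] eq ..
qed

text \<open>
  The integrand divided by \<open>cosh (\<pi>\<tau>)\<close> is dominated by \<open>\<surd>\<pi> \<bar>f\<bar>\<close> for all \<open>\<tau>\<close> simultaneously, which gives the
  norm bound and, by dominated convergence, continuity.
\<close>

lemma F_transform_bounded_continuous:
  assumes "f \<in> L1_pos"
  shows "F_transform f \<in> bcontfun" and "norm (F_transform f \<tau>) \<le> sqrt pi * L1_norm f"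
proof -
  obtain G where G: "G \<in> borel_measurable borel" "AE u in lborel. f (exp u) = G u" "integrable lborel (\<lambda>u. exp u *\<^sub>R G u)"
    by (rule L1_pos_log_representative[OF assms])
  define K where "K = (\<lambda>\<tau> u. of_real (sqrt pi / cosh (pi * \<tau>) * F_kernel \<tau> (exp u)) * (exp u *\<^sub>R G u))"
  have Km: "K \<tau> \<in> borel_measurable lborel" for \<tau> unfolding K_def using G(1) by measurable
  have F: "F_transform f \<tau> = (\<integral>u. K \<tau> u \<partial>lborel)" for \<tau>
    unfolding F_transform_log(2)[OF G] K_def by (simp only: of_real_mult mult.assoc integral_mult_right_zero)
  have bound: "norm (K \<tau> u) \<le> sqrt pi * norm (exp u *\<^sub>R G u)" for \<tau> u
  proof -
    have "\<bar>sqrt pi / cosh (pi * \<tau>) * F_kernel \<tau> (exp u)\<bar> \<le> sqrt pi / cosh (pi * \<tau>) * cosh (pi * \<tau>)"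
      unfolding abs_mult using abs_F_kernel_le(1)[of "exp u" \<tau>] by (intro mult_mono) auto
    then have "\<bar>sqrt pi / cosh (pi * \<tau>) * F_kernel \<tau> (exp u)\<bar> \<le> sqrt pi" using cosh_real_pos[of "pi * \<tau>"] by simp
    then show ?thesis unfolding K_def norm_mult norm_of_real by (rule mult_right_mono) simp
  qed
  have wi: "integrable lborel (\<lambda>u. sqrt pi * norm (exp u *\<^sub>R G u))" using G(3) by (intro integrable_mult_right integrable_norm)
  have n1: "L1_norm f = (\<integral>u. norm (exp u *\<^sub>R G u) \<partial>lborel)"
  proof -
    have m: "(\<lambda>u. norm (G u)) \<in> borel_measurable borel" using G(1) by measurable
    have ae: "AE u in lborel. norm (f (exp u)) = norm (G u)" using G(2) by eventually_elim simp
    show ?thesis unfolding L1_norm_def half_line_integral_log(2)[of _ "\<lambda>x. norm (f x)", OF m ae] by simp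
  qed
  have nb: "norm (F_transform f \<tau>) \<le> sqrt pi * L1_norm f" for \<tau>
  proof -
    have "norm (F_transform f \<tau>) \<le> (\<integral>u. norm (K \<tau> u) \<partial>lborel)" unfolding F by (rule integral_norm_bound)
    also have "\<dots> \<le> (\<integral>u. sqrt pi * norm (exp u *\<^sub>R G u) \<partial>lborel)"
      by (rule integral_mono_AE'[OF wi]) (rule AE_I2, rule bound, simp)
    finally show ?thesis unfolding n1 by simp
  qed
  then show "norm (F_transform f \<tau>) \<le> sqrt pi * L1_norm f" .
  have "isCont (F_transform f) \<tau>" for \<tau>
  proof (rule continuous_at_sequentiallyI)
    fix X :: "nat \<Rightarrow> real"
    assume X: "X \<longlonglongrightarrow> \<tau>"
    show "(\<lambda>n. F_transform f (X n)) \<longlonglongrightarrow> F_transform f \<tau>"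
      unfolding F
    proof (rule integral_dominated_convergence[OF Km Km wi])
      show "AE u in lborel. (\<lambda>n. K (X n) u) \<longlonglongrightarrow> K \<tau> u"
      proof (rule AE_I2)
        fix u
        have "isCont (\<lambda>\<tau>. K \<tau> u) \<tau>" unfolding K_def
          by (intro continuous_intros isCont_F_kernel_order) auto
        from isCont_tendsto_compose[OF this X] show "(\<lambda>n. K (X n) u) \<longlonglongrightarrow> K \<tau> u" .
      qed
      show "AE u in lborel. norm (K (X n) u) \<le> sqrt pi * norm (exp u *\<^sub>R G u)" for n
        by (rule AE_I2) (rule bound)
    qed
  qed
  then have "continuous_on UNIV (F_transform f)" by (simp add: continuous_at_imp_continuous_on)
  moreover have "bounded (range (F_transform f))" unfolding bounded_iff using nb by blast
  ultimately show "F_transform f \<in> bcontfun" by (simp add: bcontfun_def)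
qed

lemma F_transform_cong_AE:
  assumes f: "f \<in> L1_pos" and ae: "AE x in lebesgue. x > 0 \<longrightarrow> f x = g x"
  shows "F_transform f = F_transform g"
proof
  fix \<tau>
  obtain G where G: "G \<in> borel_measurable borel" "AE u in lborel. f (exp u) = G u" "integrable lborel (\<lambda>u. exp u *\<^sub>R G u)"
    by (rule L1_pos_log_representative[OF f])
  have "AE x in lborel. x > 0 \<longrightarrow> f x = g x" using ae by (simp add: AE_completion_iff)
  from AE_exp_imp[OF this] have "AE u in lborel. f (exp u) = g (exp u)" .
  with G(2) have g: "AE u in lborel. g (exp u) = G u" by eventually_elim simp
  show "F_transform f \<tau> = F_transform g \<tau>"
    unfolding F_transform_log(2)[OF G] F_transform_log(2)[OF G(1) g G(3)] ..
qed

lemma F_transform_integrable: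
  assumes "f \<in> L1_pos"
  shows "set_integrable lebesgue {0<..} (\<lambda>x. of_real (F_kernel \<tau> x) * f x)"
proof -
  obtain G where G: "G \<in> borel_measurable borel" "AE u in lborel. f (exp u) = G u" "integrable lborel (\<lambda>u. exp u *\<^sub>R G u)"
    by (rule L1_pos_log_representative[OF assms])
  show ?thesis by (rule F_transform_log(1)[OF G])
qed

lemma F_transform_linear:
  assumes f: "f \<in> L1_pos" and g: "g \<in> L1_pos"
  shows "F_transform (\<lambda>x. a * f x + b * g x) \<tau> = a * F_transform f \<tau> + b * F_transform g \<tau>"
proof -
  have "(LINT x:{0<..}|lebesgue. of_real (F_kernel \<tau> x) * (a * f x + b * g x)) = 
     (LINT x:{0<..}|lebesgue. a * (of_real (F_kernel \<tau> x) * f x) + b * (of_real (F_kernel \<tau> x) * g x))"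
    by (simp add: distrib_left mult_ac)
  also have "\<dots> = (LINT x:{0<..}|lebesgue. a * (of_real (F_kernel \<tau> x) * f x)) + (LINT x:{0<..}|lebesgue. b * (of_real (F_kernel \<tau> x) * g x))"
    by (rule set_integral_add) (intro set_integrable_mult_right F_transform_integrable f g)+
  also have "\<dots> = a * (LINT x:{0<..}|lebesgue. of_real (F_kernel \<tau> x) * f x) + b * (LINT x:{0<..}|lebesgue. of_real (F_kernel \<tau> x) * g x)"
    by (simp only: set_integral_mult_right)
  finally show ?thesis unfolding F_transform_def by (simp add: distrib_left mult_ac)
qed

section \<open>Fourier inversion tested against a kernel\<close>

definition gauss_kernel :: "real \<Rightarrow> real \<Rightarrow> real" where
  "gauss_kernel e v = exp (- (v / e)\<^sup>2 / 2) / (e * sqrt (2 * pi))"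

lemma measurable_gauss_kernel [measurable]:
  "f \<in> borel_measurable M \<Longrightarrow> (\<lambda>x. gauss_kernel e (f x)) \<in> borel_measurable M"
  by (rule measurable_compose[where g = "gauss_kernel e" and N = borel])
     (auto simp: gauss_kernel_def[abs_def])

lemma gauss_kernel_nonneg: "e > 0 \<Longrightarrow> 0 \<le> gauss_kernel e v"
  by (simp add: gauss_kernel_def)

text \<open>
  Fubini's theorem and the transform of a Gaussian. With \<open>F\<close> integrable, the Fourier transform of \<open>F\<close> is just
  bounded; the Gaussian factor makes the double integral converge.
\<close>

lemma gauss_kernel_parseval:
  fixes F :: "real \<Rightarrow> complex"
  assumes [measurable]: "F \<in> borel_measurable borel" and F: "integrable lborel F" and e: "e > 0"
  shows "(\<integral>u. F u * of_real (gauss_kernel e (u - a)) \<partial>lborel)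
     = (\<integral>t. (\<integral>u. F u * cis (t * u) \<partial>lborel) * (of_real (exp (- (e * t)\<^sup>2 / 2)) * cis (- (t * a))) \<partial>lborel) / of_real (2 * pi)"
proof -
  define w where "w = (\<lambda>t. exp (- (t / (1 / e))\<^sup>2 / 2))"
  have [measurable]: "w \<in> borel_measurable borel" unfolding w_def by measurable
  have wi: "integrable lborel w" unfolding w_def by (rule integral_gaussian) (use e in simp)
  have w: "w t = exp (- (e * t)\<^sup>2 / 2)" for t by (simp add: w_def mult.commute)
  have "(\<integral>t. (\<integral>u. F u * cis (t * u) \<partial>lborel) * (of_real (w t) * cis (- (t * a))) \<partial>lborel)
     = (\<integral>t. (\<integral>u. F u * (of_real (w t) * cis ((u - a) * t)) \<partial>lborel) \<partial>lborel)"
  proof (rule Bochner_Integration.integral_cong[OF refl])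
    fix t
    have "(\<integral>u. F u * cis (t * u) \<partial>lborel) * (of_real (w t) * cis (- (t * a))) = (\<integral>u. (F u * cis (t * u)) * (of_real (w t) * cis (- (t * a))) \<partial>lborel)"
      by (simp only: integral_mult_left_zero)
    also have "\<dots> = (\<integral>u. F u * (of_real (w t) * cis ((u - a) * t)) \<partial>lborel)"
    proof (rule Bochner_Integration.integral_cong[OF refl])
      fix u
      have "cis (t * u) * cis (- (t * a)) = cis ((u - a) * t)" by (simp add: cis_mult algebra_simps)
      then show "(F u * cis (t * u)) * (of_real (w t) * cis (- (t * a))) = F u * (of_real (w t) * cis ((u - a) * t))"
        by (simp only: mult.assoc mult.left_commute[of "cis (t * u)"])
    qed
    finally show "(\<integral>u. F u * cis (t * u) \<partial>lborel) * (of_real (w t) * cis (- (t * a))) = (\<integral>u. F u * (of_real (w t) * cis ((u - a) * t)) \<partial>lborel)" .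
  qed
  also have "\<dots> = (\<integral>u. (\<integral>t. F u * (of_real (w t) * cis ((u - a) * t)) \<partial>lborel) \<partial>lborel)"
  proof (rule lborel_pair.Fubini_integral)
    have "integrable (lborel \<Otimes>\<^sub>M lborel) (\<lambda>(u, t). norm (F u) * w t)"
      by (rule integrable_tensor_product) (use F wi in auto)
    then show "integrable (lborel \<Otimes>\<^sub>M lborel) (\<lambda>(u, t). F u * (of_real (w t) * cis ((u - a) * t)))"
    proof (rule Bochner_Integration.integrable_bound)
      show "(\<lambda>(u, t). F u * (of_real (w t) * cis ((u - a) * t))) \<in> borel_measurable (lborel \<Otimes>\<^sub>M lborel)" by measurable
      show "AE x in lborel \<Otimes>\<^sub>M lborel. norm (case x of (u, t) \<Rightarrow> F u * (of_real (w t) * cis ((u - a) * t))) \<le> norm (case x of (u, t) \<Rightarrow> norm (F u) * w t)"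
        by (rule AE_I2) (simp add: norm_mult split_beta)
    qed
  qed
  also have "\<dots> = (\<integral>u. of_real (2 * pi) * (F u * of_real (gauss_kernel e (u - a))) \<partial>lborel)"
  proof (rule Bochner_Integration.integral_cong[OF refl])
    fix u
    have "(\<integral>t. of_real (w t) * cis ((u - a) * t) \<partial>lborel) = of_real (1 / e * sqrt (2 * pi) * exp (- ((u - a) * (1 / e))\<^sup>2 / 2))"
      unfolding w_def by (rule integral_gaussian_cis(2)) (use e in simp)
    also have "1 / e * sqrt (2 * pi) * exp (- ((u - a) * (1 / e))\<^sup>2 / 2) = 2 * pi * gauss_kernel e (u - a)"
    proof -
      define q where "q = sqrt (2 * pi)"
      have q: "2 * pi = q * q" "q \<noteq> 0" by (simp_all add: q_def)
      have "2 * pi * gauss_kernel e (u - a) = q * q * (exp (- ((u - a) / e)\<^sup>2 / 2) / (e * q))"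
        unfolding gauss_kernel_def q_def[symmetric] unfolding q(1) ..
      then show ?thesis using q(2) unfolding q_def[symmetric] by simp
    qed
    finally show "(\<integral>t. F u * (of_real (w t) * cis ((u - a) * t)) \<partial>lborel) = of_real (2 * pi) * (F u * of_real (gauss_kernel e (u - a)))"
      by (simp add: mult_ac)
  qed
  also have "\<dots> = of_real (2 * pi) * (\<integral>u. F u * of_real (gauss_kernel e (u - a)) \<partial>lborel)"
    by (rule integral_mult_right_zero)
  finally show ?thesis unfolding w by simp
qed

lemma integrable_exp_minus_abs:
  fixes d :: real
  assumes d: "d > 0"
  shows "integrable lborel (\<lambda>u. exp (- d * \<bar>u\<bar>))"
proof (rule Bochner_Integration.integrable_bound)
  show "integrable lborel (\<lambda>u. (1 + 2 / d\<^sup>2) * inverse (1 + u\<^sup>2))"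
    by (intro integrable_mult_right integrable_inverse_one_plus_square)
  have "exp (- d * \<bar>u\<bar>) \<le> (1 + 2 / d\<^sup>2) * inverse (1 + u\<^sup>2)" for u
  proof -
    have e1: "1 \<le> exp (d * \<bar>u\<bar>)" using d by simp
    have "(d * \<bar>u\<bar>)\<^sup>2 / 2 \<le> exp (d * \<bar>u\<bar>)"
      using sum_subseries_exp_le[of "d * \<bar>u\<bar>" "\<lambda>_. 2" 1] d by (simp add: inj_on_def)
    then have "u\<^sup>2 \<le> 2 / d\<^sup>2 * exp (d * \<bar>u\<bar>)" using d by (simp add: power_mult_distrib field_simps)
    with e1 have "1 + u\<^sup>2 \<le> (1 + 2 / d\<^sup>2) * exp (d * \<bar>u\<bar>)" unfolding distrib_right mult_1_left by (rule add_mono)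
    then have "exp (- (d * \<bar>u\<bar>)) * (1 + u\<^sup>2) \<le> exp (- (d * \<bar>u\<bar>)) * ((1 + 2 / d\<^sup>2) * exp (d * \<bar>u\<bar>))"
      by (rule mult_left_mono) simp
    also have "\<dots> = 1 + 2 / d\<^sup>2" by (simp add: exp_minus)
    finally show ?thesis by (simp add: divide_inverse[symmetric] pos_le_divide_eq add_pos_nonneg)
  qed
  then show "AE u in lborel. norm (exp (- d * \<bar>u\<bar>)) \<le> norm ((1 + 2 / d\<^sup>2) * inverse (1 + u\<^sup>2))" by (intro AE_I2) simp
qed measurable

lemma integrable_exp_abs_gaussian: "integrable lborel (\<lambda>w. exp \<bar>w\<bar> * gauss_kernel 1 w)"
proof (rule Bochner_Integration.integrable_bound)
  show "integrable lborel (\<lambda>w. exp 1 / sqrt (2 * pi) * exp (- (w / sqrt 2)\<^sup>2 / 2))"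
    by (intro integrable_mult_right integral_gaussian) simp
  have "exp \<bar>w\<bar> * gauss_kernel 1 w \<le> exp 1 / sqrt (2 * pi) * exp (- (w / sqrt 2)\<^sup>2 / 2)" for w
  proof -
    \<comment> \<open>Half of the Gaussian exponent is spent on \<open>exp \<bar>w\<bar>\<close>.\<close>
    have "0 \<le> (\<bar>w\<bar> / 2 - 1)\<^sup>2" by simp
    then have "\<bar>w\<bar> + - w\<^sup>2 / 2 \<le> 1 + - (w / sqrt 2)\<^sup>2 / 2" by (simp add: power2_diff power_divide)
    then have "exp \<bar>w\<bar> * exp (- w\<^sup>2 / 2) \<le> exp 1 * exp (- (w / sqrt 2)\<^sup>2 / 2)" unfolding exp_add[symmetric] by simp
    from divide_right_mono[OF this, of "sqrt (2 * pi)"] show ?thesis by (simp add: gauss_kernel_def)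
  qed
  then show "AE w in lborel. norm (exp \<bar>w\<bar> * gauss_kernel 1 w) \<le> norm (exp 1 / sqrt (2 * pi) * exp (- (w / sqrt 2)\<^sup>2 / 2))"
    by (intro AE_I2) (simp add: gauss_kernel_nonneg)
qed measurable

lemma integral_gauss_kernel: "(\<integral>w. gauss_kernel 1 w \<partial>lborel) = 1"
  unfolding gauss_kernel_def using integral_gaussian(2)[of 1] by simp

text \<open>
  The two bounds say that \<open>k(u) exp (\<nu> u)\<close> decays exponentially at both ends of the real line.
\<close>

locale kernel_smoothing =
  fixes \<nu> C :: real and k :: "real \<Rightarrow> real"
  assumes \<nu>: "0 < \<nu>" "\<nu> < 1 / 2"
    and kc: "continuous_on UNIV k"
    and k1: "\<And>u. \<bar>k u\<bar> \<le> C" and k2: "\<And>u. \<bar>k u\<bar> \<le> C * exp (- u / 2)"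
begin

lemma km [measurable]: "k \<in> borel_measurable borel"
  by (rule borel_measurable_continuous_onI[OF kc])

lemma C_nonneg: "C \<ge> 0" using k1[of 0] by linarith

lemma weighted_kernel_bound: "\<bar>k u * exp (\<nu> * u)\<bar> \<le> C * exp (- min \<nu> (1 / 2 - \<nu>) * \<bar>u\<bar>)"
proof (cases "u \<ge> 0")
  case True
  have "\<bar>k u * exp (\<nu> * u)\<bar> \<le> C * exp (- u / 2) * exp (\<nu> * u)" unfolding abs_mult using k2[of u] by simp
  also have "\<dots> = C * exp (- (1 / 2 - \<nu>) * \<bar>u\<bar>)" using True by (simp add: exp_add[symmetric] algebra_simps)
  also have "\<dots> \<le> C * exp (- min \<nu> (1 / 2 - \<nu>) * \<bar>u\<bar>)"
  proof -
    have "- (1 / 2 - \<nu>) * \<bar>u\<bar> \<le> - min \<nu> (1 / 2 - \<nu>) * \<bar>u\<bar>" by (intro mult_right_mono) auto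
    then show ?thesis using C_nonneg by (intro mult_left_mono) (simp_all only: exp_le_cancel_iff)
  qed
  finally show ?thesis .
next
  case False
  have "\<bar>k u * exp (\<nu> * u)\<bar> \<le> C * exp (\<nu> * u)" unfolding abs_mult using k1[of u] by simp
  also have "\<dots> = C * exp (- \<nu> * \<bar>u\<bar>)" using False by simp
  also have "\<dots> \<le> C * exp (- min \<nu> (1 / 2 - \<nu>) * \<bar>u\<bar>)" using C_nonneg by (intro mult_left_mono) (auto intro!: mult_right_mono)
  finally show ?thesis .
qed

lemma integrable_weighted_kernel: "integrable lborel (\<lambda>u. k u * exp (\<nu> * u))"
proof (rule Bochner_Integration.integrable_bound)
  show "integrable lborel (\<lambda>u. C * exp (- min \<nu> (1 / 2 - \<nu>) * \<bar>u\<bar>))"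
    using \<nu> by (intro integrable_mult_right integrable_exp_minus_abs) auto
  show "AE u in lborel. norm (k u * exp (\<nu> * u)) \<le> norm (C * exp (- min \<nu> (1 / 2 - \<nu>) * \<bar>u\<bar>))"
    using weighted_kernel_bound C_nonneg by (intro AE_I2) simp
qed measurable

text \<open>
  Gaussian smoothing of \<open>k\<close>, carried out on \<open>k(u) exp (\<nu> u)\<close> since it is this function that meets the Fourier
  side.
\<close>

definition smoothed :: "real \<Rightarrow> real \<Rightarrow> real" where
  "smoothed e u = (\<integral>a. exp (- \<nu> * u) * gauss_kernel e (u - a) * (k a * exp (\<nu> * a)) \<partial>lborel)"

definition exp_moment :: real where "exp_moment = (\<integral>w. exp \<bar>w\<bar> * gauss_kernel 1 w \<partial>lborel)"

lemma smoothed_integrand_bound: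
  assumes e: "0 < e" "e \<le> 1"
  shows "\<bar>k (u - e * w) * exp (- \<nu> * (e * w)) * gauss_kernel 1 w\<bar> \<le> C * (exp \<bar>w\<bar> * gauss_kernel 1 w)"
proof -
  have "- \<nu> * (e * w) \<le> \<bar>w\<bar>"
  proof -
    have "\<bar>\<nu> * (e * w)\<bar> \<le> 1 * (1 * \<bar>w\<bar>)" unfolding abs_mult using \<nu> e by (intro mult_mono) auto
    then show ?thesis by linarith
  qed
  then have "\<bar>k (u - e * w)\<bar> * exp (- \<nu> * (e * w)) \<le> C * exp \<bar>w\<bar>" using k1[of "u - e * w"] C_nonneg by (intro mult_mono) auto
  from mult_right_mono[OF this gauss_kernel_nonneg[of 1 w]] show ?thesis
    by (simp add: abs_mult gauss_kernel_nonneg mult.assoc)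
qed

lemma smoothed_substitution:
  assumes e: "0 < e" "e \<le> 1"
  shows "integrable lborel (\<lambda>a. exp (- \<nu> * u) * gauss_kernel e (u - a) * (k a * exp (\<nu> * a)))"
    and "smoothed e u = (\<integral>w. k (u - e * w) * exp (- \<nu> * (e * w)) * gauss_kernel 1 w \<partial>lborel)"
    and "(\<integral>a. \<bar>exp (- \<nu> * u) * gauss_kernel e (u - a) * (k a * exp (\<nu> * a))\<bar> \<partial>lborel) \<le> C * exp_moment"
proof -
  \<comment> \<open>Substitution \<open>a = u - e w\<close>.\<close>
  have eq: "exp (- \<nu> * u) * gauss_kernel e (u - (u + (- e) * w)) * (k (u + (- e) * w) * exp (\<nu> * (u + (- e) * w))) = (k (u - e * w) * exp (- \<nu> * (e * w)) * gauss_kernel 1 w) / e" for w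
  proof -
    have "exp (- \<nu> * u) * exp (\<nu> * (u + (- e) * w)) = exp (- \<nu> * (e * w))" by (simp add: exp_add[symmetric] algebra_simps)
    moreover have "gauss_kernel e (u - (u + (- e) * w)) = gauss_kernel 1 w / e" using e by (simp add: gauss_kernel_def)
    ultimately show ?thesis by (simp add: mult_ac)
  qed
  have i: "integrable lborel (\<lambda>w. k (u - e * w) * exp (- \<nu> * (e * w)) * gauss_kernel 1 w)"
  proof (rule Bochner_Integration.integrable_bound)
    show "integrable lborel (\<lambda>w. C * (exp \<bar>w\<bar> * gauss_kernel 1 w))" by (intro integrable_mult_right integrable_exp_abs_gaussian)
    show "AE w in lborel. norm (k (u - e * w) * exp (- \<nu> * (e * w)) * gauss_kernel 1 w) \<le> norm (C * (exp \<bar>w\<bar> * gauss_kernel 1 w))"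
      by (rule AE_I2, unfold real_norm_def, rule order_trans[OF smoothed_integrand_bound[OF e] abs_ge_self])
  qed measurable
  then have "integrable lborel (\<lambda>w. exp (- \<nu> * u) * gauss_kernel e (u - (u + (- e) * w)) * (k (u + (- e) * w) * exp (\<nu> * (u + (- e) * w))))"
    unfolding eq by (rule integrable_divide)
  then show i2: "integrable lborel (\<lambda>a. exp (- \<nu> * u) * gauss_kernel e (u - a) * (k a * exp (\<nu> * a)))"
    by (subst (asm) lborel_integrable_real_affine_iff) (use e in auto)
  have "smoothed e u = \<bar>- e\<bar> *\<^sub>R (\<integral>w. exp (- \<nu> * u) * gauss_kernel e (u - (u + (- e) * w)) * (k (u + (- e) * w) * exp (\<nu> * (u + (- e) * w))) \<partial>lborel)"
    unfolding smoothed_def by (rule lborel_integral_real_affine) (use e in auto)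
  then show "smoothed e u = (\<integral>w. k (u - e * w) * exp (- \<nu> * (e * w)) * gauss_kernel 1 w \<partial>lborel)"
    unfolding eq using e by simp
  have "(\<integral>a. \<bar>exp (- \<nu> * u) * gauss_kernel e (u - a) * (k a * exp (\<nu> * a))\<bar> \<partial>lborel) = \<bar>- e\<bar> *\<^sub>R (\<integral>w. \<bar>exp (- \<nu> * u) * gauss_kernel e (u - (u + (- e) * w)) * (k (u + (- e) * w) * exp (\<nu> * (u + (- e) * w)))\<bar> \<partial>lborel)"
    by (rule lborel_integral_real_affine) (use e in auto)
  also have "\<dots> = (\<integral>w. \<bar>k (u - e * w) * exp (- \<nu> * (e * w)) * gauss_kernel 1 w\<bar> \<partial>lborel)"
    unfolding eq using e by (simp add: abs_divide)
  also have "\<dots> \<le> (\<integral>w. C * (exp \<bar>w\<bar> * gauss_kernel 1 w) \<partial>lborel)"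
    by (intro integral_mono integrable_abs i integrable_mult_right integrable_exp_abs_gaussian smoothed_integrand_bound e)
  finally show "(\<integral>a. \<bar>exp (- \<nu> * u) * gauss_kernel e (u - a) * (k a * exp (\<nu> * a))\<bar> \<partial>lborel) \<le> C * exp_moment"
    unfolding exp_moment_def by simp
qed

lemma smoothed_bound:
  assumes e: "0 < e" "e \<le> 1"
  shows "\<bar>smoothed e u\<bar> \<le> C * exp_moment"
proof -
  have "norm (smoothed e u) \<le> (\<integral>a. norm (exp (- \<nu> * u) * gauss_kernel e (u - a) * (k a * exp (\<nu> * a))) \<partial>lborel)"
    unfolding smoothed_def by (rule integral_norm_bound)
  then show ?thesis using smoothed_substitution(3)[OF e, of u] unfolding real_norm_def by linarith
qed

lemma smoothed_tendsto:
  assumes e: "\<And>n. 0 < e n" "\<And>n. e n \<le> 1" "e \<longlonglongrightarrow> 0"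
  shows "(\<lambda>n. smoothed (e n) u) \<longlonglongrightarrow> k u"
proof -
  have "(\<lambda>n. \<integral>w. k (u - e n * w) * exp (- \<nu> * (e n * w)) * gauss_kernel 1 w \<partial>lborel) \<longlonglongrightarrow> (\<integral>w. k u * gauss_kernel 1 w \<partial>lborel)"
  proof (rule integral_dominated_convergence[where w = "\<lambda>w. C * (exp \<bar>w\<bar> * gauss_kernel 1 w)"])
    show "integrable lborel (\<lambda>w. C * (exp \<bar>w\<bar> * gauss_kernel 1 w))" by (intro integrable_mult_right integrable_exp_abs_gaussian)
    show "AE w in lborel. norm (k (u - e n * w) * exp (- \<nu> * (e n * w)) * gauss_kernel 1 w) \<le> C * (exp \<bar>w\<bar> * gauss_kernel 1 w)" for n
      by (rule AE_I2, unfold real_norm_def, rule smoothed_integrand_bound[OF e(1,2)])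
    show "AE w in lborel. (\<lambda>n. k (u - e n * w) * exp (- \<nu> * (e n * w)) * gauss_kernel 1 w) \<longlonglongrightarrow> k u * gauss_kernel 1 w"
    proof (rule AE_I2)
      fix w
      have "isCont k (u - 0 * w)" using kc by (simp add: continuous_on_eq_continuous_at)
      then have "(\<lambda>n. k (u - e n * w)) \<longlonglongrightarrow> k (u - 0 * w)"
        by (rule isCont_tendsto_compose) (intro tendsto_intros e)
      then have "(\<lambda>n. k (u - e n * w) * exp (- \<nu> * (e n * w)) * gauss_kernel 1 w) \<longlonglongrightarrow> k (u - 0 * w) * exp (- \<nu> * (0 * w)) * gauss_kernel 1 w"
        by (intro tendsto_intros e)
      then show "(\<lambda>n. k (u - e n * w) * exp (- \<nu> * (e n * w)) * gauss_kernel 1 w) \<longlonglongrightarrow> k u * gauss_kernel 1 w" by simp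
    qed
  qed measurable
  then show ?thesis unfolding smoothed_substitution(2)[OF e(1,2)] using integral_gauss_kernel by simp
qed

lemma smoothed_fubini:
  fixes f :: "real \<Rightarrow> complex"
  assumes [measurable]: "f \<in> borel_measurable borel" and f: "integrable lborel f" and e: "0 < e" "e \<le> 1"
  shows "(\<integral>a. of_real (k a * exp (\<nu> * a)) * (\<integral>u. f u * of_real (exp (- \<nu> * u) * gauss_kernel e (u - a)) \<partial>lborel) \<partial>lborel)
    = (\<integral>u. f u * of_real (smoothed e u) \<partial>lborel)"
proof -
  define H where "H = (\<lambda>u a. f u * of_real (exp (- \<nu> * u) * gauss_kernel e (u - a) * (k a * exp (\<nu> * a))))"
  have Hm[measurable]: "(\<lambda>(u, a). H u a) \<in> borel_measurable (lborel \<Otimes>\<^sub>M lborel)" unfolding H_def by measurable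
  have Hi: "integrable lborel (H u)" for u unfolding H_def
    using smoothed_substitution(1)[OF e, of u] by (intro integrable_mult_right integrable_of_real)
  have nH: "(\<integral>a. norm (H u a) \<partial>lborel) = norm (f u) * (\<integral>a. \<bar>exp (- \<nu> * u) * gauss_kernel e (u - a) * (k a * exp (\<nu> * a))\<bar> \<partial>lborel)" for u
    unfolding H_def norm_mult norm_of_real by (rule integral_mult_right_zero)
  have int: "integrable (lborel \<Otimes>\<^sub>M lborel) (\<lambda>(u, a). H u a)"
  proof (rule lborel_pair.Fubini_integrable[OF Hm])
    show "AE u in lborel. integrable lborel (\<lambda>a. case (u, a) of (u, a) \<Rightarrow> H u a)" using Hi by simp
    show "integrable lborel (\<lambda>u. \<integral>a. norm (case (u, a) of (u, a) \<Rightarrow> H u a) \<partial>lborel)"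
    proof (rule Bochner_Integration.integrable_bound)
      show "integrable lborel (\<lambda>u. norm (f u) * (C * exp_moment))" using f by (intro integrable_mult_left integrable_norm)
      show "(\<lambda>u. \<integral>a. norm (case (u, a) of (u, a) \<Rightarrow> H u a) \<partial>lborel) \<in> borel_measurable lborel" by measurable
      show "AE u in lborel. norm (\<integral>a. norm (case (u, a) of (u, a) \<Rightarrow> H u a) \<partial>lborel) \<le> norm (norm (f u) * (C * exp_moment))"
      proof (rule AE_I2)
        fix u
        have "(\<integral>a. norm (H u a) \<partial>lborel) \<le> norm (f u) * (C * exp_moment)"
          unfolding nH using smoothed_substitution(3)[OF e, of u] by (intro mult_left_mono) auto
        moreover have "0 \<le> (\<integral>a. norm (H u a) \<partial>lborel)" by (rule Bochner_Integration.integral_nonneg) simp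
        ultimately show "norm (\<integral>a. norm (case (u, a) of (u, a) \<Rightarrow> H u a) \<partial>lborel) \<le> norm (norm (f u) * (C * exp_moment))" by simp
      qed
    qed
  qed
  have "(\<integral>a. of_real (k a * exp (\<nu> * a)) * (\<integral>u. f u * of_real (exp (- \<nu> * u) * gauss_kernel e (u - a)) \<partial>lborel) \<partial>lborel) = (\<integral>a. (\<integral>u. H u a \<partial>lborel) \<partial>lborel)"
    unfolding integral_mult_right_zero[symmetric] H_def of_real_mult
    by (simp only: mult.assoc mult.commute mult.left_commute)
  also have "\<dots> = (\<integral>u. (\<integral>a. H u a \<partial>lborel) \<partial>lborel)"
    by (rule lborel_pair.Fubini_integral[OF int])
  also have "\<dots> = (\<integral>u. f u * of_real (smoothed e u) \<partial>lborel)"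
    unfolding H_def smoothed_def by (simp only: integral_mult_right_zero integral_complex_of_real)
  finally show ?thesis .
qed

text \<open>
  A Fourier inversion formula for \<open>f(u) exp (- \<nu> u)\<close>, in integrated form. The hypothesis \<open>smooth\<close> is
  Parseval's relation for Gaussians of every small width centred at every point \<open>a\<close>. Multiplying it by
  \<open>k(a) exp (\<nu> a)\<close> and integrating over \<open>a\<close> moves the smoothing onto \<open>k\<close>, which is continuous; the width may
  then tend to 0 by dominated convergence, without any pointwise convergence of the smoothed \<open>f\<close>.
\<close>

lemma inversion_against_kernel:
  fixes f g :: "real \<Rightarrow> complex"
  assumes fm[measurable]: "f \<in> borel_measurable borel" and f: "integrable lborel f"
    and gm[measurable]: "g \<in> borel_measurable borel" and g: "integrable lborel g"
    and smooth: "\<And>e a. 0 < e \<Longrightarrow> e \<le> 1 \<Longrightarrow> (\<integral>u. f u * of_real (exp (- \<nu> * u) * gauss_kernel e (u - a)) \<partial>lborel)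
       = (\<integral>t. g t * (of_real (exp (- (e * t)\<^sup>2 / 2)) * cis (- (t * a))) \<partial>lborel) / of_real (2 * pi)"
  shows "(\<integral>u. of_real (k u) * f u \<partial>lborel) = (\<integral>u. of_real (k u * exp (\<nu> * u)) * (fourier g u / of_real (2 * pi)) \<partial>lborel)"
proof -
  define e where "e = (\<lambda>n. 1 / (real n + 1))"
  have e: "0 < e n" "e n \<le> 1" for n by (auto simp: e_def)
  have e0: "e \<longlonglongrightarrow> 0" unfolding e_def by real_asymp
  define R where "R = (\<lambda>n a. (\<integral>t. g t * (of_real (exp (- (e n * t)\<^sup>2 / 2)) * cis (- (t * a))) \<partial>lborel) / of_real (2 * pi))"
  have Rm: "R n \<in> borel_measurable lborel" for n unfolding R_def by measurable
  define N where "N = (\<integral>t. norm (g t) \<partial>lborel)"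
  have Rb: "norm (R n a) \<le> N / (2 * pi)" for n a
  proof -
    have "norm (\<integral>t. g t * (of_real (exp (- (e n * t)\<^sup>2 / 2)) * cis (- (t * a))) \<partial>lborel) \<le> (\<integral>t. norm (g t * (of_real (exp (- (e n * t)\<^sup>2 / 2)) * cis (- (t * a)))) \<partial>lborel)"
      by (rule integral_norm_bound)
    also have "\<dots> \<le> N" unfolding N_def
      by (rule integral_mono_AE'[OF integrable_norm[OF g]]) (rule AE_I2, simp add: norm_mult mult_left_le, simp)
    finally show ?thesis unfolding R_def norm_divide by (simp add: divide_right_mono)
  qed
  have Rl: "(\<lambda>n. R n a) \<longlonglongrightarrow> fourier g a / of_real (2 * pi)" for a
    unfolding R_def fourier_def
  proof (rule tendsto_divide[OF _ tendsto_const])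
    show "(\<lambda>n. \<integral>t. g t * (of_real (exp (- (e n * t)\<^sup>2 / 2)) * cis (- (t * a))) \<partial>lborel) \<longlonglongrightarrow> (\<integral>t. g t * cis (- (t * a)) \<partial>lborel)"
    proof (rule integral_dominated_convergence[OF _ _ integrable_norm[OF g]])
      show "AE t in lborel. (\<lambda>n. g t * (of_real (exp (- (e n * t)\<^sup>2 / 2)) * cis (- (t * a)))) \<longlonglongrightarrow> g t * cis (- (t * a))"
      proof (rule AE_I2)
        fix t
        have "(\<lambda>n. g t * (of_real (exp (- (e n * t)\<^sup>2 / 2)) * cis (- (t * a)))) \<longlonglongrightarrow> g t * (of_real (exp (- (0 * t)\<^sup>2 / 2)) * cis (- (t * a)))"
          by (intro tendsto_intros e0) auto
        then show "(\<lambda>n. g t * (of_real (exp (- (e n * t)\<^sup>2 / 2)) * cis (- (t * a)))) \<longlonglongrightarrow> g t * cis (- (t * a))" by simp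
      qed
      show "AE t in lborel. norm (g t * (of_real (exp (- (e n * t)\<^sup>2 / 2)) * cis (- (t * a)))) \<le> norm (g t)" for n
        by (rule AE_I2) (simp add: norm_mult mult_left_le)
    qed measurable
  qed simp
  have sm: "smoothed (e n) \<in> borel_measurable lborel" for n unfolding smoothed_def by measurable
  have L: "(\<lambda>n. \<integral>u. f u * of_real (smoothed (e n) u) \<partial>lborel) \<longlonglongrightarrow> (\<integral>u. f u * of_real (k u) \<partial>lborel)"
  proof (rule integral_dominated_convergence[where w = "\<lambda>u. norm (f u) * (C * exp_moment)"])
    show "integrable lborel (\<lambda>u. norm (f u) * (C * exp_moment))" using f by (intro integrable_mult_left integrable_norm)
    show "(\<lambda>u. f u * of_real (smoothed (e n) u)) \<in> borel_measurable lborel" for n using sm by measurable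
    show "AE u in lborel. (\<lambda>n. f u * of_real (smoothed (e n) u)) \<longlonglongrightarrow> f u * of_real (k u)"
      by (intro AE_I2 tendsto_mult tendsto_const tendsto_of_real smoothed_tendsto e e0)
    show "AE u in lborel. norm (f u * of_real (smoothed (e n) u)) \<le> norm (f u) * (C * exp_moment)" for n
      unfolding norm_mult norm_of_real by (intro AE_I2 mult_left_mono smoothed_bound e) simp
  qed measurable
  have Rr: "(\<lambda>n. \<integral>a. of_real (k a * exp (\<nu> * a)) * R n a \<partial>lborel) \<longlonglongrightarrow> (\<integral>a. of_real (k a * exp (\<nu> * a)) * (fourier g a / of_real (2 * pi)) \<partial>lborel)"
  proof (rule integral_dominated_convergence[where w = "\<lambda>a. \<bar>k a * exp (\<nu> * a)\<bar> * (N / (2 * pi))"])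
    show "integrable lborel (\<lambda>a. \<bar>k a * exp (\<nu> * a)\<bar> * (N / (2 * pi)))"
      by (intro integrable_mult_left integrable_abs integrable_weighted_kernel)
    show "(\<lambda>a. of_real (k a * exp (\<nu> * a)) * R n a) \<in> borel_measurable lborel" for n using Rm by measurable
    show "AE a in lborel. (\<lambda>n. of_real (k a * exp (\<nu> * a)) * R n a) \<longlonglongrightarrow> of_real (k a * exp (\<nu> * a)) * (fourier g a / of_real (2 * pi))"
      by (intro AE_I2 tendsto_mult[OF tendsto_const Rl])
    show "AE a in lborel. norm (of_real (k a * exp (\<nu> * a)) * R n a) \<le> \<bar>k a * exp (\<nu> * a)\<bar> * (N / (2 * pi))" for n
      unfolding norm_mult[of "of_real _" "R n _"] norm_of_real by (intro AE_I2 mult_left_mono Rb) simp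
  qed measurable
  have "(\<integral>u. f u * of_real (smoothed (e n) u) \<partial>lborel) = (\<integral>a. of_real (k a * exp (\<nu> * a)) * R n a \<partial>lborel)" for n
    unfolding smoothed_fubini[OF fm f e, symmetric] smooth[OF e] R_def ..
  then have "(\<integral>u. f u * of_real (k u) \<partial>lborel) = (\<integral>a. of_real (k a * exp (\<nu> * a)) * (fourier g a / of_real (2 * pi)) \<partial>lborel)"
    using LIMSEQ_unique[OF L] Rr by simp
  then show ?thesis by (simp add: mult.commute)
qed

end

section \<open>Weighted norms and convergence in the mean\<close>

lemma lebesgue_eq_lborel_AE:
  fixes f g :: "real \<Rightarrow> 'b::euclidean_space"
  assumes g: "g \<in> borel_measurable borel" and ae: "AE t in lborel. f t = g t"
  shows "f \<in> borel_measurable lebesgue" and "integrable lebesgue f \<longleftrightarrow> integrable lborel g"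
    and "integral\<^sup>L lebesgue f = integral\<^sup>L lborel g"
proof -
  have g': "g \<in> borel_measurable lborel" using g by simp
  have gl: "g \<in> borel_measurable lebesgue" by (rule measurable_completion[OF g'])
  have ael: "AE t in lebesgue. f t = g t" using ae by (subst AE_completion_iff)
  then have "AE t in lebesgue. g t = f t" by (rule eventually_mono) simp
  from borel_measurable_AE[OF gl this] show fl: "f \<in> borel_measurable lebesgue" .
  show "integrable lebesgue f \<longleftrightarrow> integrable lborel g"
    using integrable_cong_AE[OF fl gl ael] integrable_completion[OF g'] by simp
  show "integral\<^sup>L lebesgue f = integral\<^sup>L lborel g"
    using integral_cong_AE[OF fl gl ael] integral_completion[OF g'] by simp
qed

text \<open>
  A linear bound of this form, with \<open>eta\<close> chosen at the end, replaces Hoelder's inequality in the passage from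
  convergence in the mean to convergence of weighted integrals, and it treats \<open>r = 1\<close> like the other orders.
\<close>

lemma le_eps_plus_powr:
  fixes x eta r :: real
  assumes "0 \<le> x" "1 \<le> r" "0 < eta"
  shows "x \<le> eta + eta powr (1 - r) * x powr r"
proof -
  have "x / eta \<le> 1 + (x / eta) powr r" using assms by (intro le_one_plus_powr) auto
  then have "eta * (x / eta) \<le> eta * (1 + (x / eta) powr r)" using assms(3) by (intro mult_left_mono) auto
  moreover have "eta * (x / eta) powr r = eta powr (1 - r) * x powr r"
    using assms by (simp add: powr_divide powr_diff)
  ultimately show ?thesis using assms(3) by (simp add: distrib_left)
qed

lemma integrable_weight_mult:
  fixes D :: "real \<Rightarrow> complex" and w :: "real \<Rightarrow> real"
  assumes [measurable]: "D \<in> borel_measurable borel" and r: "1 \<le> r" and D: "integrable lborel (\<lambda>t. norm (D t) powr r)"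
    and w: "integrable lborel w" "\<And>t. 0 \<le> w t" "\<And>t. w t \<le> K"
  shows "integrable lborel (\<lambda>t. w t * norm (D t))"
    and "0 < eta \<Longrightarrow> (\<integral>t. w t * norm (D t) \<partial>lborel) \<le> eta * (\<integral>t. w t \<partial>lborel) + K * eta powr (1 - r) * (\<integral>t. norm (D t) powr r \<partial>lborel)"
proof -
  have [measurable]: "w \<in> borel_measurable borel" using w(1) by auto
  have le: "w t * norm (D t) \<le> eta * w t + K * eta powr (1 - r) * norm (D t) powr r" if "0 < eta" for eta t
  proof -
    have "w t * norm (D t) \<le> w t * (eta + eta powr (1 - r) * norm (D t) powr r)"
      using le_eps_plus_powr[OF norm_ge_zero r that, of "D t"] w(2) by (rule mult_left_mono)
    also have "\<dots> \<le> eta * w t + K * (eta powr (1 - r) * norm (D t) powr r)"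
      unfolding distrib_left using w(3)[of t] by (intro add_mono mult_right_mono) auto
    finally show ?thesis by (simp add: mult.assoc)
  qed
  have i: "integrable lborel (\<lambda>t. eta * w t + K * eta powr (1 - r) * norm (D t) powr r)" for eta
    by (intro Bochner_Integration.integrable_add integrable_mult_right w(1) D)
  show i1: "integrable lborel (\<lambda>t. w t * norm (D t))"
  proof (rule Bochner_Integration.integrable_bound[OF i[of 1]])
    show "AE t in lborel. norm (w t * norm (D t)) \<le> norm (1 * w t + K * 1 powr (1 - r) * norm (D t) powr r)"
    proof (rule AE_I2)
      fix t
      have "norm (w t * norm (D t)) = w t * norm (D t)" using w(2)[of t] by simp
      also have "\<dots> \<le> 1 * w t + K * 1 powr (1 - r) * norm (D t) powr r" by (rule le) simp
      finally show "norm (w t * norm (D t)) \<le> norm (1 * w t + K * 1 powr (1 - r) * norm (D t) powr r)"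
        unfolding real_norm_def by (rule order_trans[OF _ abs_ge_self])
    qed
  qed measurable
  assume "0 < eta"
  then have "(\<integral>t. w t * norm (D t) \<partial>lborel) \<le> (\<integral>t. eta * w t + K * eta powr (1 - r) * norm (D t) powr r \<partial>lborel)"
    by (intro integral_mono i i1 le)
  also have "\<dots> = (\<integral>t. eta * w t \<partial>lborel) + (\<integral>t. K * eta powr (1 - r) * norm (D t) powr r \<partial>lborel)"
    by (intro Bochner_Integration.integral_add integrable_mult_right w(1) D)
  finally show "(\<integral>t. w t * norm (D t) \<partial>lborel) \<le> eta * (\<integral>t. w t \<partial>lborel) + K * eta powr (1 - r) * (\<integral>t. norm (D t) powr r \<partial>lborel)"
    by simp
qed

lemma weighted_integral_tendsto_0:
  fixes D :: "nat \<Rightarrow> real \<Rightarrow> complex" and w :: "real \<Rightarrow> real"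
  assumes Dm: "\<And>n. D n \<in> borel_measurable borel" and r: "1 \<le> r"
    and D: "\<forall>\<^sub>F n in sequentially. integrable lborel (\<lambda>t. norm (D n t) powr r)"
    and D0: "(\<lambda>n. \<integral>t. norm (D n t) powr r \<partial>lborel) \<longlonglongrightarrow> 0"
    and w: "integrable lborel w" "\<And>t. 0 \<le> w t" "\<And>t. w t \<le> K"
  shows "(\<lambda>n. \<integral>t. w t * norm (D n t) \<partial>lborel) \<longlonglongrightarrow> 0"
proof (rule order_tendstoI)
  fix a :: real assume "a < 0"
  moreover have "0 \<le> (\<integral>t. w t * norm (D n t) \<partial>lborel)" for n
    by (rule Bochner_Integration.integral_nonneg) (simp add: w(2))
  ultimately show "\<forall>\<^sub>F n in sequentially. a < (\<integral>t. w t * norm (D n t) \<partial>lborel)"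
    by (intro always_eventually allI) (rule less_le_trans)
next
  fix a :: real assume a: "0 < a"
  define I where "I = (\<integral>t. w t \<partial>lborel)"
  have I: "I \<ge> 0" unfolding I_def by (rule Bochner_Integration.integral_nonneg) (rule w(2))
  \<comment> \<open>With this \<open>eta\<close> the first term of the bound is at most \<open>a / 2\<close>; the second one vanishes in the limit.\<close>
  define eta where "eta = a / (2 * (I + 1))"
  have eta: "eta > 0" using a I by (simp add: eta_def)
  have "eta * I \<le> a / 2" using a I by (simp add: eta_def field_simps)
  have "(\<lambda>n. K * eta powr (1 - r) * (\<integral>t. norm (D n t) powr r \<partial>lborel)) \<longlonglongrightarrow> K * eta powr (1 - r) * 0"
    by (intro tendsto_intros D0)
  then have "\<forall>\<^sub>F n in sequentially. K * eta powr (1 - r) * (\<integral>t. norm (D n t) powr r \<partial>lborel) < a / 2"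
    by (rule order_tendstoD) (use a in simp)
  with D show "\<forall>\<^sub>F n in sequentially. (\<integral>t. w t * norm (D n t) \<partial>lborel) < a"
  proof eventually_elim
    case (elim n)
    have "(\<integral>t. w t * norm (D n t) \<partial>lborel) \<le> eta * (\<integral>t. w t \<partial>lborel) + K * eta powr (1 - r) * (\<integral>t. norm (D n t) powr r \<partial>lborel)"
      by (rule integrable_weight_mult(2)[OF Dm r elim(1) w eta])
    then show ?case using elim(2) \<open>eta * I \<le> a / 2\<close> unfolding I_def by linarith
  qed
qed

lemma tendsto_powr_inverse_cancel:
  fixes I :: "'a \<Rightarrow> real"
  assumes "((\<lambda>x. I x powr (1 / r)) \<longlongrightarrow> 0) F" "r > 0" "\<And>x. 0 \<le> I x"
  shows "(I \<longlongrightarrow> 0) F"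
proof -
  have "((\<lambda>x. (I x powr (1 / r)) powr r) \<longlongrightarrow> 0 powr r) F"
    by (rule tendsto_powr'[OF assms(1) tendsto_const]) (use assms in \<open>auto intro: always_eventually\<close>)
  then show ?thesis using assms by (simp add: powr_powr)
qed

lemma norm_diff_powr_le:
  fixes x y :: complex
  assumes "0 \<le> r"
  shows "norm (x - y) powr r \<le> 2 powr r * (norm x powr r + norm y powr r)"
proof -
  have "norm (x - y) \<le> 2 * max (norm x) (norm y)" using norm_triangle_ineq4[of x y] by linarith
  then have "norm (x - y) powr r \<le> (2 * max (norm x) (norm y)) powr r" using assms by (intro powr_mono2) auto
  also have "\<dots> = 2 powr r * (max (norm x) (norm y)) powr r" by (rule powr_mult)
  also have "\<dots> \<le> 2 powr r * (norm x powr r + norm y powr r)"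
    by (intro mult_left_mono) (auto simp: max_def)
  finally show ?thesis .
qed

lemma integrable_norm_diff_powr:
  fixes f g :: "real \<Rightarrow> complex"
  assumes [measurable]: "f \<in> borel_measurable borel" "g \<in> borel_measurable borel" and r: "0 \<le> r"
    and f: "integrable lborel (\<lambda>t. norm (f t) powr r)" and g: "integrable lborel (\<lambda>t. norm (g t) powr r)"
  shows "integrable lborel (\<lambda>t. norm (f t - g t) powr r)"
proof (rule Bochner_Integration.integrable_bound)
  show "integrable lborel (\<lambda>t. 2 powr r * (norm (f t) powr r + norm (g t) powr r))"
    by (intro integrable_mult_right Bochner_Integration.integrable_add f g)
  show "AE t in lborel. norm (norm (f t - g t) powr r) \<le> norm (2 powr r * (norm (f t) powr r + norm (g t) powr r))"
    using norm_diff_powr_le[OF r] by (intro AE_I2) simp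
qed measurable

text \<open>
  The factor \<open>exp (c v)\<close> by which \<open>\<Phi>\<close> differs from \<open>\<phi>\<close> in the logarithmic variable absorbs the weight of the
  norm.
\<close>

lemma weighted_Lp_log:
  assumes Pm: "\<Phi> \<in> borel_measurable borel" and ae: "AE v in lborel. \<phi> (exp v) = of_real (exp (- c * v)) * \<Phi> v" and r: "0 < r"
  shows "\<phi> \<in> weighted_Lp c r \<longleftrightarrow> integrable lborel (\<lambda>v. norm (\<Phi> v) powr r)"
    and "weighted_Lp_norm c r \<phi> = (\<integral>v. norm (\<Phi> v) powr r \<partial>lborel) powr (1 / r)"
proof -
  have m1: "(\<lambda>v. of_real (exp (- c * v)) * \<Phi> v) \<in> borel_measurable borel" using Pm by measurable
  have m2: "(\<lambda>v. norm (of_real (exp (- c * v)) * \<Phi> v) powr r * exp v powr (c * r - 1)) \<in> borel_measurable borel" using Pm by measurable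
  have ae2: "AE v in lborel. norm (\<phi> (exp v)) powr r * exp v powr (c * r - 1) = norm (of_real (exp (- c * v)) * \<Phi> v) powr r * exp v powr (c * r - 1)"
    using ae by eventually_elim simp
  have eq: "exp v *\<^sub>R (norm (of_real (exp (- c * v)) * \<Phi> v) powr r * exp v powr (c * r - 1)) = norm (\<Phi> v) powr r" for v
  proof -
    have "norm (of_real (exp (- c * v)) * \<Phi> v) powr r = exp (- c * v * r) * norm (\<Phi> v) powr r"
      by (simp add: norm_mult powr_mult exp_powr_real)
    moreover have "exp v powr (c * r - 1) = exp (v * (c * r - 1))" by (simp add: exp_powr_real)
    moreover have "exp v * exp (- c * v * r) * exp (v * (c * r - 1)) = 1"
      unfolding exp_add[symmetric] by (simp add: algebra_simps)
    ultimately show ?thesis by (simp add: mult_ac)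
  qed
  note h = half_line_integral_log[of _ "\<lambda>x. norm (\<phi> x) powr r * x powr (c * r - 1)", OF m2 ae2, unfolded eq]
  have "set_borel_measurable lebesgue {0<..} \<phi>" by (rule half_line_integral_log(3)[OF m1 ae])
  then show "\<phi> \<in> weighted_Lp c r \<longleftrightarrow> integrable lborel (\<lambda>v. norm (\<Phi> v) powr r)"
    unfolding weighted_Lp_def using h(1) by simp
  show "weighted_Lp_norm c r \<phi> = (\<integral>v. norm (\<Phi> v) powr r \<partial>lborel) powr (1 / r)"
    unfolding weighted_Lp_norm_def h(2) ..
qed

lemma exp_powr_Complex: "complex_of_real (exp v) powr (- Complex c t) = of_real (exp (- c * v)) * cis (- (t * v))"
proof -
  have "complex_of_real (exp v) powr (- Complex c t) = exp (- Complex c t * of_real v)"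
    by (simp add: powr_def Ln_of_real)
  also have "- Complex c t * of_real v = of_real (- c * v) + \<i> * of_real (- (t * v))"
    by (simp add: complex_eq_iff)
  finally show ?thesis unfolding exp_add exp_of_real cis_conv_exp by simp
qed

text \<open>
  In the logarithmic variable the cut-off inverse Mellin transform is the Fourier transform of a truncation.
\<close>

lemma inv_mellin_trunc_exp:
  assumes hm[measurable]: "h0 \<in> borel_measurable borel" and ae: "AE t in lborel. H (Complex c t) = h0 t"
  shows "inv_mellin_trunc c H T (exp v) = of_real (exp (- c * v)) * (fourier (truncate_at h0 T) v / of_real (2 * pi))"
proof -
  have m: "(\<lambda>t. indicat_real {- T..T} t *\<^sub>R (h0 t * of_real (exp v) powr (- Complex c t))) \<in> borel_measurable borel"
    unfolding exp_powr_Complex by measurable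
  have ae': "AE t in lborel. indicat_real {- T..T} t *\<^sub>R (H (Complex c t) * of_real (exp v) powr (- Complex c t))
      = indicat_real {- T..T} t *\<^sub>R (h0 t * of_real (exp v) powr (- Complex c t))"
    using ae by eventually_elim simp
  have "(LINT t:{- T..T}|lebesgue. H (Complex c t) * of_real (exp v) powr (- Complex c t))
     = (\<integral>t. indicat_real {- T..T} t *\<^sub>R (h0 t * of_real (exp v) powr (- Complex c t)) \<partial>lborel)"
    unfolding set_lebesgue_integral_def by (rule lebesgue_eq_lborel_AE(3)[OF m ae'])
  also have "\<dots> = (\<integral>t. of_real (exp (- c * v)) * (truncate_at h0 T t * cis (- (t * v))) \<partial>lborel)"
    unfolding exp_powr_Complex truncate_at_def by (simp add: mult_ac)
  also have "\<dots> = of_real (exp (- c * v)) * fourier (truncate_at h0 T) v"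
    unfolding fourier_def by (rule integral_mult_right_zero)
  finally show ?thesis unfolding inv_mellin_trunc_def by simp
qed

section \<open>The inverse Mellin transform and its Laplace-type integral\<close>

text \<open>
  The transforms of the truncations converge in \<open>L\<^sub>q\<close>, with the tails of \<open>h0\<close> as the rate.
\<close>

lemma inv_mellin_exists:
  assumes p: "1 < p" "p \<le> 2" and q: "q = p / (p - 1)"
    and hm[measurable]: "h0 \<in> borel_measurable borel" and hp: "integrable lborel (\<lambda>t. norm (h0 t) powr p)"
    and ae: "AE t in lborel. H (Complex c t) = h0 t"
  shows "\<exists>\<phi>. is_inv_mellin_in_mean c q H \<phi>"
proof -
  have q1: "q > 1" using p unfolding q by (simp add: field_simps)
  obtain \<psi> C where \<psi>[measurable]: "\<psi> \<in> borel_measurable borel" and C: "C \<ge> 0"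
    and b: "\<And>T. (\<integral>\<^sup>+u. ennreal (norm (fourier (truncate_at h0 T) u - \<psi> u) powr q) \<partial>lborel) \<le> ennreal (C * tail_power h0 p T powr (q - 1))"
  proof -
    have "\<exists>\<psi> C. \<psi> \<in> borel_measurable borel \<and> C \<ge> 0 \<and> (\<forall>T. (\<integral>\<^sup>+u. ennreal (norm (fourier (truncate_at h0 T) u - \<psi> u) powr q) \<partial>lborel) \<le> ennreal (C * tail_power h0 p T powr (q - 1)))"
      by (rule fourier_truncations_converge[OF p q hm hp], intro exI conjI allI)
    then show ?thesis using that by (elim exE conjE) simp
  qed
  define d where "d = (\<lambda>T u. fourier (truncate_at h0 T) u / of_real (2 * pi) - \<psi> u / of_real (2 * pi))"
  have dm[measurable]: "d T \<in> borel_measurable borel" for T unfolding d_def by measurable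
  have dn: "norm (d T u) powr q = norm (fourier (truncate_at h0 T) u - \<psi> u) powr q / (2 * pi) powr q" for T u
    unfolding d_def diff_divide_distrib[symmetric] norm_divide by (simp add: powr_divide norm_mult)
  have di0: "integrable lborel (\<lambda>u. norm (fourier (truncate_at h0 T) u - \<psi> u) powr q)" for T
  proof (rule integrableI_bounded)
    show "(\<integral>\<^sup>+u. ennreal (norm (norm (fourier (truncate_at h0 T) u - \<psi> u) powr q)) \<partial>lborel) < \<infinity>"
      using le_less_trans[OF b[of T] ennreal_less_top] by simp
  qed measurable
  have di: "integrable lborel (\<lambda>u. norm (d T u) powr q)" for T
    unfolding dn by (intro integrable_divide di0)
  have dle: "(\<integral>u. norm (d T u) powr q \<partial>lborel) \<le> C * tail_power h0 p T powr (q - 1) / (2 * pi) powr q" for T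
  proof -
    have "ennreal (\<integral>u. norm (fourier (truncate_at h0 T) u - \<psi> u) powr q \<partial>lborel) \<le> ennreal (C * tail_power h0 p T powr (q - 1))"
      using b[of T] by (subst nn_integral_eq_integral[OF di0, symmetric]) simp_all
    then have "(\<integral>u. norm (fourier (truncate_at h0 T) u - \<psi> u) powr q \<partial>lborel) \<le> C * tail_power h0 p T powr (q - 1)"
      using C by (subst (asm) ennreal_le_iff) auto
    then show ?thesis unfolding dn by (simp add: divide_right_mono)
  qed
  \<comment> \<open>A negative cut-off gives the zero function, so the bound on \<open>d\<close> there says that \<open>\<psi>\<close> lies in \<open>L\<^sub>q\<close>.\<close>
  have "truncate_at h0 (- 1) = (\<lambda>t. 0)" unfolding truncate_at_def by (simp add: indicator_def)
  then have "d (- 1) = (\<lambda>u. - (\<psi> u / of_real (2 * pi)))" unfolding d_def fourier_def by simp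
  then have \<psi>i: "integrable lborel (\<lambda>u. norm (\<psi> u / of_real (2 * pi)) powr q)" using di[of "- 1"] by simp
  define \<Phi> where "\<Phi> = (\<lambda>u. \<psi> u / complex_of_real (2 * pi))"
  have \<Phi>m[measurable]: "\<Phi> \<in> borel_measurable borel" unfolding \<Phi>_def by measurable
  define \<phi> where "\<phi> = (\<lambda>x. of_real (exp (- c * ln x)) * \<Phi> (ln x))"
  have \<phi>e: "\<phi> (exp v) = of_real (exp (- c * v)) * \<Phi> v" for v by (simp add: \<phi>_def)
  have q0: "q > 0" using q1 by simp
  have Fm: "(\<lambda>v. fourier (truncate_at h0 T) v / of_real (2 * pi)) \<in> borel_measurable borel" for T by measurable
  have Te: "inv_mellin_trunc c H T (exp v) = of_real (exp (- c * v)) * (fourier (truncate_at h0 T) v / of_real (2 * pi))" for T v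
    by (rule inv_mellin_trunc_exp[OF hm ae])
  have A: "\<phi> \<in> weighted_Lp c q"
    using weighted_Lp_log(1)[OF \<Phi>m _ q0, of \<phi> c] \<phi>e \<psi>i by (simp add: \<Phi>_def)
  have Fi: "integrable lborel (\<lambda>v. norm (fourier (truncate_at h0 T) v / of_real (2 * pi)) powr q)" for T
  proof -
    have "integrable lborel (\<lambda>v. norm (d T v - (- \<Phi> v)) powr q)"
      by (rule integrable_norm_diff_powr) (use di \<psi>i q0 in \<open>auto simp: \<Phi>_def\<close>)
    then show ?thesis by (simp add: d_def \<Phi>_def)
  qed
  have B: "inv_mellin_trunc c H T \<in> weighted_Lp c q" for T
    using weighted_Lp_log(1)[OF Fm _ q0, of "inv_mellin_trunc c H T" c T] Te Fi by simp
  have N: "weighted_Lp_norm c q (\<lambda>x. inv_mellin_trunc c H T x - \<phi> x) = (\<integral>v. norm (d T v) powr q \<partial>lborel) powr (1 / q)" for T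
    by (rule weighted_Lp_log(2)[OF dm _ q0]) (simp add: Te \<phi>e d_def \<Phi>_def right_diff_distrib)
  have "((\<lambda>T. \<integral>v. norm (d T v) powr q \<partial>lborel) \<longlongrightarrow> 0) at_top"
  proof (rule tendsto_sandwich[OF _ _ tendsto_const])
    show "\<forall>\<^sub>F T in at_top. 0 \<le> (\<integral>v. norm (d T v) powr q \<partial>lborel)"
      by (intro always_eventually allI Bochner_Integration.integral_nonneg) simp
    show "\<forall>\<^sub>F T in at_top. (\<integral>v. norm (d T v) powr q \<partial>lborel) \<le> C * tail_power h0 p T powr (q - 1) / (2 * pi) powr q"
      by (intro always_eventually allI dle)
    have "((\<lambda>T. tail_power h0 p T powr (q - 1)) \<longlongrightarrow> 0 powr (q - 1)) at_top"
      by (rule tendsto_powr'[OF tail_power_tendsto_0[OF hm hp] tendsto_const]) (use q1 tail_power_nonneg in \<open>auto intro: always_eventually\<close>)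
    then have "((\<lambda>T. C * tail_power h0 p T powr (q - 1) / (2 * pi) powr q) \<longlongrightarrow> C * 0 powr (q - 1) / (2 * pi) powr q) at_top"
      by (intro tendsto_divide tendsto_mult tendsto_const) auto
    then show "((\<lambda>T. C * tail_power h0 p T powr (q - 1) / (2 * pi) powr q) \<longlongrightarrow> 0) at_top" using q1 by simp
  qed
  then have "((\<lambda>T. (\<integral>v. norm (d T v) powr q \<partial>lborel) powr (1 / q)) \<longlongrightarrow> 0 powr (1 / q)) at_top"
    by (rule tendsto_powr'[OF _ tendsto_const]) (use q1 in \<open>auto intro!: always_eventually Bochner_Integration.integral_nonneg\<close>)
  then have "((\<lambda>T. weighted_Lp_norm c q (\<lambda>x. inv_mellin_trunc c H T x - \<phi> x)) \<longlongrightarrow> 0) at_top"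
    unfolding N using q1 by simp
  then show ?thesis unfolding is_inv_mellin_in_mean_def using A B by auto
qed

text \<open>
  An arbitrary inverse Mellin transform \<open>\<phi>\<close> is put into the logarithmic variable, along with the convergence
  that defines it; integer cut-offs suffice from here on.
\<close>

lemma inv_mellin_log:
  assumes q: "1 < q" and hm[measurable]: "h0 \<in> borel_measurable borel"
    and ae: "AE t in lborel. H (Complex c t) = h0 t"
    and \<phi>: "is_inv_mellin_in_mean c q H \<phi>"
  obtains \<Phi> where "\<Phi> \<in> borel_measurable borel" "AE v in lborel. \<phi> (exp v) = of_real (exp (- c * v)) * \<Phi> v"
    "integrable lborel (\<lambda>v. norm (\<Phi> v) powr q)"
    "\<forall>\<^sub>F n in sequentially. integrable lborel (\<lambda>v. norm (fourier (truncate_at h0 (real n)) v / of_real (2 * pi) - \<Phi> v) powr q)"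
    "(\<lambda>n. \<integral>v. norm (fourier (truncate_at h0 (real n)) v / of_real (2 * pi) - \<Phi> v) powr q \<partial>lborel) \<longlonglongrightarrow> 0"
proof -
  have q0: "q > 0" using q by simp
  have \<phi>1: "\<phi> \<in> weighted_Lp c q" and \<phi>2: "\<forall>\<^sub>F T in at_top. inv_mellin_trunc c H T \<in> weighted_Lp c q"
    and \<phi>3: "((\<lambda>T. weighted_Lp_norm c q (\<lambda>x. inv_mellin_trunc c H T x - \<phi> x)) \<longlongrightarrow> 0) at_top"
    using \<phi> unfolding is_inv_mellin_in_mean_def by auto
  have "set_borel_measurable lebesgue {0<..} \<phi>" using \<phi>1 by (simp add: weighted_Lp_def)
  then obtain G where G[measurable]: "G \<in> borel_measurable borel" and Gae: "AE v in lborel. \<phi> (exp v) = G v"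
    by (rule half_line_log_representative)
  define \<Phi> where "\<Phi> = (\<lambda>v. of_real (exp (c * v)) * G v)"
  have \<Phi>m[measurable]: "\<Phi> \<in> borel_measurable borel" unfolding \<Phi>_def by measurable
  have Gback: "of_real (exp (- c * v)) * \<Phi> v = G v" for v
    unfolding \<Phi>_def mult.assoc[symmetric] of_real_mult[symmetric] exp_add[symmetric] by simp
  have \<Phi>ae: "AE v in lborel. \<phi> (exp v) = of_real (exp (- c * v)) * \<Phi> v" unfolding Gback by (rule Gae)
  have \<Phi>i: "integrable lborel (\<lambda>v. norm (\<Phi> v) powr q)"
    using weighted_Lp_log(1)[OF \<Phi>m \<Phi>ae q0] \<phi>1 by simp
  define F where "F = (\<lambda>T v. fourier (truncate_at h0 T) v / complex_of_real (2 * pi))"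
  have Fm[measurable]: "F T \<in> borel_measurable borel" for T unfolding F_def by measurable
  have Te: "inv_mellin_trunc c H T (exp v) = of_real (exp (- c * v)) * F T v" for T v
    unfolding F_def by (rule inv_mellin_trunc_exp[OF hm ae])
  have top: "filterlim real at_top sequentially" by (rule filterlim_real_sequentially)
  have ev: "\<forall>\<^sub>F T in at_top. integrable lborel (\<lambda>v. norm (F T v - \<Phi> v) powr q)"
    using \<phi>2
  proof eventually_elim
    case (elim T)
    have "integrable lborel (\<lambda>v. norm (F T v) powr q)"
      using weighted_Lp_log(1)[OF Fm _ q0, of "inv_mellin_trunc c H T" c T] Te elim by simp
    then show ?case by (intro integrable_norm_diff_powr \<Phi>i) (use q in auto)
  qed
  have N: "weighted_Lp_norm c q (\<lambda>x. inv_mellin_trunc c H T x - \<phi> x) = (\<integral>v. norm (F T v - \<Phi> v) powr q \<partial>lborel) powr (1 / q)" for T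
  proof (rule weighted_Lp_log(2)[OF _ _ q0])
    show "AE v in lborel. inv_mellin_trunc c H T (exp v) - \<phi> (exp v) = of_real (exp (- c * v)) * (F T v - \<Phi> v)"
      using \<Phi>ae by eventually_elim (simp add: Te right_diff_distrib)
  qed measurable
  have lim: "((\<lambda>T. \<integral>v. norm (F T v - \<Phi> v) powr q \<partial>lborel) \<longlongrightarrow> 0) at_top"
    by (rule tendsto_powr_inverse_cancel[OF \<phi>3[unfolded N] q0]) (rule Bochner_Integration.integral_nonneg, simp)
  show ?thesis
  proof (rule that[OF \<Phi>m \<Phi>ae \<Phi>i])
    show "\<forall>\<^sub>F n in sequentially. integrable lborel (\<lambda>v. norm (fourier (truncate_at h0 (real n)) v / of_real (2 * pi) - \<Phi> v) powr q)"
      using eventually_compose_filterlim[OF ev top] unfolding F_def .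
    show "(\<lambda>n. \<integral>v. norm (fourier (truncate_at h0 (real n)) v / of_real (2 * pi) - \<Phi> v) powr q \<partial>lborel) \<longlonglongrightarrow> 0"
      using filterlim_compose[OF lim top] unfolding F_def .
  qed
qed

text \<open>
  The function \<open>x\<^bsup>\<nu>\<^esup> exp (- x/y)\<close> in the variables \<open>y = exp u\<close> and \<open>x = exp v\<close>.
\<close>

definition laplace_weight :: "real \<Rightarrow> real \<Rightarrow> real \<Rightarrow> real" where
  "laplace_weight \<nu> u v = exp (\<nu> * v - exp (v - u))"

lemma measurable_laplace_weight [measurable]: "laplace_weight \<nu> u \<in> borel_measurable borel"
  unfolding laplace_weight_def by measurable

lemma laplace_weight_pos: "0 < laplace_weight \<nu> u v" by (simp add: laplace_weight_def)

lemma laplace_weight_le: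
  assumes "0 < \<nu>" "\<nu> < 1"
  shows "laplace_weight \<nu> u v \<le> exp (\<nu> * u)"
proof -
  \<comment> \<open>In terms of \<open>t = x/y\<close> this is \<open>t\<^bsup>\<nu>\<^esup> exp (- t) \<le> 1\<close>.\<close>
  have "\<nu> * (v - u) \<le> exp (v - u)"
  proof (cases "v \<ge> u")
    case True
    have "\<nu> * (v - u) \<le> 1 * (v - u)" using assms True by (intro mult_right_mono) auto
    also have "\<dots> \<le> 1 + (v - u)" by simp
    also have "\<dots> \<le> exp (v - u)" by (rule exp_ge_add_one_self)
    finally show ?thesis .
  next
    case False
    then have "\<nu> * (v - u) \<le> 0" using assms by (intro mult_nonneg_nonpos) auto
    also have "0 \<le> exp (v - u)" by simp
    finally show ?thesis .
  qed
  then show ?thesis unfolding laplace_weight_def by (simp add: algebra_simps)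
qed

lemma laplace_weight_integral:
  assumes "0 < \<nu>"
  shows "integrable lborel (laplace_weight \<nu> u)" and "(\<integral>v. laplace_weight \<nu> u v \<partial>lborel) = Gamma \<nu> * exp (\<nu> * u)"
proof -
  have eq: "laplace_weight \<nu> u = (\<lambda>v. exp (\<nu> * v - exp (- u) * exp v))"
    by (rule ext) (simp add: laplace_weight_def exp_add[symmetric])
  show "integrable lborel (laplace_weight \<nu> u)" unfolding eq by (rule gamma_weight_integral_real) (use assms in auto)
  have "(\<integral>v. laplace_weight \<nu> u v \<partial>lborel) = Gamma \<nu> * exp (- u) powr (- \<nu>)"
    unfolding eq by (rule gamma_weight_integral_real) (use assms in auto)
  then show "(\<integral>v. laplace_weight \<nu> u v \<partial>lborel) = Gamma \<nu> * exp (\<nu> * u)" by (simp add: exp_powr_real mult.commute)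
qed

lemma laplace_weight_cis_integral:
  assumes "0 < \<nu>"
  shows "(\<integral>v. of_real (laplace_weight \<nu> u v) * cis (- (t * v)) \<partial>lborel) = of_real (exp (\<nu> * u)) * (Gamma (Complex \<nu> (- t)) * cis (- (t * u)))"
proof -
  define z where "z = Complex \<nu> (- t)"
  have eq: "of_real (laplace_weight \<nu> u v) * cis (- (t * v)) = gamma_weight (exp (- u)) z v" for v
  proof -
    have "z * of_real v - of_real (exp (- u) * exp v) = of_real (\<nu> * v - exp (v - u)) + \<i> * of_real (- (t * v))"
      by (simp add: z_def complex_eq_iff exp_add[symmetric])
    then show ?thesis unfolding gamma_weight_def laplace_weight_def cis_conv_exp by (simp only: exp_add exp_of_real)
  qed
  have "(\<integral>v. gamma_weight (exp (- u)) z v \<partial>lborel) = Gamma z * of_real (exp (- u)) powr (- z)"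
    by (rule gamma_weight_integral(2)) (use assms in \<open>auto simp: z_def\<close>)
  also have "complex_of_real (exp (- u)) powr (- z) = of_real (exp (\<nu> * u)) * cis (- (t * u))"
    unfolding z_def exp_powr_Complex by simp
  finally show ?thesis unfolding eq z_def by (simp add: mult_ac)
qed

text \<open>
  The Laplace-type integral acts on each exponential as multiplication by a value of \<open>\<Gamma>\<close> and by \<open>exp (\<nu> u)\<close>.
\<close>

lemma laplace_of_fourier:
  assumes \<nu>: "0 < \<nu>" and hm[measurable]: "h \<in> borel_measurable borel" and h: "integrable lborel h"
  shows "(\<integral>v. of_real (laplace_weight \<nu> u v) * fourier h v \<partial>lborel) = of_real (exp (\<nu> * u)) * fourier (\<lambda>t. h t * Gamma (Complex \<nu> (- t))) u"
proof -
  have "(\<integral>v. of_real (laplace_weight \<nu> u v) * fourier h v \<partial>lborel) = (\<integral>v. (\<integral>t. h t * (of_real (laplace_weight \<nu> u v) * cis (- (t * v))) \<partial>lborel) \<partial>lborel)"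
    unfolding fourier_def integral_mult_right_zero[symmetric] by (simp only: mult.left_commute)
  also have "\<dots> = (\<integral>t. (\<integral>v. h t * (of_real (laplace_weight \<nu> u v) * cis (- (t * v))) \<partial>lborel) \<partial>lborel)"
  proof (rule lborel_pair.Fubini_integral)
    have "integrable (lborel \<Otimes>\<^sub>M lborel) (\<lambda>(t, v). norm (h t) * laplace_weight \<nu> u v)"
      by (rule integrable_tensor_product) (use h laplace_weight_integral(1)[OF \<nu>] in auto)
    then show "integrable (lborel \<Otimes>\<^sub>M lborel) (\<lambda>(t, v). h t * (of_real (laplace_weight \<nu> u v) * cis (- (t * v))))"
    proof (rule Bochner_Integration.integrable_bound)
      show "(\<lambda>(t, v). h t * (of_real (laplace_weight \<nu> u v) * cis (- (t * v)))) \<in> borel_measurable (lborel \<Otimes>\<^sub>M lborel)" by measurable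
      show "AE x in lborel \<Otimes>\<^sub>M lborel. norm (case x of (t, v) \<Rightarrow> h t * (of_real (laplace_weight \<nu> u v) * cis (- (t * v)))) \<le> norm (case x of (t, v) \<Rightarrow> norm (h t) * laplace_weight \<nu> u v)"
        by (rule AE_I2) (simp add: norm_mult split_beta)
    qed
  qed
  also have "\<dots> = (\<integral>t. of_real (exp (\<nu> * u)) * (h t * Gamma (Complex \<nu> (- t)) * cis (- (t * u))) \<partial>lborel)"
  proof (rule Bochner_Integration.integral_cong[OF refl])
    fix t
    show "(\<integral>v. h t * (of_real (laplace_weight \<nu> u v) * cis (- (t * v))) \<partial>lborel) = of_real (exp (\<nu> * u)) * (h t * Gamma (Complex \<nu> (- t)) * cis (- (t * u)))"
      unfolding integral_mult_right_zero laplace_weight_cis_integral[OF \<nu>] by (simp only: mult.assoc mult.left_commute)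
  qed
  also have "\<dots> = of_real (exp (\<nu> * u)) * fourier (\<lambda>t. h t * Gamma (Complex \<nu> (- t))) u"
    unfolding fourier_def by (rule integral_mult_right_zero)
  finally show ?thesis .
qed

lemma measurable_Gamma_line [measurable]:
  assumes "0 < \<nu>"
  shows "(\<lambda>t. Gamma (Complex \<nu> (- t))) \<in> borel_measurable borel"
proof (rule borel_measurable_continuous_onI)
  have eq: "(\<lambda>t. Gamma (Complex \<nu> (- t))) = (\<lambda>t. Gamma (of_real \<nu> - \<i> * of_real t))" by (simp add: Complex_eq)
  have "of_real \<nu> - \<i> * of_real t \<notin> \<int>\<^sub>\<le>\<^sub>0" for t
    using assms by (auto elim!: nonpos_Ints_cases simp: complex_eq_iff)
  then have np: "(\<lambda>t. of_real \<nu> - \<i> * of_real t) ` UNIV \<subseteq> - \<int>\<^sub>\<le>\<^sub>0" by auto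
  have c: "continuous_on UNIV (\<lambda>t. of_real \<nu> - \<i> * of_real t)" by (intro continuous_intros)
  have "continuous_on (- \<int>\<^sub>\<le>\<^sub>0) (Gamma :: complex \<Rightarrow> complex)" by (rule continuous_on_Gamma) auto
  from continuous_on_compose2[OF this c np] show "continuous_on UNIV (\<lambda>t. Gamma (Complex \<nu> (- t)))" unfolding eq .
qed

text \<open>
  The decay of \<open>\<Gamma>\<close> on the line makes it an element of every \<open>L\<^sub>q\<close>. This is where the Mellin transform of \<open>f\<close>
  becomes integrable.
\<close>

lemma integrable_mult_Gamma_line:
  assumes \<nu>: "0 < \<nu>" "\<nu> \<le> 1" and hm[measurable]: "h \<in> borel_measurable borel" and p: "1 \<le> p"
    and hp: "integrable lborel (\<lambda>t. norm (h t) powr p)"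
  shows "integrable lborel (\<lambda>t. h t * Gamma (Complex \<nu> (- t)))"
proof -
  define K where "K = Gamma (\<nu> + 2) / \<nu>\<^sup>2"
  have K: "K \<ge> 0" unfolding K_def using \<nu> Gamma_real_pos[of "\<nu> + 2"] by simp
  define w where "w = (\<lambda>t::real. K * inverse (1 + t\<^sup>2))"
  have "integrable lborel (\<lambda>t. w t * norm (h t))"
  proof (rule integrable_weight_mult(1)[OF hm p hp])
    show "integrable lborel w" unfolding w_def by (intro integrable_mult_right integrable_inverse_one_plus_square)
    show "0 \<le> w t" for t using K by (simp add: w_def)
    show "w t \<le> K" for t unfolding w_def using K by (intro mult_left_le) (auto simp: inverse_le_1_iff add_pos_nonneg)
  qed
  then show ?thesis
  proof (rule Bochner_Integration.integrable_bound)
    show "(\<lambda>t. h t * Gamma (Complex \<nu> (- t))) \<in> borel_measurable lborel" using \<nu> by measurable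
    show "AE t in lborel. norm (h t * Gamma (Complex \<nu> (- t))) \<le> norm (w t * norm (h t))"
    proof (rule AE_I2)
      fix t
      have "norm (Gamma (Complex \<nu> (- t))) \<le> w t" using norm_Gamma_decay[OF \<nu>, of "- t"] by (simp add: w_def K_def)
      then have "norm (h t * Gamma (Complex \<nu> (- t))) \<le> w t * norm (h t)"
        unfolding norm_mult by (subst mult.commute) (rule mult_right_mono, auto)
      then show "norm (h t * Gamma (Complex \<nu> (- t))) \<le> norm (w t * norm (h t))"
        unfolding real_norm_def by (rule order_trans[OF _ abs_ge_self])
    qed
  qed
qed

text \<open>
  In the original variables this is \<open>(1/y) \<integral> exp (- x/y) \<phi>(x) dx = f(y)\<close>, with the right-hand side
  represented by its inverse Mellin integral. For a cut-off inverse transform it is the exchange of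
  integrals in the preceding lemmas. The left-hand side passes to the limit because the weight is bounded
  and integrable in \<open>v\<close>, the right-hand side because \<open>h0\<close> times \<open>\<Gamma>\<close> is integrable.
\<close>

lemma laplace_of_inv_mellin:
  assumes \<nu>: "0 < \<nu>" "\<nu> < 1" and p: "1 \<le> p" and q: "1 \<le> q"
    and hm[measurable]: "h0 \<in> borel_measurable borel" and hp: "integrable lborel (\<lambda>t. norm (h0 t) powr p)"
    and \<Phi>m[measurable]: "\<Phi> \<in> borel_measurable borel" and \<Phi>: "integrable lborel (\<lambda>v. norm (\<Phi> v) powr q)"
    and ev: "\<forall>\<^sub>F n in sequentially. integrable lborel (\<lambda>v. norm (fourier (truncate_at h0 (real n)) v / of_real (2 * pi) - \<Phi> v) powr q)"
    and lim: "(\<lambda>n. \<integral>v. norm (fourier (truncate_at h0 (real n)) v / of_real (2 * pi) - \<Phi> v) powr q \<partial>lborel) \<longlonglongrightarrow> 0"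
  shows "(\<integral>v. of_real (laplace_weight \<nu> u v) * \<Phi> v \<partial>lborel) = of_real (exp (\<nu> * u)) * (fourier (\<lambda>t. h0 t * Gamma (Complex \<nu> (- t))) u / of_real (2 * pi))"
proof -
  define F where "F = (\<lambda>n v. fourier (truncate_at h0 (real n)) v / complex_of_real (2 * pi))"
  have Fm[measurable]: "F n \<in> borel_measurable borel" for n unfolding F_def by measurable
  have hi: "integrable lborel (truncate_at h0 T)" for T by (rule integrable_truncate_at[OF hm hp p])
  note w = laplace_weight_integral(1)[OF \<nu>(1), of u] less_imp_le[OF laplace_weight_pos] laplace_weight_le[OF \<nu>]
  have wm: "laplace_weight \<nu> u \<in> borel_measurable lborel" by simp
  have i\<Phi>: "integrable lborel (\<lambda>v. of_real (laplace_weight \<nu> u v) * \<Phi> v)"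
    by (rule Bochner_Integration.integrable_bound[OF integrable_weight_mult(1)[OF \<Phi>m q \<Phi> w]])
       (auto simp: norm_mult)
  have iF: "integrable lborel (\<lambda>v. of_real (laplace_weight \<nu> u v) * F n v)" for n
  proof (rule Bochner_Integration.integrable_bound)
    define M where "M = (\<integral>t. norm (truncate_at h0 (real n) t) \<partial>lborel) / (2 * pi)"
    show "integrable lborel (\<lambda>v. M * laplace_weight \<nu> u v)" by (intro integrable_mult_right w(1))
    have "norm (F n v) \<le> M" for v
      unfolding F_def M_def norm_divide using norm_fourier_le[of "truncate_at h0 (real n)" v] by (simp add: divide_right_mono)
    then have "norm (of_real (laplace_weight \<nu> u v) * F n v) \<le> M * laplace_weight \<nu> u v" for v
      unfolding norm_mult norm_of_real using w(2)[of \<nu> u v] by (subst mult.commute) (simp add: mult_right_mono)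
    then show "AE v in lborel. norm (of_real (laplace_weight \<nu> u v) * F n v) \<le> norm (M * laplace_weight \<nu> u v)"
      unfolding real_norm_def by (intro AE_I2) (rule order_trans[OF _ abs_ge_self])
  qed measurable
  have vanish: "(\<lambda>n. \<integral>v. laplace_weight \<nu> u v * norm (F n v - \<Phi> v) \<partial>lborel) \<longlonglongrightarrow> 0"
    by (rule weighted_integral_tendsto_0[OF _ q _ _ w]) (use ev lim in \<open>auto simp: F_def\<close>)
  have "(\<lambda>n. (\<integral>v. of_real (laplace_weight \<nu> u v) * F n v \<partial>lborel) - (\<integral>v. of_real (laplace_weight \<nu> u v) * \<Phi> v \<partial>lborel)) \<longlonglongrightarrow> 0"
  proof (rule Lim_null_comparison[OF _ vanish], rule always_eventually, rule allI)
    fix n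
    have "(\<integral>v. of_real (laplace_weight \<nu> u v) * F n v \<partial>lborel) - (\<integral>v. of_real (laplace_weight \<nu> u v) * \<Phi> v \<partial>lborel)
       = (\<integral>v. of_real (laplace_weight \<nu> u v) * (F n v - \<Phi> v) \<partial>lborel)"
      unfolding right_diff_distrib by (rule Bochner_Integration.integral_diff[symmetric, OF iF i\<Phi>])
    also have "norm \<dots> \<le> (\<integral>v. norm (of_real (laplace_weight \<nu> u v) * (F n v - \<Phi> v)) \<partial>lborel)" by (rule integral_norm_bound)
    finally show "norm ((\<integral>v. of_real (laplace_weight \<nu> u v) * F n v \<partial>lborel) - (\<integral>v. of_real (laplace_weight \<nu> u v) * \<Phi> v \<partial>lborel)) \<le> (\<integral>v. laplace_weight \<nu> u v * norm (F n v - \<Phi> v) \<partial>lborel)"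
      unfolding norm_mult norm_of_real abs_of_pos[OF laplace_weight_pos] .
  qed
  then have L: "(\<lambda>n. \<integral>v. of_real (laplace_weight \<nu> u v) * F n v \<partial>lborel) \<longlonglongrightarrow> (\<integral>v. of_real (laplace_weight \<nu> u v) * \<Phi> v \<partial>lborel)"
    by (simp add: LIM_zero_iff)
  define g where "g = (\<lambda>t. h0 t * Gamma (Complex \<nu> (- t)))"
  have gm: "g \<in> borel_measurable borel" unfolding g_def using \<nu> by measurable
  have gi: "integrable lborel g" unfolding g_def by (rule integrable_mult_Gamma_line[OF _ _ hm p hp]) (use \<nu> in auto)
  have "(\<integral>v. of_real (laplace_weight \<nu> u v) * F n v \<partial>lborel) = of_real (exp (\<nu> * u)) * (fourier (truncate_at g (real n)) u / of_real (2 * pi))" for n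
  proof -
    have tg: "(\<lambda>t. truncate_at h0 (real n) t * Gamma (Complex \<nu> (- t))) = truncate_at g (real n)"
      by (rule ext) (simp add: truncate_at_def g_def)
    have "(\<integral>v. of_real (laplace_weight \<nu> u v) * F n v \<partial>lborel) = (\<integral>v. of_real (laplace_weight \<nu> u v) * fourier (truncate_at h0 (real n)) v \<partial>lborel) / of_real (2 * pi)"
      unfolding F_def times_divide_eq_right by (rule integral_divide_zero)
    also have "(\<integral>v. of_real (laplace_weight \<nu> u v) * fourier (truncate_at h0 (real n)) v \<partial>lborel) = of_real (exp (\<nu> * u)) * fourier (truncate_at g (real n)) u"
      using laplace_of_fourier[OF \<nu>(1) _ hi, of "real n" u] unfolding tg by simp
    finally show ?thesis by simp
  qed
  moreover have "(\<lambda>n. fourier (truncate_at g (real n)) u) \<longlonglongrightarrow> fourier g u"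
    unfolding fourier_def
  proof (rule integral_dominated_convergence[OF _ _ integrable_norm[OF gi]])
    show "(\<lambda>t. g t * cis (- (t * u))) \<in> borel_measurable lborel" using gm by measurable
    show "(\<lambda>t. truncate_at g (real n) t * cis (- (t * u))) \<in> borel_measurable lborel" for n using gm by measurable
    show "AE t in lborel. (\<lambda>n. truncate_at g (real n) t * cis (- (t * u))) \<longlonglongrightarrow> g t * cis (- (t * u))"
    proof (rule AE_I2)
      fix t :: real
      obtain N :: nat where N: "\<bar>t\<bar> \<le> real N" using real_arch_simple by blast
      have "\<forall>\<^sub>F n in sequentially. truncate_at g (real n) t * cis (- (t * u)) = g t * cis (- (t * u))"
        using eventually_ge_at_top[of N]
      proof eventually_elim
        case (elim n)
        then have "t \<in> {- real n..real n}" using N by auto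
        then show ?case by (simp add: truncate_at_def)
      qed
      then show "(\<lambda>n. truncate_at g (real n) t * cis (- (t * u))) \<longlonglongrightarrow> g t * cis (- (t * u))" by (rule tendsto_eventually)
    qed
    show "AE t in lborel. norm (truncate_at g (real n) t * cis (- (t * u))) \<le> norm (g t)" for n
      by (rule AE_I2) (simp add: truncate_at_def norm_mult split: split_indicator)
  qed
  ultimately have "(\<lambda>n. \<integral>v. of_real (laplace_weight \<nu> u v) * F n v \<partial>lborel) \<longlonglongrightarrow> of_real (exp (\<nu> * u)) * (fourier g u / of_real (2 * pi))"
    by (simp only:) (intro tendsto_intros, auto)
  from LIMSEQ_unique[OF L this] show ?thesis unfolding g_def .
qed

section \<open>The index transform as a Lebedev transform\<close>

text \<open>
  Completion of the square in the exponent.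
\<close>

lemma exp_times_gauss_kernel_le:
  assumes e: "0 < e"
  shows "exp (- \<nu> * u) * gauss_kernel e (u - a) \<le> exp (- \<nu> * a + (\<nu> * e)\<^sup>2 / 2) / (e * sqrt (2 * pi))"
proof -
  define z where "z = (u - a) / e"
  have u: "u = a + e * z" using e by (simp add: z_def)
  have "0 \<le> (z + \<nu> * e)\<^sup>2" by simp
  then have "- \<nu> * u + - z\<^sup>2 / 2 \<le> - \<nu> * a + (\<nu> * e)\<^sup>2 / 2"
    unfolding u by (simp add: power2_eq_square algebra_simps)
  then have "exp (- \<nu> * u) * exp (- z\<^sup>2 / 2) \<le> exp (- \<nu> * a + (\<nu> * e)\<^sup>2 / 2)"
    unfolding exp_add[symmetric] by simp
  then have "exp (- \<nu> * u) * exp (- z\<^sup>2 / 2) / (e * sqrt (2 * pi)) \<le> exp (- \<nu> * a + (\<nu> * e)\<^sup>2 / 2) / (e * sqrt (2 * pi))"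
    using e by (intro divide_right_mono) auto
  then show ?thesis unfolding gauss_kernel_def z_def by simp
qed

lemma exp_powr_mellin: "complex_of_real (exp u) powr (Complex (1 - \<nu>) t - 1) = of_real (exp (- \<nu> * u)) * cis (t * u)"
proof -
  have "Complex (1 - \<nu>) t - 1 = - Complex \<nu> (- t)" by (simp add: complex_eq_iff)
  then show ?thesis using exp_powr_Complex[of u \<nu> "- t"] by simp
qed

lemma mellin_trunc_log:
  assumes G[measurable]: "G \<in> borel_measurable borel" and ae: "AE u in lborel. f (exp u) = G u"
  shows "mellin_trunc f (exp A) (Complex (1 - \<nu>) t) = (\<integral>u. truncate_at (\<lambda>u. of_real (exp (- \<nu> * u)) * (exp u *\<^sub>R G u)) A u * cis (t * u) \<partial>lborel)"
proof -
  define s where "s = Complex (1 - \<nu>) t"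
  define G' where "G' = (\<lambda>u. indicat_real {- A..A} u *\<^sub>R (G u * (of_real (exp (- \<nu> * u)) * cis (t * u))))"
  have G'm: "G' \<in> borel_measurable borel" unfolding G'_def by measurable
  have ind: "indicat_real {1 / exp A..exp A} (exp u) = indicat_real {- A..A} u" for u
  proof -
    have "1 / exp A \<le> exp u \<longleftrightarrow> - A \<le> u" by (simp add: exp_minus[symmetric] inverse_eq_divide[symmetric])
    then show ?thesis by (simp add: indicator_def)
  qed
  have ae': "AE u in lborel. indicat_real {1 / exp A..exp A} (exp u) *\<^sub>R (f (exp u) * of_real (exp u) powr (s - 1)) = G' u"
    using ae by eventually_elim (simp only: ind G'_def s_def exp_powr_mellin)
  have "mellin_trunc f (exp A) s = (LINT x:{0<..}|lebesgue. indicat_real {1 / exp A..exp A} x *\<^sub>R (f x * of_real x powr (s - 1)))"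
    unfolding mellin_trunc_def set_lebesgue_integral_def
  proof (rule Bochner_Integration.integral_cong[OF refl])
    fix x :: real
    have "x \<in> {1 / exp A..exp A} \<Longrightarrow> x > 0" by (auto intro: less_le_trans[of _ "1 / exp A"])
    then show "indicat_real {1 / exp A..exp A} x *\<^sub>R (f x * of_real x powr (s - 1)) = indicat_real {0<..} x *\<^sub>R (indicat_real {1 / exp A..exp A} x *\<^sub>R (f x * of_real x powr (s - 1)))"
      by (auto simp: indicator_def)
  qed
  also have "\<dots> = (\<integral>u. exp u *\<^sub>R G' u \<partial>lborel)" by (rule half_line_integral_log(2)[OF G'm ae'])
  also have "\<dots> = (\<integral>u. truncate_at (\<lambda>u. of_real (exp (- \<nu> * u)) * (exp u *\<^sub>R G u)) A u * cis (t * u) \<partial>lborel)"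
    by (rule Bochner_Integration.integral_cong[OF refl]) (simp add: G'_def truncate_at_def scaleR_conv_of_real)
  finally show ?thesis unfolding s_def .
qed

text \<open>
  This supplies the hypothesis \<open>smooth\<close> of \<open>inversion_against_kernel\<close>. If the Mellin integral converges
  absolutely, \<open>f\<close> is integrable with the weight of the line and Parseval's relation applies directly. If it
  converges in the mean, the relation holds for the part of \<open>f\<close> on \<open>[exp (- n), exp n]\<close>; the Gaussian factor on
  the spectral side turns convergence in the mean into convergence of the integrals, and on the other side
  the integrability of \<open>f\<close> without weight suffices, because the Gaussian dominates the weight
  \<open>exp (- \<nu> u)\<close>.
\<close>

lemma mellin_gauss_smoothing:
  assumes G[measurable]: "G \<in> borel_measurable borel" and ae: "AE u in lborel. f (exp u) = G u"
    and f1: "integrable lborel (\<lambda>u. exp u *\<^sub>R G u)"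
    and mel: "is_mellin_transform f (1 - \<nu>) fs"
    and gm[measurable]: "g \<in> borel_measurable borel" and g: "integrable lborel g"
    and gae: "AE t in lborel. fs (Complex (1 - \<nu>) t) = g t"
    and \<nu>: "0 < \<nu>" and e: "0 < e"
  shows "(\<integral>u. (exp u *\<^sub>R G u) * of_real (exp (- \<nu> * u) * gauss_kernel e (u - a)) \<partial>lborel)
     = (\<integral>t. g t * (of_real (exp (- (e * t)\<^sup>2 / 2)) * cis (- (t * a))) \<partial>lborel) / of_real (2 * pi)"
proof -
  define F where "F = (\<lambda>u. of_real (exp (- \<nu> * u)) * (exp u *\<^sub>R G u))"
  have Fm[measurable]: "F \<in> borel_measurable borel" unfolding F_def by measurable
  define w where "w = (\<lambda>t. exp (- (e * t)\<^sup>2 / 2))"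
  have wm[measurable]: "w \<in> borel_measurable borel" unfolding w_def by measurable
  have w1: "0 \<le> w t" "w t \<le> 1" for t by (auto simp: w_def)
  have wi: "integrable lborel w"
  proof -
    have "w = (\<lambda>t. exp (- (t / (1 / e))\<^sup>2 / 2))" unfolding w_def by (simp add: mult.commute)
    then show ?thesis using integral_gaussian(1)[of "1 / e"] e by simp
  qed
  define W where "W = (\<lambda>t. complex_of_real (w t) * cis (- (t * a)))"
  have Wm[measurable]: "W \<in> borel_measurable borel" unfolding W_def by measurable
  have nW: "norm (W t) = w t" for t using w1(1)[of t] by (simp add: W_def norm_mult)
  have lhs: "(exp u *\<^sub>R G u) * of_real (exp (- \<nu> * u) * gauss_kernel e (u - a)) = F u * of_real (gauss_kernel e (u - a))" for u
    unfolding F_def of_real_mult by (simp only: mult_ac)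
  have pv: "(\<integral>u. F' u * of_real (gauss_kernel e (u - a)) \<partial>lborel) = (\<integral>t. (\<integral>u. F' u * cis (t * u) \<partial>lborel) * W t \<partial>lborel) / of_real (2 * pi)"
    if "F' \<in> borel_measurable borel" "integrable lborel F'" for F'
    unfolding W_def w_def by (rule gauss_kernel_parseval[OF that e])
  have "(\<integral>u. F u * of_real (gauss_kernel e (u - a)) \<partial>lborel) = (\<integral>t. g t * W t \<partial>lborel) / of_real (2 * pi)"
    using mel unfolding is_mellin_transform_def
  proof (elim disjE conjE exE)
    \<comment> \<open>Absolute convergence of the Mellin integral.\<close>
    assume abs: "\<forall>s. Re s = 1 - \<nu> \<longrightarrow> set_integrable lebesgue {0<..} (\<lambda>x. f x * of_real x powr (s - 1)) \<and>
        fs s = (LINT x:{0<..}|lebesgue. f x * of_real x powr (s - 1))"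
    have FI: "integrable lborel (\<lambda>u. F u * cis (t * u)) \<and> fs (Complex (1 - \<nu>) t) = (\<integral>u. F u * cis (t * u) \<partial>lborel)" for t
    proof -
      define G' where "G' = (\<lambda>u. G u * (of_real (exp (- \<nu> * u)) * cis (t * u)))"
      have G'm: "G' \<in> borel_measurable borel" unfolding G'_def by measurable
      have ae': "AE u in lborel. f (exp u) * of_real (exp u) powr (Complex (1 - \<nu>) t - 1) = G' u"
        using ae by eventually_elim (simp only: G'_def exp_powr_mellin)
      have "exp u *\<^sub>R G' u = F u * cis (t * u)" for u by (simp add: G'_def F_def scaleR_conv_of_real)
      then show ?thesis
        using half_line_integral_log(1,2)[of G' "\<lambda>x. f x * of_real x powr (Complex (1 - \<nu>) t - 1)", OF G'm ae'] abs by simp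
    qed
    have Fi: "integrable lborel F" using FI[of 0] by simp
    have "(\<integral>t. (\<integral>u. F u * cis (t * u) \<partial>lborel) * W t \<partial>lborel) = (\<integral>t. g t * W t \<partial>lborel)"
    proof (rule integral_cong_AE)
      show "AE t in lborel. (\<integral>u. F u * cis (t * u) \<partial>lborel) * W t = g t * W t"
        using gae by eventually_elim (use FI in simp)
    qed measurable
    then show ?thesis unfolding pv[OF Fm Fi] by simp
  next
    \<comment> \<open>Convergence in the mean of order \<open>r\<close>.\<close>
    fix r :: real
    assume r: "1 \<le> r" and fsL: "fs \<in> line_Lp (1 - \<nu>) r"
      and mL: "\<forall>\<^sub>F a in at_top. mellin_trunc f a \<in> line_Lp (1 - \<nu>) r"
      and mN: "((\<lambda>a. line_Lp_norm (1 - \<nu>) r (\<lambda>s. mellin_trunc f a s - fs s)) \<longlongrightarrow> 0) at_top"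
    define Fn where "Fn = (\<lambda>n::nat. truncate_at F (real n))"
    have Fnm[measurable]: "Fn n \<in> borel_measurable borel" for n unfolding Fn_def by measurable
    have Fni: "integrable lborel (Fn n)" for n
    proof (rule Bochner_Integration.integrable_bound)
      show "integrable lborel (\<lambda>u. exp (\<nu> * real n) * norm (exp u *\<^sub>R G u))" using f1 by (intro integrable_mult_right integrable_norm)
      show "AE u in lborel. norm (Fn n u) \<le> norm (exp (\<nu> * real n) * norm (exp u *\<^sub>R G u))"
      proof (rule AE_I2)
        fix u
        show "norm (Fn n u) \<le> norm (exp (\<nu> * real n) * norm (exp u *\<^sub>R G u))"
        proof (cases "u \<in> {- real n..real n}")
          case True
          then have "\<nu> * - u \<le> \<nu> * real n" using \<nu> by (intro mult_left_mono) auto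
          then have "exp (- \<nu> * u) \<le> exp (\<nu> * real n)" by simp
          then have "exp (- \<nu> * u) * norm (exp u *\<^sub>R G u) \<le> exp (\<nu> * real n) * norm (exp u *\<^sub>R G u)" by (rule mult_right_mono) simp
          then show ?thesis using True by (simp add: Fn_def truncate_at_def F_def norm_mult)
        qed (simp add: Fn_def truncate_at_def)
      qed
    qed measurable
    define m where "m = (\<lambda>n t. \<integral>u. Fn n u * cis (t * u) \<partial>lborel)"
    have mm[measurable]: "m n \<in> borel_measurable borel" for n unfolding m_def by measurable
    have mt: "mellin_trunc f (exp (real n)) (Complex (1 - \<nu>) t) = m n t" for n t
      unfolding m_def Fn_def F_def by (rule mellin_trunc_log[OF G ae])
    define D where "D = (\<lambda>n t. m n t - g t)"
    have Dm[measurable]: "D n \<in> borel_measurable borel" for n unfolding D_def by measurable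
    have top: "filterlim (\<lambda>n::nat. exp (real n)) at_top sequentially" by real_asymp
    have gr: "integrable lborel (\<lambda>t. norm (g t) powr r)"
    proof -
      have "AE t in lborel. norm (fs (Complex (1 - \<nu>) t)) powr r = norm (g t) powr r" using gae by eventually_elim simp
      then show ?thesis using lebesgue_eq_lborel_AE(2)[of "\<lambda>t. norm (g t) powr r" "\<lambda>t. norm (fs (Complex (1 - \<nu>) t)) powr r"] fsL
        by (simp add: line_Lp_def)
    qed
    have Dr: "\<forall>\<^sub>F n in sequentially. integrable lborel (\<lambda>t. norm (D n t) powr r)"
      using eventually_compose_filterlim[OF mL top]
    proof eventually_elim
      case (elim n)
      then have "integrable lebesgue (\<lambda>t. norm (m n t) powr r)" by (simp add: line_Lp_def mt)
      then have "integrable lborel (\<lambda>t. norm (m n t) powr r)" by (subst (asm) integrable_completion) simp_all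
      then show ?case unfolding D_def using r by (intro integrable_norm_diff_powr gr) auto
    qed
    have "line_Lp_norm (1 - \<nu>) r (\<lambda>s. mellin_trunc f (exp (real n)) s - fs s) = (\<integral>t. norm (D n t) powr r \<partial>lborel) powr (1 / r)" for n
    proof -
      have "AE t in lborel. norm (m n t - fs (Complex (1 - \<nu>) t)) powr r = norm (D n t) powr r"
        using gae by eventually_elim (simp add: D_def)
      then show ?thesis unfolding line_Lp_norm_def mt
        using lebesgue_eq_lborel_AE(3)[of "\<lambda>t. norm (D n t) powr r" "\<lambda>t. norm (m n t - fs (Complex (1 - \<nu>) t)) powr r"] by simp
    qed
    then have "(\<lambda>n. (\<integral>t. norm (D n t) powr r \<partial>lborel) powr (1 / r)) \<longlonglongrightarrow> 0"
      using filterlim_compose[OF mN top] by simp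
    then have D0: "(\<lambda>n. \<integral>t. norm (D n t) powr r \<partial>lborel) \<longlonglongrightarrow> 0"
      by (rule tendsto_powr_inverse_cancel) (use r in \<open>auto intro: Bochner_Integration.integral_nonneg\<close>)
    have van: "(\<lambda>n. \<integral>t. w t * norm (D n t) \<partial>lborel) \<longlonglongrightarrow> 0"
      by (rule weighted_integral_tendsto_0[OF Dm r Dr D0 wi w1])
    have gW: "integrable lborel (\<lambda>t. g t * W t)"
      by (rule Bochner_Integration.integrable_bound[OF g]) (auto simp: norm_mult nW intro!: AE_I2 mult_left_le w1)
    have mW: "integrable lborel (\<lambda>t. m n t * W t)" for n
    proof (rule Bochner_Integration.integrable_bound)
      define M where "M = (\<integral>u. norm (Fn n u) \<partial>lborel)"
      have M0: "0 \<le> M" unfolding M_def by (rule Bochner_Integration.integral_nonneg) simp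
      show "integrable lborel (\<lambda>t. M * w t)" by (intro integrable_mult_right wi)
      have "norm (m n t) \<le> M" for t
        unfolding m_def M_def using integral_norm_bound[of lborel "\<lambda>u. Fn n u * cis (t * u)"] by (simp add: norm_mult)
      then show "AE t in lborel. norm (m n t * W t) \<le> norm (M * w t)"
        using w1 M0 by (intro AE_I2) (simp add: norm_mult nW mult_right_mono abs_of_nonneg)
    qed measurable
    have "(\<lambda>n. (\<integral>t. m n t * W t \<partial>lborel) - (\<integral>t. g t * W t \<partial>lborel)) \<longlonglongrightarrow> 0"
    proof (rule Lim_null_comparison[OF _ van], rule always_eventually, rule allI)
      fix n
      have "(\<integral>t. m n t * W t \<partial>lborel) - (\<integral>t. g t * W t \<partial>lborel) = (\<integral>t. D n t * W t \<partial>lborel)"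
        unfolding D_def left_diff_distrib by (rule Bochner_Integration.integral_diff[symmetric, OF mW gW])
      also have "norm \<dots> \<le> (\<integral>t. norm (D n t * W t) \<partial>lborel)" by (rule integral_norm_bound)
      finally show "norm ((\<integral>t. m n t * W t \<partial>lborel) - (\<integral>t. g t * W t \<partial>lborel)) \<le> (\<integral>t. w t * norm (D n t) \<partial>lborel)"
        unfolding norm_mult nW by (simp only: mult.commute)
    qed
    then have "(\<lambda>n. \<integral>t. m n t * W t \<partial>lborel) \<longlonglongrightarrow> (\<integral>t. g t * W t \<partial>lborel)" by (simp add: LIM_zero_iff)
    then have R: "(\<lambda>n. (\<integral>t. m n t * W t \<partial>lborel) / of_real (2 * pi)) \<longlonglongrightarrow> (\<integral>t. g t * W t \<partial>lborel) / of_real (2 * pi)"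
      by (intro tendsto_divide tendsto_const) auto
    have L: "(\<lambda>n. \<integral>u. Fn n u * of_real (gauss_kernel e (u - a)) \<partial>lborel) \<longlonglongrightarrow> (\<integral>u. F u * of_real (gauss_kernel e (u - a)) \<partial>lborel)"
    proof (rule integral_dominated_convergence)
      define K where "K = exp (- \<nu> * a + (\<nu> * e)\<^sup>2 / 2) / (e * sqrt (2 * pi))"
      show "integrable lborel (\<lambda>u. norm (exp u *\<^sub>R G u) * K)" using f1 by (intro integrable_mult_left integrable_norm)
      show "AE u in lborel. (\<lambda>n. Fn n u * of_real (gauss_kernel e (u - a))) \<longlonglongrightarrow> F u * of_real (gauss_kernel e (u - a))"
      proof (rule AE_I2)
        fix u :: real
        obtain N :: nat where N: "\<bar>u\<bar> \<le> real N" using real_arch_simple by blast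
        have "\<forall>\<^sub>F n in sequentially. Fn n u * of_real (gauss_kernel e (u - a)) = F u * of_real (gauss_kernel e (u - a))"
          using eventually_ge_at_top[of N]
        proof eventually_elim
          case (elim n)
          then have "u \<in> {- real n..real n}" using N by auto
          then show ?case by (simp add: Fn_def truncate_at_def)
        qed
        then show "(\<lambda>n. Fn n u * of_real (gauss_kernel e (u - a))) \<longlonglongrightarrow> F u * of_real (gauss_kernel e (u - a))" by (rule tendsto_eventually)
      qed
      show "AE u in lborel. norm (Fn n u * of_real (gauss_kernel e (u - a))) \<le> norm (exp u *\<^sub>R G u) * K" for n
      proof (rule AE_I2)
        fix u
        have "norm (Fn n u * of_real (gauss_kernel e (u - a))) \<le> norm (F u) * gauss_kernel e (u - a)"
          unfolding norm_mult norm_of_real abs_of_nonneg[OF gauss_kernel_nonneg[OF e]]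
          by (intro mult_right_mono gauss_kernel_nonneg e) (simp add: Fn_def truncate_at_def indicator_def)
        also have "\<dots> = norm (exp u *\<^sub>R G u) * (exp (- \<nu> * u) * gauss_kernel e (u - a))" by (simp add: F_def norm_mult)
        also have "\<dots> \<le> norm (exp u *\<^sub>R G u) * K"
          unfolding K_def by (intro mult_left_mono exp_times_gauss_kernel_le e) simp
        finally show "norm (Fn n u * of_real (gauss_kernel e (u - a))) \<le> norm (exp u *\<^sub>R G u) * K" .
      qed
    qed measurable
    have "(\<integral>u. Fn n u * of_real (gauss_kernel e (u - a)) \<partial>lborel) = (\<integral>t. m n t * W t \<partial>lborel) / of_real (2 * pi)" for n
      unfolding m_def by (rule pv[OF Fnm Fni])
    then show ?thesis using LIMSEQ_unique[OF L] R by simp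
  qed
  then show ?thesis unfolding lhs W_def w_def .
qed

lemma kernel_smoothing_F_kernel:
  assumes "0 < \<nu>" "\<nu> < 1 / 2"
  shows "kernel_smoothing \<nu> (sqrt 2 * cosh (pi * \<tau>)) (\<lambda>u. F_kernel \<tau> (exp u))"
proof
  fix u
  have "\<bar>F_kernel \<tau> (exp u)\<bar> \<le> 1 * cosh (pi * \<tau>)" using abs_F_kernel_le(1)[of "exp u" \<tau>] by simp
  also have "\<dots> \<le> sqrt 2 * cosh (pi * \<tau>)" by (intro mult_right_mono) auto
  finally show "\<bar>F_kernel \<tau> (exp u)\<bar> \<le> sqrt 2 * cosh (pi * \<tau>)" .
  show "\<bar>F_kernel \<tau> (exp u)\<bar> \<le> sqrt 2 * cosh (pi * \<tau>) * exp (- u / 2)"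
    using abs_F_kernel_le(2)[of "exp u" \<tau>] by (simp add: exp_powr_real mult_ac)
qed (use assms continuous_on_F_kernel_exp in auto)

text \<open>
  The exchange of integrations at the heart of the theorem. The inner integral of the modulus is at most a
  constant times \<open>exp (\<nu> u)\<close>, and \<open>k(exp u) exp (\<nu> u)\<close> is integrable since \<open>0 < \<nu> < 1/2\<close>; integration over \<open>u\<close>
  first produces the Lebedev kernel.
\<close>

lemma lebedev_fubini:
  fixes \<Phi> :: "real \<Rightarrow> complex"
  assumes \<nu>: "0 < \<nu>" "\<nu> < 1 / 2" and q: "1 \<le> q"
    and \<Phi>m[measurable]: "\<Phi> \<in> borel_measurable borel" and \<Phi>: "integrable lborel (\<lambda>v. norm (\<Phi> v) powr q)"
  shows "integrable lborel (\<lambda>v. of_real (exp (\<nu> * v)) * (lebedev_kernel \<tau> (exp v) * \<Phi> v))"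
    and "(\<integral>u. of_real (F_kernel \<tau> (exp u)) * (\<integral>v. of_real (laplace_weight \<nu> u v) * \<Phi> v \<partial>lborel) \<partial>lborel)
       = 2 * (\<integral>v. of_real (exp (\<nu> * v)) * (lebedev_kernel \<tau> (exp v) * \<Phi> v) \<partial>lborel)"
proof -
  interpret kernel_smoothing \<nu> "sqrt 2 * cosh (pi * \<tau>)" "\<lambda>u. F_kernel \<tau> (exp u)"
    by (rule kernel_smoothing_F_kernel[OF \<nu>])
  define H where "H = (\<lambda>u v. of_real (F_kernel \<tau> (exp u)) * (of_real (laplace_weight \<nu> u v) * \<Phi> v))"
  have Hm[measurable]: "(\<lambda>(u, v). H u v) \<in> borel_measurable (lborel \<Otimes>\<^sub>M lborel)" unfolding H_def laplace_weight_def by measurable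
  define N where "N = (\<integral>v. norm (\<Phi> v) powr q \<partial>lborel)"
  have \<nu>1: "\<nu> < 1" using \<nu> by simp
  note w = laplace_weight_integral(1)[OF \<nu>(1)] less_imp_le[OF laplace_weight_pos] laplace_weight_le[OF \<nu>(1) \<nu>1]
  have i1: "integrable lborel (\<lambda>v. laplace_weight \<nu> u v * norm (\<Phi> v))" for u
    by (rule integrable_weight_mult(1)[OF \<Phi>m q \<Phi> w])
  have Hn: "norm (H u v) = \<bar>F_kernel \<tau> (exp u)\<bar> * (laplace_weight \<nu> u v * norm (\<Phi> v))" for u v
    unfolding H_def norm_mult norm_of_real abs_of_pos[OF laplace_weight_pos] ..
  have Hi: "integrable lborel (H u)" for u
  proof (rule Bochner_Integration.integrable_bound)
    show "integrable lborel (\<lambda>v. \<bar>F_kernel \<tau> (exp u)\<bar> * (laplace_weight \<nu> u v * norm (\<Phi> v)))" by (intro integrable_mult_right i1)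
    show "H u \<in> borel_measurable lborel" unfolding H_def by measurable
    show "AE v in lborel. norm (H u v) \<le> norm (\<bar>F_kernel \<tau> (exp u)\<bar> * (laplace_weight \<nu> u v * norm (\<Phi> v)))"
      unfolding Hn real_norm_def by (intro AE_I2 abs_ge_self)
  qed
  have inner: "(\<integral>v. norm (H u v) \<partial>lborel) \<le> \<bar>F_kernel \<tau> (exp u) * exp (\<nu> * u)\<bar> * (Gamma \<nu> + N)" for u
  proof -
    \<comment> \<open>Both terms, with \<open>eta = 1\<close>, are multiples of \<open>exp (\<nu> u)\<close>.\<close>
    have "(\<integral>v. laplace_weight \<nu> u v * norm (\<Phi> v) \<partial>lborel) \<le> 1 * (\<integral>v. laplace_weight \<nu> u v \<partial>lborel) + exp (\<nu> * u) * 1 powr (1 - q) * (\<integral>v. norm (\<Phi> v) powr q \<partial>lborel)"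
      by (rule integrable_weight_mult(2)[OF \<Phi>m q \<Phi> w]) simp
    then have "(\<integral>v. laplace_weight \<nu> u v * norm (\<Phi> v) \<partial>lborel) \<le> exp (\<nu> * u) * (Gamma \<nu> + N)"
      unfolding laplace_weight_integral(2)[OF \<nu>(1)] N_def[symmetric] by (simp add: algebra_simps)
    then have "\<bar>F_kernel \<tau> (exp u)\<bar> * (\<integral>v. laplace_weight \<nu> u v * norm (\<Phi> v) \<partial>lborel) \<le> \<bar>F_kernel \<tau> (exp u)\<bar> * (exp (\<nu> * u) * (Gamma \<nu> + N))"
      by (rule mult_left_mono) simp
    then show ?thesis unfolding Hn integral_mult_right_zero by (simp add: abs_mult mult.assoc)
  qed
  have int: "integrable (lborel \<Otimes>\<^sub>M lborel) (\<lambda>(u, v). H u v)"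
  proof (rule lborel_pair.Fubini_integrable[OF Hm])
    show "AE u in lborel. integrable lborel (\<lambda>v. case (u, v) of (u, v) \<Rightarrow> H u v)" using Hi by simp
    show "integrable lborel (\<lambda>u. \<integral>v. norm (case (u, v) of (u, v) \<Rightarrow> H u v) \<partial>lborel)"
    proof (rule Bochner_Integration.integrable_bound)
      show "integrable lborel (\<lambda>u. \<bar>F_kernel \<tau> (exp u) * exp (\<nu> * u)\<bar> * (Gamma \<nu> + N))"
        by (intro integrable_mult_left integrable_abs integrable_weighted_kernel)
      show "(\<lambda>u. \<integral>v. norm (case (u, v) of (u, v) \<Rightarrow> H u v) \<partial>lborel) \<in> borel_measurable lborel" by measurable
      show "AE u in lborel. norm (\<integral>v. norm (case (u, v) of (u, v) \<Rightarrow> H u v) \<partial>lborel) \<le> norm (\<bar>F_kernel \<tau> (exp u) * exp (\<nu> * u)\<bar> * (Gamma \<nu> + N))"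
      proof (rule AE_I2)
        fix u
        have "0 \<le> (\<integral>v. norm (H u v) \<partial>lborel)" by (rule Bochner_Integration.integral_nonneg) simp
        then show "norm (\<integral>v. norm (case (u, v) of (u, v) \<Rightarrow> H u v) \<partial>lborel) \<le> norm (\<bar>F_kernel \<tau> (exp u) * exp (\<nu> * u)\<bar> * (Gamma \<nu> + N))"
          using inner[of u] by simp
      qed
    qed
  qed
  have col: "(\<integral>u. H u v \<partial>lborel) = 2 * (of_real (exp (\<nu> * v)) * (lebedev_kernel \<tau> (exp v) * \<Phi> v))" for v
  proof -
    have "H u v = (of_real (exp (\<nu> * v)) * \<Phi> v) * of_real (F_kernel \<tau> (exp u) * exp (- exp (v - u)))" for u
    proof -
      have "laplace_weight \<nu> u v = exp (\<nu> * v) * exp (- exp (v - u))" by (simp add: laplace_weight_def exp_diff exp_minus divide_inverse)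
      then show ?thesis unfolding H_def of_real_mult[symmetric] by (simp add: mult_ac)
    qed
    then have "(\<integral>u. H u v \<partial>lborel) = (of_real (exp (\<nu> * v)) * \<Phi> v) * of_real (\<integral>u. F_kernel \<tau> (exp u) * exp (- exp (v - u)) \<partial>lborel)"
      by (simp only: integral_mult_right_zero integral_complex_of_real)
    then show ?thesis unfolding lebedev_kernel_eq_integral(2) by simp
  qed
  have "integrable lborel (\<lambda>v. \<integral>u. H u v \<partial>lborel)"
    using lborel_pair.integrable_snd[OF int] by simp
  then have "integrable lborel (\<lambda>v. (1 / 2) * (2 * (of_real (exp (\<nu> * v)) * (lebedev_kernel \<tau> (exp v) * \<Phi> v))))"
    unfolding col by (rule integrable_mult_right)
  then show "integrable lborel (\<lambda>v. of_real (exp (\<nu> * v)) * (lebedev_kernel \<tau> (exp v) * \<Phi> v))" by simp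
  have "(\<integral>u. of_real (F_kernel \<tau> (exp u)) * (\<integral>v. of_real (laplace_weight \<nu> u v) * \<Phi> v \<partial>lborel) \<partial>lborel) = (\<integral>u. (\<integral>v. H u v \<partial>lborel) \<partial>lborel)"
    unfolding H_def integral_mult_right_zero ..
  also have "\<dots> = (\<integral>v. (\<integral>u. H u v \<partial>lborel) \<partial>lborel)" by (rule lborel_pair.Fubini_integral[OF int, symmetric])
  also have "\<dots> = 2 * (\<integral>v. of_real (exp (\<nu> * v)) * (lebedev_kernel \<tau> (exp v) * \<Phi> v) \<partial>lborel)"
    unfolding col by (rule integral_mult_right_zero)
  finally show "(\<integral>u. of_real (F_kernel \<tau> (exp u)) * (\<integral>v. of_real (laplace_weight \<nu> u v) * \<Phi> v \<partial>lborel) \<partial>lborel)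
       = 2 * (\<integral>v. of_real (exp (\<nu> * v)) * (lebedev_kernel \<tau> (exp v) * \<Phi> v) \<partial>lborel)" .
qed

lemma measurable_lebedev_kernel_exp [measurable]: "(\<lambda>v. lebedev_kernel \<tau> (exp v)) \<in> borel_measurable borel"
  unfolding lebedev_kernel_eq_integral(2) by measurable

text \<open>
  Here \<open>h0\<close> is a Borel representative of \<open>f\<^sup>*(s) / \<Gamma>(1 - s)\<close> on the line and \<open>g = h0 \<Gamma>\<close> one of \<open>f\<^sup>*\<close>. The chain runs
  from \<open>\<integral> k f\<close> over the inverse Fourier integral of \<open>g\<close> (inversion against \<open>k\<close>) and the Laplace-type integral of
  \<open>\<phi>\<close> to the integral of \<open>\<phi>\<close> against the Lebedev kernel.
\<close>

lemma F_transform_eq_lebedev_transform: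
  fixes H :: "complex \<Rightarrow> complex"
  assumes f: "f \<in> L1_pos" and \<nu>: "0 < \<nu>" "\<nu> < 1 / 2" and p: "1 < p" "p \<le> 2" and q: "q = p / (p - 1)"
    and mel: "is_mellin_transform f (1 - \<nu>) fs"
    and H: "H = (\<lambda>s. fs s / Gamma (1 - s))" and HL: "H \<in> line_Lp (1 - \<nu>) p"
  shows "\<exists>\<phi>. is_inv_mellin_in_mean (1 - \<nu>) q H \<phi>"
    and "is_inv_mellin_in_mean (1 - \<nu>) q H \<phi> \<Longrightarrow> set_integrable lebesgue {0<..} (\<lambda>x. lebedev_kernel \<tau> x * \<phi> x)"
    and "is_inv_mellin_in_mean (1 - \<nu>) q H \<phi> \<Longrightarrow> F_transform f \<tau> = of_real (2 * sqrt pi / cosh (pi * \<tau>)) * (LINT x:{0<..}|lebesgue. lebedev_kernel \<tau> x * \<phi> x)"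
proof -
  have q1: "1 < q" using p unfolding q by (simp add: field_simps)
  obtain G where G: "G \<in> borel_measurable borel" "AE u in lborel. f (exp u) = G u" "integrable lborel (\<lambda>u. exp u *\<^sub>R G u)"
    by (rule L1_pos_log_representative[OF f])
  have "(\<lambda>t. H (Complex (1 - \<nu>) t)) \<in> borel_measurable lebesgue" using HL by (simp add: line_Lp_def)
  from lebesgue_borel_representative[OF this] obtain h0 where
    hm[measurable]: "h0 \<in> borel_measurable borel" and hae: "AE t in lborel. H (Complex (1 - \<nu>) t) = h0 t" by (elim bexE)
  have hp: "integrable lborel (\<lambda>t. norm (h0 t) powr p)"
  proof -
    have "AE t in lborel. norm (H (Complex (1 - \<nu>) t)) powr p = norm (h0 t) powr p" using hae by eventually_elim simp
    then show ?thesis using lebesgue_eq_lborel_AE(2)[of "\<lambda>t. norm (h0 t) powr p" "\<lambda>t. norm (H (Complex (1 - \<nu>) t)) powr p"] HL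
      by (simp add: line_Lp_def)
  qed
  show "\<exists>\<phi>. is_inv_mellin_in_mean (1 - \<nu>) q H \<phi>"
    by (rule inv_mellin_exists[OF p q hm hp hae])
  define g where "g = (\<lambda>t. h0 t * Gamma (Complex \<nu> (- t)))"
  have gm[measurable]: "g \<in> borel_measurable borel" unfolding g_def using \<nu>(1) by measurable
  have gi: "integrable lborel g" unfolding g_def by (rule integrable_mult_Gamma_line[OF _ _ hm _ hp]) (use \<nu> p in auto)
  have gae: "AE t in lborel. fs (Complex (1 - \<nu>) t) = g t"
    using hae
  proof eventually_elim
    case (elim t)
    have e: "1 - Complex (1 - \<nu>) t = Complex \<nu> (- t)" by (simp add: complex_eq_iff)
    have "Complex \<nu> (- t) \<notin> \<int>\<^sub>\<le>\<^sub>0" using \<nu> by (auto elim!: nonpos_Ints_cases simp: complex_eq_iff)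
    then have "Gamma (Complex \<nu> (- t)) \<noteq> 0" by (simp add: Gamma_eq_zero_iff)
    then show ?case using elim unfolding H g_def e by (simp add: field_simps)
  qed
  assume \<phi>: "is_inv_mellin_in_mean (1 - \<nu>) q H \<phi>"
  obtain \<Phi> where \<Phi>m[measurable]: "\<Phi> \<in> borel_measurable borel"
    and \<Phi>ae: "AE v in lborel. \<phi> (exp v) = of_real (exp (- (1 - \<nu>) * v)) * \<Phi> v"
    and \<Phi>i: "integrable lborel (\<lambda>v. norm (\<Phi> v) powr q)"
    and ev: "\<forall>\<^sub>F n in sequentially. integrable lborel (\<lambda>v. norm (fourier (truncate_at h0 (real n)) v / of_real (2 * pi) - \<Phi> v) powr q)"
    and lim: "(\<lambda>n. \<integral>v. norm (fourier (truncate_at h0 (real n)) v / of_real (2 * pi) - \<Phi> v) powr q \<partial>lborel) \<longlonglongrightarrow> 0"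
    by (rule inv_mellin_log[OF q1 hm hae \<phi>])
  have L: "(\<integral>v. of_real (laplace_weight \<nu> u v) * \<Phi> v \<partial>lborel) = of_real (exp (\<nu> * u)) * (fourier g u / of_real (2 * pi))" for u
    unfolding g_def by (rule laplace_of_inv_mellin[OF _ _ _ _ hm hp \<Phi>m \<Phi>i ev lim]) (use \<nu> p q1 in auto)
  have lm: "(\<lambda>v. lebedev_kernel \<tau> (exp v) * (of_real (exp (- (1 - \<nu>) * v)) * \<Phi> v)) \<in> borel_measurable borel" by measurable
  have lae: "AE v in lborel. lebedev_kernel \<tau> (exp v) * \<phi> (exp v) = lebedev_kernel \<tau> (exp v) * (of_real (exp (- (1 - \<nu>) * v)) * \<Phi> v)"
    using \<Phi>ae by eventually_elim simp
  have eq: "exp v *\<^sub>R (lebedev_kernel \<tau> (exp v) * (of_real (exp (- (1 - \<nu>) * v)) * \<Phi> v)) = of_real (exp (\<nu> * v)) * (lebedev_kernel \<tau> (exp v) * \<Phi> v)" for v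
  proof -
    have "exp v * exp (- (1 - \<nu>) * v) = exp (\<nu> * v)" unfolding exp_add[symmetric] by (simp add: algebra_simps)
    from arg_cong[OF this, of complex_of_real] show ?thesis by (simp add: scaleR_conv_of_real mult_ac)
  qed
  note half = half_line_integral_log[of _ "\<lambda>x. lebedev_kernel \<tau> x * \<phi> x", OF lm lae, unfolded eq]
  note fub = lebedev_fubini[OF \<nu> less_imp_le[OF q1] \<Phi>m \<Phi>i]
  show "set_integrable lebesgue {0<..} (\<lambda>x. lebedev_kernel \<tau> x * \<phi> x)"
    using half(1) fub(1) by simp
  interpret kernel_smoothing \<nu> "sqrt 2 * cosh (pi * \<tau>)" "\<lambda>u. F_kernel \<tau> (exp u)"
    by (rule kernel_smoothing_F_kernel[OF \<nu>])
  have "(\<integral>u. of_real (F_kernel \<tau> (exp u)) * (exp u *\<^sub>R G u) \<partial>lborel)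
     = (\<integral>u. of_real (F_kernel \<tau> (exp u) * exp (\<nu> * u)) * (fourier g u / of_real (2 * pi)) \<partial>lborel)"
  proof (rule inversion_against_kernel[OF _ G(3) gm gi])
    show "(\<lambda>u. exp u *\<^sub>R G u) \<in> borel_measurable borel" using G(1) by measurable
    show "(\<integral>u. (exp u *\<^sub>R G u) * of_real (exp (- \<nu> * u) * gauss_kernel e (u - a)) \<partial>lborel)
       = (\<integral>t. g t * (of_real (exp (- (e * t)\<^sup>2 / 2)) * cis (- (t * a))) \<partial>lborel) / of_real (2 * pi)" if "0 < e" for e a
      by (rule mellin_gauss_smoothing[OF G mel gm gi gae \<nu>(1) that])
  qed
  also have "\<dots> = (\<integral>u. of_real (F_kernel \<tau> (exp u)) * (\<integral>v. of_real (laplace_weight \<nu> u v) * \<Phi> v \<partial>lborel) \<partial>lborel)"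
    unfolding L of_real_mult mult.assoc ..
  also have "\<dots> = 2 * (LINT x:{0<..}|lebesgue. lebedev_kernel \<tau> x * \<phi> x)"
    unfolding fub(2) half(2) ..
  finally show "F_transform f \<tau> = of_real (2 * sqrt pi / cosh (pi * \<tau>)) * (LINT x:{0<..}|lebesgue. lebedev_kernel \<tau> x * \<phi> x)"
    unfolding F_transform_log(2)[OF G] by simp
qed

theorem theorem1:
  "(\<forall>f\<in>L1_pos.
      (\<forall>\<tau>. set_integrable lebesgue {0<..} (\<lambda>x. of_real (F_kernel \<tau> x) * f x)) \<and>
      F_transform f \<in> bcontfun \<and>
      (SUP \<tau>. norm (F_transform f \<tau>)) \<le> sqrt pi * L1_norm f) \<and>
   (\<forall>f\<in>L1_pos. \<forall>g\<in>L1_pos.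
      (AE x in lebesgue. x > 0 \<longrightarrow> f x = g x) \<longrightarrow> F_transform f = F_transform g) \<and>
   (\<forall>f\<in>L1_pos. \<forall>g\<in>L1_pos. \<forall>a b :: complex. \<forall>\<tau>.
      F_transform (\<lambda>x. a * f x + b * g x) \<tau> = a * F_transform f \<tau> + b * F_transform g \<tau>) \<and>
   (\<forall>f\<in>L1_pos. \<forall>(\<nu>::real) (p::real) (q::real) (fstar :: complex \<Rightarrow> complex).
      0 < \<nu> \<and> \<nu> < 1 / 2 \<and> 1 < p \<and> p \<le> 2 \<and> q = p / (p - 1) \<and>
      is_mellin_transform f (1 - \<nu>) fstar \<and>
      (\<lambda>s. fstar s / Gamma (1 - s)) \<in> line_Lp (1 - \<nu>) p \<longrightarrow>
      (\<exists>\<phi>. is_inv_mellin_in_mean (1 - \<nu>) q (\<lambda>s. fstar s / Gamma (1 - s)) \<phi>) \<and>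
      (\<forall>\<phi>. is_inv_mellin_in_mean (1 - \<nu>) q (\<lambda>s. fstar s / Gamma (1 - s)) \<phi> \<longrightarrow>
         (\<forall>\<tau>. set_integrable lebesgue {0<..} (\<lambda>x. lebedev_kernel \<tau> x * \<phi> x) \<and>
              F_transform f \<tau> =
                of_real (2 * sqrt pi / cosh (pi * \<tau>)) *
                (LINT x:{0<..}|lebesgue. lebedev_kernel \<tau> x * \<phi> x))))"
proof (intro conjI ballI allI impI; (elim conjE)?)
  fix f assume f: "f \<in> L1_pos"
  show "set_integrable lebesgue {0<..} (\<lambda>x. of_real (F_kernel \<tau> x) * f x)" for \<tau>
    by (rule F_transform_integrable[OF f])
  show "F_transform f \<in> bcontfun" by (rule F_transform_bounded_continuous(1)[OF f])
  show "(SUP \<tau>. norm (F_transform f \<tau>)) \<le> sqrt pi * L1_norm f"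
    by (rule cSUP_least) (simp, rule F_transform_bounded_continuous(2)[OF f])
next
  fix f g assume "f \<in> L1_pos" "AE x in lebesgue. x > 0 \<longrightarrow> f x = g x"
  then show "F_transform f = F_transform g" by (rule F_transform_cong_AE)
next
  fix f g a b \<tau> assume "f \<in> L1_pos" "g \<in> L1_pos"
  then show "F_transform (\<lambda>x. a * f x + b * g x) \<tau> = a * F_transform f \<tau> + b * F_transform g \<tau>" by (rule F_transform_linear)
next
  fix f :: "real \<Rightarrow> complex" and \<nu> p q :: real and fstar
  assume "f \<in> L1_pos" "0 < \<nu>" "\<nu> < 1 / 2" "1 < p" "p \<le> 2" "q = p / (p - 1)" "is_mellin_transform f (1 - \<nu>) fstar"
    "(\<lambda>s. fstar s / Gamma (1 - s)) \<in> line_Lp (1 - \<nu>) p"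
  note * = F_transform_eq_lebedev_transform[OF this(1-7) refl this(8)]
  show "\<exists>\<phi>. is_inv_mellin_in_mean (1 - \<nu>) q (\<lambda>s. fstar s / Gamma (1 - s)) \<phi>" by (rule *(1))
  fix \<phi> \<tau> assume \<phi>: "is_inv_mellin_in_mean (1 - \<nu>) q (\<lambda>s. fstar s / Gamma (1 - s)) \<phi>"
  show "set_integrable lebesgue {0<..} (\<lambda>x. lebedev_kernel \<tau> x * \<phi> x)" by (rule *(2)[OF \<phi>])
  show "F_transform f \<tau> = of_real (2 * sqrt pi / cosh (pi * \<tau>)) * (LINT x:{0<..}|lebesgue. lebedev_kernel \<tau> x * \<phi> x)" by (rule *(3)[OF \<phi>])
qed

end
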